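(* Suppose $M\subseteq\mathbb{R}^2$ is a connected smooth hypersurface (i.e. a smooth one-dimensional submanifold of $\mathbb{R}^2$) of finite type. Let $\mu$ be a smooth measure on $M$. Then the Weyl transform $W(\mu)$ is a compact operator on $L^2(\mathbb{R})$.
   Context: A submanifold is of finite type if at each of its points it has at most a finite order of contact with any affine hyperplane. For a one-dimensional submanifold $M$ of $\mathbb{R}^2$ this means: for every $p\in M$, every smooth regular local parametrization $\gamma$ of $M$ with $\gamma(s_0)=p$, and every unit vector $v\in\mathbb{R}^2$, there is an integer $k\ge 1$ with $\langle\gamma^{(k)}(s_0),v\rangle\neq 0$. A smooth measure on a smooth submanifold $M$ of $\mathbb{R}^{N}$ is a measure of the form $\mu=\psi\sigma$, where $\sigma$ is the measure on $M$ induced by Lebesgue measure on $\mathbb{R}^N$ (the Riemannian volume measure of the induced metric; arc length for curves), and $\psi$ is a smooth (complex-valued) function on $\mathbb{R}^N$ whose support intersects $M$ in a compact set. Such a $\mu$ is regarded as a finite (complex) Borel measure on $\mathbb{R}^N$. For a finite (complex) Borel measure $\lambda$ on $\mathbb{R}^{2}$, the Weyl transform of $\lambda$ is the bounded operator $W(\lambda)$ on $L^2(\mathbb{R})$ defined by $$(W(\lambda)\varphi)(t)=\int_{\mathbb{R}^{2}} e^{\pi i(xy+2yt)}\,\varphi(t+x)\,d\lambda(x,y),\qquad \varphi\in L^2(\mathbb{R}).$$ *)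

theory Defs
  imports "HOL-Analysis.Analysis"
begin

section \<open>Smooth maps and one-dimensional submanifolds of the plane\<close>

text \<open>
  \<open>Ck_on k S f\<close> is meant for open \<open>S\<close> in a finite-dimensional space, where the derivative is
  unique and a map is of class \<open>C\<^sup>k\<^sup>+\<^sup>1\<close> iff it is differentiable and all its directional
  derivatives are of class \<open>C\<^sup>k\<close>.
\<close>

primrec Ck_on :: "nat \<Rightarrow> 'a::euclidean_space set \<Rightarrow> ('a \<Rightarrow> 'b::real_normed_vector) \<Rightarrow> bool" where
  "Ck_on 0 S f \<longleftrightarrow> continuous_on S f"
| "Ck_on (Suc k) S f \<longleftrightarrow>
     (\<exists>f'. (\<forall>x\<in>S. (f has_derivative f' x) (at x)) \<and> (\<forall>v. Ck_on k S (\<lambda>x. f' x v)))"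

definition smooth_on :: "'a::euclidean_space set \<Rightarrow> ('a \<Rightarrow> 'b::real_normed_vector) \<Rightarrow> bool" where
  "smooth_on S f \<longleftrightarrow> (\<forall>k. Ck_on k S f)"

definition curve_deriv :: "nat \<Rightarrow> (real \<Rightarrow> 'b::real_normed_vector) \<Rightarrow> real \<Rightarrow> 'b" where
  "curve_deriv k \<gamma> = ((\<lambda>c s. vector_derivative c (at s)) ^^ k) \<gamma>"

definition regular_param :: "(real \<times> real) set \<Rightarrow> real set \<Rightarrow> (real \<Rightarrow> real \<times> real) \<Rightarrow> bool" where
  "regular_param M I \<gamma> \<longleftrightarrow>
     open I \<and> is_interval I \<and> smooth_on I \<gamma> \<and> (\<forall>s\<in>I. curve_deriv 1 \<gamma> s \<noteq> 0) \<and>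
     openin (top_of_set M) (\<gamma> ` I) \<and> (\<exists>g. homeomorphism I (\<gamma> ` I) \<gamma> g)"

text \<open>Submanifolds are embedded, but need not be closed subsets of the plane.\<close>

definition smooth_curve_submanifold :: "(real \<times> real) set \<Rightarrow> bool" where
  "smooth_curve_submanifold M \<longleftrightarrow> (\<forall>p\<in>M. \<exists>I \<gamma>. regular_param M I \<gamma> \<and> p \<in> \<gamma> ` I)"

definition finite_type :: "(real \<times> real) set \<Rightarrow> bool" where
  "finite_type M \<longleftrightarrow>
     (\<forall>p\<in>M. \<forall>I \<gamma> s\<^sub>0 v. regular_param M I \<gamma> \<and> s\<^sub>0 \<in> I \<and> \<gamma> s\<^sub>0 = p \<and> norm v = 1 \<longrightarrow>
        (\<exists>k\<ge>1. curve_deriv k \<gamma> s\<^sub>0 \<bullet> v \<noteq> 0))"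

section \<open>Smooth measures\<close>

text \<open>
  The arc-length measure of \<open>M\<close>, as a Borel measure on the plane: it lives on \<open>M\<close>, and in every
  local parametrization it is \<open>\<bar>\<gamma>'(s)\<bar> ds\<close>. As countably many parametrized pieces cover \<open>M\<close>,
  these conditions determine \<open>\<sigma>\<close> uniquely.
\<close>

definition arc_length_measure :: "(real \<times> real) set \<Rightarrow> (real \<times> real) measure \<Rightarrow> bool" where
  "arc_length_measure M \<sigma> \<longleftrightarrow>
     sets \<sigma> = sets borel \<and> (AE z in \<sigma>. z \<in> M) \<and>
     (\<forall>I \<gamma>. regular_param M I \<gamma> \<longrightarrow>
        (\<forall>B\<in>sets borel. emeasure \<sigma> (B \<inter> \<gamma> ` I) =
           (\<integral>\<^sup>+s. ennreal (norm (curve_deriv 1 \<gamma> s)) * indicator (I \<inter> \<gamma> -` B) s \<partial>lborel)))"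

text \<open>
  A finite complex Borel measure is represented as \<open>\<psi> \<sigma>\<close>, with \<open>\<sigma>\<close> a positive Borel measure and
  \<open>\<psi>\<close> a complex \<open>\<sigma>\<close>-integrable density; integration against it is
  \<open>h \<mapsto> \<integral> h \<psi> d\<sigma>\<close>.
\<close>

definition smooth_measure ::
    "(real \<times> real) set \<Rightarrow> (real \<times> real) measure \<Rightarrow> (real \<times> real \<Rightarrow> complex) \<Rightarrow> bool" where
  "smooth_measure M \<sigma> \<psi> \<longleftrightarrow>
     arc_length_measure M \<sigma> \<and> smooth_on UNIV \<psi> \<and> compact (closure {z. \<psi> z \<noteq> 0} \<inter> M)"

section \<open>The space of square-integrable functions on the line\<close>

definition square_integrable :: "(real \<Rightarrow> complex) \<Rightarrow> bool" where
  "square_integrable f \<longleftrightarrow>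
     f \<in> borel_measurable lborel \<and> integrable lborel (\<lambda>t. (cmod (f t))\<^sup>2)"

definition L2_rel :: "(real \<Rightarrow> complex) \<Rightarrow> (real \<Rightarrow> complex) \<Rightarrow> bool" where
  "L2_rel f g \<longleftrightarrow> square_integrable f \<and> square_integrable g \<and> (AE t in lborel. f t = g t)"

lemma square_integrable_zero: "square_integrable (\<lambda>t. 0)"
  by (simp add: square_integrable_def)

lemma square_integrable_cmult:
  assumes "square_integrable f"
  shows "square_integrable (\<lambda>t. c * f t)"
  using assms by (auto simp: square_integrable_def norm_mult power_mult_distrib)

lemma square_integrable_add:
  assumes f: "square_integrable f" and g: "square_integrable g"
  shows "square_integrable (\<lambda>t. f t + g t)"
proof -
  have [measurable]: "f \<in> borel_measurable lborel" "g \<in> borel_measurable lborel"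
    using f g by (auto simp: square_integrable_def)
  have le: "(cmod (a + b))\<^sup>2 \<le> 2 * (cmod a)\<^sup>2 + 2 * (cmod b)\<^sup>2" for a b :: complex
  proof -
    have "(cmod (a + b))\<^sup>2 \<le> (cmod a + cmod b)\<^sup>2"
      by (simp add: norm_triangle_ineq)
    also have "\<dots> \<le> 2 * (cmod a)\<^sup>2 + 2 * (cmod b)\<^sup>2"
      using sum_squares_bound[of "cmod a" "cmod b"] by (simp add: power2_sum)
    finally show ?thesis .
  qed
  have "integrable lborel (\<lambda>t. 2 * (cmod (f t))\<^sup>2 + 2 * (cmod (g t))\<^sup>2)"
    using f g by (auto simp: square_integrable_def)
  then have "integrable lborel (\<lambda>t. (cmod (f t + g t))\<^sup>2)"
    by (rule Bochner_Integration.integrable_bound) (auto simp: le intro!: AE_I2)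
  then show ?thesis
    by (simp add: square_integrable_def)
qed

lemma square_integrable_inner:
  assumes f: "square_integrable f" and g: "square_integrable g"
  shows "integrable lborel (\<lambda>t. f t \<bullet> g t)"
proof -
  have [measurable]: "f \<in> borel_measurable lborel" "g \<in> borel_measurable lborel"
    using f g by (auto simp: square_integrable_def)
  have le: "\<bar>a \<bullet> b\<bar> \<le> (cmod a)\<^sup>2 + (cmod b)\<^sup>2" for a b :: complex
    using Cauchy_Schwarz_ineq2[of a b] sum_squares_bound[of "cmod a" "cmod b"]
      mult_nonneg_nonneg[OF norm_ge_zero[of a] norm_ge_zero[of b]] by linarith
  have "integrable lborel (\<lambda>t. (cmod (f t))\<^sup>2 + (cmod (g t))\<^sup>2)"
    using f g by (auto simp: square_integrable_def)
  then show ?thesis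
    by (rule Bochner_Integration.integrable_bound) (auto simp: intro!: AE_I2 order_trans[OF le])
qed

lemma L2_relI:
  assumes "square_integrable g" "\<And>t. f t = g t"
  shows "L2_rel f g"
proof -
  have "f = g" using assms(2) by auto
  then show ?thesis using assms(1) by (simp add: L2_rel_def)
qed

quotient_type L2 = "real \<Rightarrow> complex" / partial: L2_rel
proof (rule part_equivpI)
  show "\<exists>f. L2_rel f f"
    using square_integrable_zero by (auto simp: L2_rel_def)
  show "symp L2_rel"
    by (auto simp: symp_def L2_rel_def eq_commute)
  show "transp L2_rel"
    by (auto simp: transp_def L2_rel_def elim!: AE_mp)
qed

lift_definition cscale_L2 :: "complex \<Rightarrow> L2 \<Rightarrow> L2" is "\<lambda>c f t. c * f t"
  by (auto simp: L2_rel_def square_integrable_cmult)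

instantiation L2 :: real_vector
begin

lift_definition zero_L2 :: L2 is "\<lambda>t. 0"
  by (simp add: L2_rel_def square_integrable_zero)

lift_definition plus_L2 :: "L2 \<Rightarrow> L2 \<Rightarrow> L2" is "\<lambda>f g t. f t + g t"
  by (auto simp: L2_rel_def square_integrable_add)

definition scaleR_L2 :: "real \<Rightarrow> L2 \<Rightarrow> L2" where
  "scaleR_L2 r f = cscale_L2 (of_real r) f"

definition uminus_L2 :: "L2 \<Rightarrow> L2" where
  "uminus_L2 f = cscale_L2 (- 1) f"

definition minus_L2 :: "L2 \<Rightarrow> L2 \<Rightarrow> L2" where
  "minus_L2 f g = f + cscale_L2 (- 1) g"

instance
proof
  fix x y z :: L2 and a b :: real
  note defs = scaleR_L2_def uminus_L2_def minus_L2_def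
  show "x + y + z = x + (y + z)"
    by transfer (rule L2_relI; simp add: L2_rel_def algebra_simps square_integrable_add)
  show "x + y = y + x"
    by transfer (rule L2_relI; simp add: L2_rel_def algebra_simps square_integrable_add)
  show "0 + x = x"
    by transfer simp
  show "- x + x = 0"
    unfolding defs by transfer (rule L2_relI; simp add: L2_rel_def square_integrable_zero square_integrable_add square_integrable_cmult)
  show "x - y = x + - y"
    by (simp add: defs)
  show "a *\<^sub>R (x + y) = a *\<^sub>R x + a *\<^sub>R y"
    unfolding defs
    by transfer (rule L2_relI; simp add: L2_rel_def distrib_left square_integrable_add square_integrable_cmult)
  show "(a + b) *\<^sub>R x = a *\<^sub>R x + b *\<^sub>R x"
    unfolding defs by transfer (rule L2_relI; simp add: L2_rel_def distrib_right square_integrable_add square_integrable_cmult)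
  show "a *\<^sub>R b *\<^sub>R x = (a * b) *\<^sub>R x"
    unfolding defs by transfer (rule L2_relI; simp add: L2_rel_def square_integrable_cmult)
  show "1 *\<^sub>R x = x"
    unfolding defs by transfer simp
qed

end

text \<open>
  Note \<open>z \<bullet> w = Re (z * cnj w)\<close> for complex \<open>z\<close>, \<open>w\<close>: the inner product below is the real part
  of the usual one and induces the usual norm.
\<close>

instantiation L2 :: real_inner
begin

lift_definition inner_L2 :: "L2 \<Rightarrow> L2 \<Rightarrow> real" is "\<lambda>f g. integral\<^sup>L lborel (\<lambda>t. f t \<bullet> g t)"
proof -
  fix f f' g g'
  assume "L2_rel f f'" "L2_rel g g'"
  then show "integral\<^sup>L lborel (\<lambda>t. f t \<bullet> g t) = integral\<^sup>L lborel (\<lambda>t. f' t \<bullet> g' t)"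
    by (intro integral_cong_AE) (auto simp: L2_rel_def square_integrable_def)
qed

definition norm_L2 :: "L2 \<Rightarrow> real" where
  "norm_L2 f = sqrt (f \<bullet> f)"

definition sgn_L2 :: "L2 \<Rightarrow> L2" where
  "sgn_L2 f = f /\<^sub>R norm f"

definition dist_L2 :: "L2 \<Rightarrow> L2 \<Rightarrow> real" where
  "dist_L2 f g = norm (f - g)"

definition uniformity_L2 :: "(L2 \<times> L2) filter" where
  "uniformity_L2 = (INF e\<in>{0<..}. principal {(x, y). dist x y < e})"

definition open_L2 :: "L2 set \<Rightarrow> bool" where
  "open_L2 U = (\<forall>x\<in>U. eventually (\<lambda>(x', y). x' = x \<longrightarrow> y \<in> U) uniformity)"

instance
proof
  fix x y z :: L2 and r :: real and U :: "L2 set"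
  show "dist x y = norm (x - y)" "sgn x = x /\<^sub>R norm x" "norm x = sqrt (x \<bullet> x)"
    by (simp_all add: dist_L2_def sgn_L2_def norm_L2_def)
  show "uniformity = (INF e\<in>{0<..}. principal {(x, y :: L2). dist x y < e})"
    by (rule uniformity_L2_def)
  show "open U \<longleftrightarrow> (\<forall>x\<in>U. \<forall>\<^sub>F (x', y) in uniformity. x' = x \<longrightarrow> y \<in> U)"
    by (rule open_L2_def)
  show "x \<bullet> y = y \<bullet> x"
    by transfer (simp add: inner_commute)
  show "(x + y) \<bullet> z = x \<bullet> z + y \<bullet> z"
    by transfer (simp add: L2_rel_def inner_add_left square_integrable_inner)
  have of_real: "(of_real r * a) \<bullet> b = r * (a \<bullet> b)" for a b :: complex and r :: real
    by (simp add: scaleR_conv_of_real[symmetric])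
  show "(r *\<^sub>R x) \<bullet> y = r * (x \<bullet> y)"
    unfolding scaleR_L2_def by transfer (simp only: of_real integral_mult_right_zero)
  show "0 \<le> x \<bullet> x"
    by transfer simp
  show "x \<bullet> x = 0 \<longleftrightarrow> x = 0"
  proof transfer
    fix f assume f: "L2_rel f f"
    then have "integral\<^sup>L lborel (\<lambda>t. f t \<bullet> f t) = 0 \<longleftrightarrow> (AE t in lborel. f t \<bullet> f t = 0)"
      by (intro integral_nonneg_eq_0_iff_AE) (auto simp: L2_rel_def square_integrable_inner)
    then show "integral\<^sup>L lborel (\<lambda>t. f t \<bullet> f t) = 0 \<longleftrightarrow> L2_rel f (\<lambda>t. 0)"
      using f by (simp add: L2_rel_def square_integrable_zero)
  qed
qed

end

definition compact_operator :: "(L2 \<Rightarrow> L2) \<Rightarrow> bool" where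
  "compact_operator T \<longleftrightarrow>
     bounded_linear T \<and> (\<forall>c f. T (cscale_L2 c f) = cscale_L2 c (T f)) \<and>
     compact (closure (T ` cball 0 1))"

section \<open>The Weyl transform\<close>

definition weyl_fun ::
    "(real \<times> real) measure \<Rightarrow> (real \<times> real \<Rightarrow> complex) \<Rightarrow> (real \<Rightarrow> complex) \<Rightarrow> real \<Rightarrow> complex" where
  "weyl_fun \<sigma> \<psi> f t =
     (\<integral>(x, y). exp (of_real pi * \<i> * of_real (x * y + 2 * y * t)) * f (t + x) * \<psi> (x, y) \<partial>\<sigma>)"

text \<open>
  The class of \<open>weyl_fun \<sigma> \<psi> f\<close> does not depend on the representative \<open>f\<close> chosen here, and the
  integral converges for almost every \<open>t\<close>; see \<open>weyl_transform_abs\<close> and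
  \<open>weyl_fun_integrable\<close> below.
\<close>

definition weyl_transform ::
    "(real \<times> real) measure \<Rightarrow> (real \<times> real \<Rightarrow> complex) \<Rightarrow> L2 \<Rightarrow> L2" where
  "weyl_transform \<sigma> \<psi> \<phi> = abs_L2 (weyl_fun \<sigma> \<psi> (rep_L2 \<phi>))"

context
  fixes \<sigma> :: "(real \<times> real) measure" and \<psi> :: "real \<times> real \<Rightarrow> complex"
  assumes sets_\<sigma>: "sets \<sigma> = sets borel" and int_\<psi>: "integrable \<sigma> \<psi>"
begin

abbreviation (input) total_var :: "(real \<times> real) measure" where
  "total_var \<equiv> density \<sigma> (\<lambda>z. ennreal (cmod (\<psi> z)))"

lemma sets_\<sigma>' [measurable_cong]: "sets \<sigma> = sets (borel \<Otimes>\<^sub>M borel)"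
  by (simp only: sets_\<sigma> borel_prod)

lemma space_\<sigma>: "space \<sigma> = UNIV"
  using sets_eq_imp_space_eq[OF sets_\<sigma>] by simp

lemma measurable_\<psi> [measurable]: "\<psi> \<in> borel_measurable (borel \<Otimes>\<^sub>M borel)"
  using borel_measurable_integrable[OF int_\<psi>] measurable_cong_sets[OF sets_\<sigma>' refl] by blast

lemma finite_total_var: "finite_measure total_var"
proof
  have "emeasure total_var (space total_var) = (\<integral>\<^sup>+z. ennreal (cmod (\<psi> z)) \<partial>\<sigma>)"
    by (subst emeasure_density) (auto intro!: nn_integral_cong)
  then show "emeasure total_var (space total_var) \<noteq> \<infinity>"
    using int_\<psi> by (simp add: integrable_iff_bounded)
qed

lemma nn_integral_translates:
  assumes [measurable]: "g \<in> borel_measurable borel"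
  shows "(\<integral>\<^sup>+t. (\<integral>\<^sup>+z. g (t + fst z) \<partial>total_var) \<partial>lborel) =
    emeasure total_var UNIV * (\<integral>\<^sup>+t. g t \<partial>lborel)"
proof -
  interpret finite_measure total_var by (rule finite_total_var)
  interpret pair_sigma_finite total_var lborel ..
  have "(\<integral>\<^sup>+t. (\<integral>\<^sup>+z. g (t + fst z) \<partial>total_var) \<partial>lborel) =
      (\<integral>\<^sup>+z. (\<integral>\<^sup>+t. g (t + fst z) \<partial>lborel) \<partial>total_var)"
    by (rule Fubini') measurable
  also have "\<dots> = (\<integral>\<^sup>+z. (\<integral>\<^sup>+t. g t \<partial>lborel) \<partial>total_var)"
  proof (rule nn_integral_cong)
    fix z :: "real \<times> real"
    show "(\<integral>\<^sup>+t. g (t + fst z) \<partial>lborel) = (\<integral>\<^sup>+t. g t \<partial>lborel)"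
      using nn_integral_real_affine[of g 1 "fst z"] by (simp add: add.commute)
  qed
  finally show ?thesis
    by (simp add: space_\<sigma> mult.commute)
qed

lemma norm_sgn_cancel: "cmod w *\<^sub>R (a * sgn w) = a * w"
  by (cases "w = 0") (auto simp: sgn_div_norm)

lemma weyl_fun_eq:
  assumes [measurable]: "f \<in> borel_measurable borel"
  shows "weyl_fun \<sigma> \<psi> f t =
    (\<integral>z. exp (of_real pi * \<i> * of_real (fst z * snd z + 2 * snd z * t)) * f (t + fst z) *
      sgn (\<psi> z) \<partial>total_var)"
proof -
  have "(\<integral>z. exp (of_real pi * \<i> * of_real (fst z * snd z + 2 * snd z * t)) * f (t + fst z) *
      sgn (\<psi> z) \<partial>total_var) =
    (\<integral>z. cmod (\<psi> z) *\<^sub>R (exp (of_real pi * \<i> * of_real (fst z * snd z + 2 * snd z * t)) *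
      f (t + fst z) * sgn (\<psi> z)) \<partial>\<sigma>)"
    by (rule integral_density) auto
  also have "\<dots> = weyl_fun \<sigma> \<psi> f t"
    unfolding weyl_fun_def
    by (rule Bochner_Integration.integral_cong) (auto simp: norm_sgn_cancel)
  finally show ?thesis ..
qed

lemma AE_translates:
  assumes "square_integrable f" "square_integrable g" "AE t in lborel. f t = g t"
  shows "AE t in lborel. AE z in total_var. f (t + fst z) = g (t + fst z)"
proof -
  interpret finite_measure total_var by (rule finite_total_var)
  have [measurable]: "f \<in> borel_measurable borel" "g \<in> borel_measurable borel"
    using assms by (auto simp: square_integrable_def)
  define h :: "real \<Rightarrow> ennreal" where "h t = (if f t = g t then 0 else 1)" for t
  have [measurable]: "h \<in> borel_measurable borel"
    unfolding h_def by measurable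
  have "(\<integral>\<^sup>+t. h t \<partial>lborel) = 0"
    using assms(3) by (subst nn_integral_0_iff_AE) (auto simp: h_def elim!: AE_mp)
  then have "(\<integral>\<^sup>+t. (\<integral>\<^sup>+z. h (t + fst z) \<partial>total_var) \<partial>lborel) = 0"
    by (simp add: nn_integral_translates)
  then have ae: "AE t in lborel. (\<integral>\<^sup>+z. h (t + fst z) \<partial>total_var) = 0"
    by (subst (asm) nn_integral_0_iff_AE) auto
  show ?thesis
  proof (rule AE_mp[OF ae], rule AE_I2, rule impI)
    fix t assume "(\<integral>\<^sup>+z. h (t + fst z) \<partial>total_var) = 0"
    then have "AE z in total_var. h (t + fst z) = 0"
      by (subst (asm) nn_integral_0_iff_AE) auto
    then show "AE z in total_var. f (t + fst z) = g (t + fst z)"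
      by (rule AE_mp) (auto simp: h_def intro!: AE_I2 split: if_splits)
  qed
qed

lemma weyl_fun_cong:
  assumes f: "square_integrable f" and g: "square_integrable g"
    and eq: "AE t in lborel. f t = g t"
  shows "AE t in lborel. weyl_fun \<sigma> \<psi> f t = weyl_fun \<sigma> \<psi> g t"
proof -
  have [measurable]: "f \<in> borel_measurable borel" "g \<in> borel_measurable borel"
    using f g by (auto simp: square_integrable_def)
  show ?thesis
  proof (rule AE_mp[OF AE_translates[OF assms]], intro AE_I2 impI)
    fix t assume "AE z in total_var. f (t + fst z) = g (t + fst z)"
    then show "weyl_fun \<sigma> \<psi> f t = weyl_fun \<sigma> \<psi> g t"
      unfolding weyl_fun_eq[OF \<open>f \<in> borel_measurable borel\<close>]
        weyl_fun_eq[OF \<open>g \<in> borel_measurable borel\<close>]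
      by (intro integral_cong_AE) (auto elim!: AE_mp)
  qed
qed

lemma norm_weyl_integrand:
  "cmod (exp (of_real pi * \<i> * of_real a) * b * sgn (\<psi> z)) \<le> cmod b"
proof -
  have "cmod (exp (of_real pi * \<i> * of_real a)) = 1"
    using norm_exp_i_times[of "pi * a"] by (simp add: mult_ac)
  then show ?thesis
    by (auto simp: norm_mult norm_sgn)
qed

lemma AE_square_translates:
  assumes f: "square_integrable f"
  shows "AE t in lborel. integrable total_var (\<lambda>z. (cmod (f (t + fst z)))\<^sup>2)"
proof -
  interpret finite_measure total_var by (rule finite_total_var)
  have [measurable]: "f \<in> borel_measurable borel"
    using f by (auto simp: square_integrable_def)
  have "(\<integral>\<^sup>+t. ennreal ((cmod (f t))\<^sup>2) \<partial>lborel) < \<infinity>"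
    using f by (simp add: square_integrable_def integrable_iff_bounded)
  then have "(\<integral>\<^sup>+t. (\<integral>\<^sup>+z. ennreal ((cmod (f (t + fst z)))\<^sup>2) \<partial>total_var) \<partial>lborel) \<noteq> \<infinity>"
    using emeasure_finite[of UNIV]
      nn_integral_translates[of "\<lambda>t. ennreal ((cmod (f t))\<^sup>2)"]
    by (simp add: ennreal_mult_eq_top_iff less_top)
  then have "AE t in lborel. (\<integral>\<^sup>+z. ennreal ((cmod (f (t + fst z)))\<^sup>2) \<partial>total_var) \<noteq> \<infinity>"
    by (intro nn_integral_PInf_AE) auto
  then show ?thesis
    by (rule AE_mp) (auto intro!: AE_I2 simp: integrable_iff_bounded less_top)
qed

lemma weyl_fun_integrable:
  assumes f: "square_integrable f"
  shows "AE t in lborel. integrable \<sigma>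
    (\<lambda>(x, y). exp (of_real pi * \<i> * of_real (x * y + 2 * y * t)) * f (t + x) * \<psi> (x, y))"
proof -
  interpret finite_measure total_var by (rule finite_total_var)
  have [measurable]: "f \<in> borel_measurable borel"
    using f by (auto simp: square_integrable_def)
  show ?thesis
  proof (rule AE_mp[OF AE_square_translates[OF f]], intro AE_I2 impI)
    fix t assume "integrable total_var (\<lambda>z. (cmod (f (t + fst z)))\<^sup>2)"
    then have "integrable total_var (\<lambda>z. cmod (f (t + fst z)))"
      by (rule square_integrable_imp_integrable[rotated]) auto
    then have "integrable total_var (\<lambda>z. exp (of_real pi * \<i> *
        of_real (fst z * snd z + 2 * snd z * t)) * f (t + fst z) * sgn (\<psi> z))"
      by (rule Bochner_Integration.integrable_bound) (auto simp: norm_weyl_integrand simp del: of_real_add of_real_mult)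
    then have "integrable \<sigma> (\<lambda>z. cmod (\<psi> z) *\<^sub>R (exp (of_real pi * \<i> *
        of_real (fst z * snd z + 2 * snd z * t)) * f (t + fst z) * sgn (\<psi> z)))"
      by (subst (asm) integrable_density) auto
    then show "integrable \<sigma>
        (\<lambda>(x, y). exp (of_real pi * \<i> * of_real (x * y + 2 * y * t)) * f (t + x) * \<psi> (x, y))"
      by (rule Bochner_Integration.integrable_cong[THEN iffD1, rotated -1])
        (auto simp: norm_sgn_cancel)
  qed
qed

lemma square_integrable_weyl_fun:
  assumes f: "square_integrable f"
  shows "square_integrable (weyl_fun \<sigma> \<psi> f)"
proof -
  interpret finite_measure total_var by (rule finite_total_var)
  have f_meas [measurable]: "f \<in> borel_measurable borel"
    using f by (auto simp: square_integrable_def)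
  have meas [measurable]: "weyl_fun \<sigma> \<psi> f \<in> borel_measurable borel"
  proof -
    have "(\<lambda>t. \<integral>z. exp (of_real pi * \<i> * of_real (fst z * snd z + 2 * snd z * t)) * f (t + fst z) *
        sgn (\<psi> z) \<partial>total_var) \<in> borel_measurable borel"
      by measurable
    then show ?thesis
      by (simp add: weyl_fun_eq[OF f_meas, abs_def])
  qed
  define m where "m = measure total_var UNIV"
  have m: "emeasure total_var UNIV = ennreal m"
    unfolding m_def by (rule emeasure_eq_measure)
  have "AE t in lborel. ennreal ((cmod (weyl_fun \<sigma> \<psi> f t))\<^sup>2) \<le>
    ennreal m * (\<integral>\<^sup>+z. ennreal ((cmod (f (t + fst z)))\<^sup>2) \<partial>total_var)"
  proof (rule AE_mp[OF AE_square_translates[OF f]], intro AE_I2 impI)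
    fix t assume sq: "integrable total_var (\<lambda>z. (cmod (f (t + fst z)))\<^sup>2)"
    define h where "h z = cmod (f (t + fst z))" for z :: "real \<times> real"
    have [measurable]: "h \<in> borel_measurable (borel \<Otimes>\<^sub>M borel)"
      unfolding h_def by measurable
    have h2: "integrable total_var (\<lambda>z. (h z)\<^sup>2)"
      using sq by (simp add: h_def)
    then have h1: "integrable total_var h"
      by (rule square_integrable_imp_integrable[rotated]) auto
    define A where "A = (\<integral>z. h z \<partial>total_var)"
    define B where "B = (\<integral>z. (h z)\<^sup>2 \<partial>total_var)"
    have "0 \<le> (\<integral>z. (m * h z - A)\<^sup>2 \<partial>total_var)"
      by simp
    also have "(\<lambda>z. (m * h z - A)\<^sup>2) = (\<lambda>z. m\<^sup>2 * (h z)\<^sup>2 - 2 * m * A * h z + A\<^sup>2)"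
      by (auto simp: power2_eq_square algebra_simps)
    also have "(\<integral>z. m\<^sup>2 * (h z)\<^sup>2 - 2 * m * A * h z + A\<^sup>2 \<partial>total_var) = m\<^sup>2 * B - 2 * m * A * A + A\<^sup>2 * m"
      using h1 h2 by (simp add: A_def B_def m_def space_\<sigma>)
    finally have "0 \<le> m * (m * B - A\<^sup>2)"
      by (simp add: power2_eq_square algebra_simps)
    moreover have "0 \<le> m"
      by (simp add: m_def)
    moreover have "A = 0" if "m = 0"
    proof -
      have "emeasure total_var (space total_var) = 0"
        using m that by (simp add: space_\<sigma>)
      then have "AE z in total_var. h z = 0"
        by (intro AE_I[where N = "space total_var"]) auto
      then show ?thesis
        unfolding A_def by (rule integral_eq_zero_AE)
    qed
    ultimately have AB: "A\<^sup>2 \<le> m * B"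
      by (cases "m = 0") (auto simp: zero_le_mult_iff)
    have "cmod (weyl_fun \<sigma> \<psi> f t) \<le> A"
      unfolding weyl_fun_eq[OF f_meas] A_def
      by (rule Bochner_Integration.integral_norm_bound_integral[OF _ h1])
        (auto intro!: Bochner_Integration.integrable_bound[OF h1]
          simp: h_def norm_weyl_integrand simp del: of_real_add of_real_mult)
    then have "(cmod (weyl_fun \<sigma> \<psi> f t))\<^sup>2 \<le> m * B"
      by (meson AB norm_ge_zero order_trans power_mono)
    then have "ennreal ((cmod (weyl_fun \<sigma> \<psi> f t))\<^sup>2) \<le> ennreal m * ennreal B"
      using \<open>0 \<le> m\<close> by (simp add: B_def flip: ennreal_mult)
    also have "ennreal B = (\<integral>\<^sup>+z. ennreal ((h z)\<^sup>2) \<partial>total_var)"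
      unfolding B_def by (rule nn_integral_eq_integral[symmetric]) (auto simp: h2)
    finally show "ennreal ((cmod (weyl_fun \<sigma> \<psi> f t))\<^sup>2) \<le>
        ennreal m * (\<integral>\<^sup>+z. ennreal ((cmod (f (t + fst z)))\<^sup>2) \<partial>total_var)"
      by (simp add: h_def)
  qed
  then have "(\<integral>\<^sup>+t. ennreal ((cmod (weyl_fun \<sigma> \<psi> f t))\<^sup>2) \<partial>lborel) \<le>
      (\<integral>\<^sup>+t. ennreal m * (\<integral>\<^sup>+z. ennreal ((cmod (f (t + fst z)))\<^sup>2) \<partial>total_var) \<partial>lborel)"
    by (rule nn_integral_mono_AE)
  also have "\<dots> = ennreal m * (ennreal m * (\<integral>\<^sup>+t. ennreal ((cmod (f t))\<^sup>2) \<partial>lborel))"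
    by (subst nn_integral_cmult) (auto simp: nn_integral_translates[of "\<lambda>t. ennreal ((cmod (f t))\<^sup>2)"] m)
  also have "\<dots> < \<infinity>"
    using f by (simp add: square_integrable_def integrable_iff_bounded ennreal_mult_less_top)
  finally show ?thesis
    by (simp add: square_integrable_def integrable_iff_bounded)
qed

lemma weyl_transform_abs:
  assumes f: "square_integrable f"
  shows "weyl_transform \<sigma> \<psi> (abs_L2 f) = abs_L2 (weyl_fun \<sigma> \<psi> f)"
proof -
  have "L2_rel f f"
    using f by (simp add: L2_rel_def)
  then have "L2_rel (rep_L2 (abs_L2 f)) f"
    by (rule Quotient3_rep_abs[OF Quotient3_L2])
  then have "L2_rel (weyl_fun \<sigma> \<psi> (rep_L2 (abs_L2 f))) (weyl_fun \<sigma> \<psi> f)"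
    unfolding L2_rel_def by (blast intro: square_integrable_weyl_fun weyl_fun_cong)
  then show ?thesis
    unfolding weyl_transform_def by (rule Quotient3_rel_abs[OF Quotient3_L2])
qed

end

end

theory Submission
  imports Defs "HOL-Probability.Characteristic_Functions"
begin

text \<open>
  Writing \<open>\<pi>(z)\<close> for the Weyl operators, \<open>W(\<mu>)\<^sup>* W(\<mu>)\<close> is a superposition of the operators
  \<open>\<pi>(z - z')\<close> with respect to \<open>\<mu> \<otimes> \<mu>\<close>, up to unimodular factors. Finite type makes the image of
  this product measure under \<open>(z, z') \<mapsto> z - z'\<close> absolutely continuous in the plane: the Jacobian of
  \<open>(s, t) \<mapsto> \<gamma>(s) - \<eta>(t)\<close> vanishes where \<open>\<gamma>'(s)\<close> and \<open>\<eta>'(t)\<close> are parallel, and for fixed \<open>t\<close> these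
  \<open>s\<close> are isolated. So \<open>\<parallel>W(\<mu>) f\<parallel>\<^sup>2\<close> is the integral of the ambiguity function of \<open>f\<close> against a density
  in \<open>L\<^sup>1\<close>; a bounded, compactly supported density gives a Hilbert--Schmidt form, and truncation
  handles the general case.

  No spectral theory is needed: the form bounds the cardinality of any orthonormal set on which
  \<open>\<parallel>W(\<mu>) f\<parallel> \<ge> \<epsilon>\<close>, and such a bound for every \<open>\<epsilon>\<close> already makes the image of the unit ball
  totally bounded.
\<close>

section \<open>Orthonormal sets and total boundedness\<close>

text \<open>The Hilbert-Schmidt operators are the Weyl transforms of square-integrable densities, so
  a nonzero measure carried by a curve is beyond that criterion; passing to the squared norm smooths
  the measure. The density obtained is in general neither bounded nor square integrable, since the
  inverse Jacobian blows up at pairs of parallel tangents. Integrability is enough because the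
  ambiguity function of \<open>f\<close> is bounded by the squared norm of \<open>f\<close>: a part
  of the density that is small in \<open>L\<^sup>1\<close> changes the form little, uniformly over
  unit vectors.

  Only diagonal values of the forms enter, so neither an adjoint nor the operator of a form is
  constructed. The space carries the real part of the usual inner product, so an orthonormal set is
  orthonormal over the reals and may contain both \<open>f\<close> and \<open>\<i> * f\<close>; this
  costs a factor 2 in Bessel's inequality for complex coefficients. The cocycle of the Weyl
  operators does not depend on \<open>z - z'\<close> alone, so it has to be absorbed into the
  measure before the measure is pushed forward by subtraction.\<close>

definition orthonormal_set :: "'a::real_inner set \<Rightarrow> bool" where
  "orthonormal_set E \<longleftrightarrow> pairwise orthogonal E \<and> (\<forall>e\<in>E. norm e = 1)"

lemma orthonormal_set_inner:
  assumes "orthonormal_set E" "d \<in> E" "e \<in> E"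
  shows "d \<bullet> e = (if d = e then 1 else 0)"
  using assms by (auto simp: orthonormal_set_def pairwise_def orthogonal_def norm_eq_1)

lemma orthonormal_set_insert:
  assumes "orthonormal_set E" "norm u = 1" "\<And>e. e \<in> E \<Longrightarrow> u \<bullet> e = 0"
  shows "orthonormal_set (insert u E)"
  using assms
  by (auto simp: orthonormal_set_def pairwise_insert orthogonal_def inner_commute)

lemma orthonormal_residual:
  fixes x :: "'a::real_inner"
  assumes "finite E" "orthonormal_set E" "e \<in> E"
  shows "(x - (\<Sum>d\<in>E. (x \<bullet> d) *\<^sub>R d)) \<bullet> e = 0"
proof -
  have "(\<Sum>d\<in>E. (x \<bullet> d) *\<^sub>R d) \<bullet> e = (\<Sum>d\<in>E. if d = e then x \<bullet> e else 0)"
    unfolding inner_sum_left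
    by (rule sum.cong) (auto simp: orthonormal_set_inner[OF assms(2) _ assms(3)])
  then show ?thesis
    using assms by (simp add: inner_diff_left)
qed

lemma orthonormal_Pythagoras:
  fixes x :: "'a::real_inner"
  assumes "finite E" "orthonormal_set E"
  shows "(norm x)\<^sup>2 = (norm (x - (\<Sum>d\<in>E. (x \<bullet> d) *\<^sub>R d)))\<^sup>2 + (\<Sum>e\<in>E. (x \<bullet> e)\<^sup>2)"
proof -
  define y where "y = (\<Sum>d\<in>E. (x \<bullet> d) *\<^sub>R d)"
  have res: "(x - y) \<bullet> e = 0" if "e \<in> E" for e
    unfolding y_def using assms that by (rule orthonormal_residual)
  have ry: "(x - y) \<bullet> y = 0"
    by (subst (2) y_def) (simp add: inner_sum_right res)
  have xy: "x \<bullet> y = (\<Sum>e\<in>E. (x \<bullet> e)\<^sup>2)"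
    by (simp add: y_def inner_sum_right power2_eq_square)
  show ?thesis
    using ry xy unfolding y_def[symmetric]
    by (simp add: power2_norm_eq_inner inner_diff_left inner_diff_right inner_commute)
qed

lemma Bessel_inequality:
  fixes x :: "'a::real_inner"
  assumes "finite E" "orthonormal_set E"
  shows "(\<Sum>e\<in>E. (x \<bullet> e)\<^sup>2) \<le> (norm x)\<^sup>2"
  using orthonormal_Pythagoras[OF assms, of x] by simp

text \<open>The set is the Minkowski sum of the segments from \<open>- f e\<close> to
  \<open>f e\<close>, and sums of two compact sets are compact. Taking a linear map for
  \<open>f\<close> and an orthonormal \<open>E\<close>, it contains the image of the projection of
  the unit ball onto the span of \<open>E\<close>.\<close>

lemma compact_bounded_combinations:
  fixes f :: "'a \<Rightarrow> 'b::real_normed_vector"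
  assumes "finite E"
  shows "compact {\<Sum>e\<in>E. c e *\<^sub>R f e |c. \<forall>e\<in>E. \<bar>c e\<bar> \<le> (1::real)}"
  using assms
proof (induction E)
  case empty
  have "{\<Sum>e\<in>{}. c e *\<^sub>R f e |c. \<forall>e\<in>{}. \<bar>c e\<bar> \<le> (1::real)} = {0}"
    by auto
  then show ?case by (simp only: compact_sing)
next
  case (insert a E)
  let ?S = "{\<Sum>e\<in>E. c e *\<^sub>R f e |c. \<forall>e\<in>E. \<bar>c e\<bar> \<le> (1::real)}"
  let ?L = "(\<lambda>r. r *\<^sub>R f a) ` {-1..1::real}"
  have "compact ?L"
    by (intro compact_continuous_image continuous_intros) auto
  moreover have "{\<Sum>e\<in>insert a E. c e *\<^sub>R f e |c. \<forall>e\<in>insert a E. \<bar>c e\<bar> \<le> (1::real)} =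
      {x + y |x y. x \<in> ?S \<and> y \<in> ?L}" (is "?A = ?B")
  proof (intro equalityI subsetI)
    fix z assume "z \<in> ?A"
    then obtain c where c: "\<forall>e\<in>insert a E. \<bar>c e\<bar> \<le> (1::real)" "z = (\<Sum>e\<in>insert a E. c e *\<^sub>R f e)"
      by blast
    then have "z = (\<Sum>e\<in>E. c e *\<^sub>R f e) + c a *\<^sub>R f a"
      using insert by (simp add: add.commute)
    moreover have "c a *\<^sub>R f a \<in> ?L"
      using c(1) by (auto simp: abs_le_iff)
    ultimately show "z \<in> ?B"
      using c(1) by blast
  next
    fix z assume "z \<in> ?B"
    then obtain c r where c: "\<forall>e\<in>E. \<bar>c e\<bar> \<le> (1::real)" and r: "-1 \<le> r" "r \<le> 1"
      and z: "z = (\<Sum>e\<in>E. c e *\<^sub>R f e) + r *\<^sub>R f a"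
      by auto
    define c' where "c' = c(a := r)"
    have "(\<Sum>e\<in>E. c' e *\<^sub>R f e) = (\<Sum>e\<in>E. c e *\<^sub>R f e)"
      using insert by (intro sum.cong) (auto simp: c'_def)
    then have "z = (\<Sum>e\<in>insert a E. c' e *\<^sub>R f e)"
      using insert by (simp add: z c'_def add.commute)
    moreover have "\<forall>e\<in>insert a E. \<bar>c' e\<bar> \<le> 1"
      using c r by (auto simp: c'_def)
    ultimately show "z \<in> ?A"
      by blast
  qed
  ultimately show ?case
    using compact_sums[OF insert.IH] by simp
qed

text \<open>
  A finite orthonormal set on which \<open>T\<close> is large and whose cardinality is maximal leaves \<open>T\<close> small
  on its orthogonal complement.
\<close>

lemma totally_bounded_image_cball:
  fixes T :: "'a::real_inner \<Rightarrow> 'b::real_normed_vector"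
  assumes T: "bounded_linear T"
    and few: "\<And>\<epsilon>. \<epsilon> > 0 \<Longrightarrow> \<exists>N. \<forall>E. finite E \<longrightarrow> orthonormal_set E \<longrightarrow>
      (\<forall>e\<in>E. \<epsilon> \<le> norm (T e)) \<longrightarrow> card E \<le> N"
    and "\<epsilon> > 0"
  shows "\<exists>k. finite k \<and> T ` cball 0 1 \<subseteq> (\<Union>x\<in>k. ball x \<epsilon>)"
proof -
  interpret T: bounded_linear T by (rule T)
  \<comment> \<open>Half of the tolerance goes to the orthogonal complement of a maximal good set,
    the other half to the net of the finite-dimensional part.\<close>
  define good where
    "good E \<longleftrightarrow> finite E \<and> orthonormal_set E \<and> (\<forall>e\<in>E. \<epsilon> / 2 \<le> norm (T e))" for E
  obtain N where N: "\<And>E. good E \<Longrightarrow> card E \<le> N"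
    using few[of "\<epsilon> / 2"] \<open>\<epsilon> > 0\<close> unfolding good_def by auto
  have "good {}"
    by (simp add: good_def orthonormal_set_def)
  \<comment> \<open>The maximum principle asks for a strict upper bound on the cardinalities, hence
    \<open>Suc N\<close>.\<close>
  then obtain E where E: "good E" and max: "\<And>E'. good E' \<Longrightarrow> card E' \<le> card E"
    using ex_has_greatest_nat[of good "{}" card "Suc N"] N by (auto simp: less_Suc_eq_le)
  then have fin: "finite E" and on: "orthonormal_set E"
    by (auto simp: good_def)
  have small: "norm (T r) \<le> \<epsilon> / 2 * norm r" if r: "\<And>e. e \<in> E \<Longrightarrow> r \<bullet> e = 0" for r
  proof (rule ccontr)
    assume *: "\<not> norm (T r) \<le> \<epsilon> / 2 * norm r"
    then have "r \<noteq> 0" by auto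
    define u where "u = r /\<^sub>R norm r"
    have u: "norm u = 1" "\<And>e. e \<in> E \<Longrightarrow> u \<bullet> e = 0"
      using \<open>r \<noteq> 0\<close> r by (auto simp: u_def)
    then have "u \<notin> E"
      by (metis inner_eq_zero_iff norm_zero zero_neq_one)
    have "\<epsilon> / 2 \<le> norm (T u)"
      using * \<open>r \<noteq> 0\<close> by (simp add: u_def T.scaleR field_simps)
    then have "good (insert u E)"
      using E orthonormal_set_insert[OF on u] by (auto simp: good_def)
    then have "card (insert u E) \<le> card E"
      by (rule max)
    then show False
      using fin \<open>u \<notin> E\<close> by simp
  qed
  let ?K = "{\<Sum>e\<in>E. c e *\<^sub>R T e |c. \<forall>e\<in>E. \<bar>c e\<bar> \<le> (1::real)}"
  obtain k where k: "finite k" "?K \<subseteq> (\<Union>x\<in>k. ball x (\<epsilon> / 2))"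
    using compact_bounded_combinations[OF fin, of T] \<open>\<epsilon> > 0\<close>
    unfolding compact_eq_totally_bounded by (meson half_gt_zero)
  have "T ` cball 0 1 \<subseteq> (\<Union>x\<in>k. ball x \<epsilon>)"
  proof clarify
    fix f :: 'a assume "f \<in> cball 0 1"
    then have f: "norm f \<le> 1" by simp
    define r where "r = f - (\<Sum>d\<in>E. (f \<bullet> d) *\<^sub>R d)"
    have "(norm r)\<^sup>2 \<le> (norm f)\<^sup>2"
      using orthonormal_Pythagoras[OF fin on, of f]
      by (simp add: r_def sum_nonneg)
    then have "norm r \<le> 1"
      using f by (meson norm_ge_zero order_trans power2_le_imp_le)
    have "norm (T r) \<le> \<epsilon> / 2 * norm r"
      by (rule small) (simp add: r_def orthonormal_residual[OF fin on])
    also have "\<dots> \<le> \<epsilon> / 2"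
      using \<open>norm r \<le> 1\<close> \<open>\<epsilon> > 0\<close> by (simp add: mult_left_le)
    finally have Tr: "norm (T r) \<le> \<epsilon> / 2" .
    have "\<bar>f \<bullet> e\<bar> \<le> 1" if "e \<in> E" for e
      using Cauchy_Schwarz_ineq2[of f e] f on that by (simp add: orthonormal_set_def)
    then have "(\<Sum>e\<in>E. (f \<bullet> e) *\<^sub>R T e) \<in> ?K"
      by blast
    then obtain x where x: "x \<in> k" "(\<Sum>e\<in>E. (f \<bullet> e) *\<^sub>R T e) \<in> ball x (\<epsilon> / 2)"
      using k(2) by blast
    have "T f - x = T r + ((\<Sum>e\<in>E. (f \<bullet> e) *\<^sub>R T e) - x)"
      by (simp add: r_def T.diff T.sum T.scaleR)
    then have "norm (T f - x) < \<epsilon>"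
      using x(2) Tr norm_triangle_ineq[of "T r" "(\<Sum>e\<in>E. (f \<bullet> e) *\<^sub>R T e) - x"]
      unfolding \<open>T f - x = _\<close> by (simp add: dist_norm norm_minus_commute[of x])
    then show "T f \<in> (\<Union>x\<in>k. ball x \<epsilon>)"
      using x(1) by (auto simp: dist_norm norm_minus_commute[of _ "T f"])
  qed
  then show ?thesis
    using k(1) by blast
qed

section \<open>Completeness of the space of square-integrable functions\<close>

lemma square_integrable_rep_L2: "square_integrable (rep_L2 \<phi>)"
  using Quotient3_rep_reflp[OF Quotient3_L2, of \<phi>] by (simp add: L2_rel_def)

lemma abs_rep_L2: "abs_L2 (rep_L2 \<phi>) = \<phi>"
  by (rule Quotient3_abs_rep[OF Quotient3_L2])

lemma rep_abs_L2: "square_integrable f \<Longrightarrow> AE t in lborel. rep_L2 (abs_L2 f) t = f t"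
  using Quotient3_rep_abs[OF Quotient3_L2, of f] by (simp add: L2_rel_def)

lemma L2_rel_refl: "square_integrable f \<Longrightarrow> L2_rel f f"
  by (simp add: L2_rel_def)

lemma inner_abs_L2:
  assumes "square_integrable f" "square_integrable g"
  shows "abs_L2 f \<bullet> abs_L2 g = (\<integral>t. f t \<bullet> g t \<partial>lborel)"
  using assms by (simp add: inner_L2.abs_eq L2_rel_refl)

lemma norm_abs_L2:
  assumes "square_integrable f"
  shows "(norm (abs_L2 f))\<^sup>2 = (\<integral>t. (cmod (f t))\<^sup>2 \<partial>lborel)"
  using assms by (simp add: power2_norm_eq_inner inner_abs_L2)

lemma square_integrable_diff:
  "square_integrable f \<Longrightarrow> square_integrable g \<Longrightarrow> square_integrable (\<lambda>t. f t - g t)"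
  using square_integrable_add[of f "\<lambda>t. (- 1) * g t"] square_integrable_cmult[of g "- 1"] by simp

lemma minus_abs_L2:
  assumes "square_integrable f" "square_integrable g"
  shows "abs_L2 f - abs_L2 g = abs_L2 (\<lambda>t. f t - g t)"
  using assms square_integrable_cmult[of g "- 1"]
  by (simp add: minus_L2_def cscale_L2.abs_eq plus_L2.abs_eq L2_rel_refl square_integrable_cmult)

text \<open>Moves distances between classes to nonnegative integrals of representatives, where
  Fatou's lemma and termwise integration of series apply.\<close>

lemma nn_integral_dist_L2:
  "(\<integral>\<^sup>+t. ennreal ((cmod (rep_L2 \<phi> t - rep_L2 \<xi> t))\<^sup>2) \<partial>lborel) = ennreal ((dist \<phi> \<xi>)\<^sup>2)"
proof -
  let ?d = "\<lambda>t. rep_L2 \<phi> t - rep_L2 \<xi> t"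
  have sq: "square_integrable ?d"
    by (intro square_integrable_diff square_integrable_rep_L2)
  have "(\<integral>\<^sup>+t. ennreal ((cmod (?d t))\<^sup>2) \<partial>lborel) = ennreal (\<integral>t. (cmod (?d t))\<^sup>2 \<partial>lborel)"
    using sq by (intro nn_integral_eq_integral) (auto simp: square_integrable_def)
  also have "(\<integral>t. (cmod (?d t))\<^sup>2 \<partial>lborel) = (norm (abs_L2 ?d))\<^sup>2"
    by (rule norm_abs_L2[OF sq, symmetric])
  also have "abs_L2 ?d = \<phi> - \<xi>"
    by (simp add: minus_abs_L2[symmetric] square_integrable_rep_L2 abs_rep_L2)
  finally show ?thesis
    by (simp add: dist_norm)
qed

text \<open>Riesz-Fischer theorem. A subsequence with consecutive distances below
  \<open>(1/2) ^ k\<close> converges almost everywhere; Fatou's lemma then gives norm convergence of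
  the whole sequence to the pointwise limit.\<close>

lemma complete_UNIV_L2: "complete (UNIV :: L2 set)"
proof (rule completeI)
  fix \<phi> :: "nat \<Rightarrow> L2"
  assume \<phi>: "Cauchy \<phi>"
  define f where "f n = rep_L2 (\<phi> n)" for n
  have f: "square_integrable (f n)" for n
    by (simp add: f_def square_integrable_rep_L2)
  then have meas [measurable]: "f n \<in> borel_measurable borel" for n
    by (auto simp: square_integrable_def)
  have abs_f: "abs_L2 (f n) = \<phi> n" for n
    by (simp add: f_def abs_rep_L2)
  have "\<exists>r::nat \<Rightarrow> nat. \<forall>k. (\<forall>m\<ge>r k. \<forall>n\<ge>r k. dist (\<phi> m) (\<phi> n) < (1/2) ^ k) \<and> r k < r (Suc k)"
  proof (rule dependent_nat_choice)
    show "\<exists>N. \<forall>m\<ge>N. \<forall>n\<ge>N. dist (\<phi> m) (\<phi> n) < (1/2) ^ 0"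
      using \<phi> by (auto simp: Cauchy_def dest: spec[of _ 1])
    fix N k assume "\<forall>m\<ge>N. \<forall>n\<ge>N. dist (\<phi> m) (\<phi> n) < (1/2) ^ k"
    obtain N' where "\<forall>m\<ge>N'. \<forall>n\<ge>N'. dist (\<phi> m) (\<phi> n) < (1/2) ^ Suc k"
      using metric_CauchyD[OF \<phi>, of "(1/2) ^ Suc k"] by auto
    then show "\<exists>N'. (\<forall>m\<ge>N'. \<forall>n\<ge>N'. dist (\<phi> m) (\<phi> n) < (1/2) ^ Suc k) \<and> N < N'"
      by (intro exI[of _ "max N' (Suc N)"]) auto
  qed
  then obtain r :: "nat \<Rightarrow> nat" where r: "\<And>k. r k < r (Suc k)"
    and small: "\<And>k m n. r k \<le> m \<Longrightarrow> r k \<le> n \<Longrightarrow> dist (\<phi> m) (\<phi> n) < (1/2) ^ k"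
    by blast
  have mono: "strict_mono r"
    using r by (simp add: strict_mono_Suc_iff)
  define d where "d k t = cmod (f (r (Suc k)) t - f (r k) t)" for k t
  have [measurable]: "d k \<in> borel_measurable borel" for k
    unfolding d_def by measurable
  \<comment> \<open>The squared distances are below \<open>(1/4) ^ k\<close>, so the weight
    \<open>2 ^ k\<close> still leaves a convergent series. The weight is what later allows the
    squares to control the increments themselves.\<close>
  have "(\<integral>\<^sup>+t. (\<Sum>k. ennreal (2 ^ k * (d k t)\<^sup>2)) \<partial>lborel) =
      (\<Sum>k. \<integral>\<^sup>+t. ennreal (2 ^ k * (d k t)\<^sup>2) \<partial>lborel)"
    by (rule nn_integral_suminf) measurable
  also have "\<dots> \<le> (\<Sum>k. ennreal ((1/2) ^ k))"
  proof (intro suminf_le summableI)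
    fix k
    have "(\<integral>\<^sup>+t. ennreal (2 ^ k * (d k t)\<^sup>2) \<partial>lborel) =
        ennreal (2 ^ k) * (\<integral>\<^sup>+t. ennreal ((d k t)\<^sup>2) \<partial>lborel)"
      by (subst nn_integral_cmult[symmetric]) (auto simp: ennreal_mult)
    also have "(\<integral>\<^sup>+t. ennreal ((d k t)\<^sup>2) \<partial>lborel) = ennreal ((dist (\<phi> (r (Suc k))) (\<phi> (r k)))\<^sup>2)"
      unfolding d_def f_def by (rule nn_integral_dist_L2)
    also have "ennreal (2 ^ k) * \<dots> = ennreal (2 ^ k * (dist (\<phi> (r (Suc k))) (\<phi> (r k)))\<^sup>2)"
      by (simp add: ennreal_mult)
    also have "\<dots> \<le> ennreal (2 ^ k * ((1/2) ^ k)\<^sup>2)"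
      using small[of k "r (Suc k)" "r k"] r[of k]
      by (intro ennreal_leI mult_left_mono power_mono) auto
    also have "(2::real) ^ k * ((1/2) ^ k)\<^sup>2 = (1/2) ^ k"
      by (simp add: power2_eq_square power_one_over)
    finally show "(\<integral>\<^sup>+t. ennreal (2 ^ k * (d k t)\<^sup>2) \<partial>lborel) \<le> ennreal ((1/2) ^ k)" .
  qed
  also have "\<dots> = ennreal (\<Sum>k. (1/2) ^ k)"
    by (rule suminf_ennreal2) (auto simp: summable_geometric)
  also have "\<dots> < \<infinity>"
    by simp
  finally have "AE t in lborel. (\<Sum>k. ennreal (2 ^ k * (d k t)\<^sup>2)) \<noteq> \<infinity>"
    by (intro nn_integral_PInf_AE) auto
  then have conv: "AE t in lborel. convergent (\<lambda>k. f (r k) t)"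
  proof (rule AE_mp, intro AE_I2 impI)
    fix t assume *: "(\<Sum>k. ennreal (2 ^ k * (d k t)\<^sup>2)) \<noteq> \<infinity>"
    have s: "summable (\<lambda>k. 2 ^ k * (d k t)\<^sup>2)"
      by (rule summable_suminf_not_top) (use * in auto)
    \<comment> \<open>Arithmetic-geometric mean inequality with weight \<open>2 ^ k\<close>: the
      increments are dominated by a geometric series plus the series that converges at this
      \<open>t\<close>. This replaces Minkowski's inequality for infinite sums.\<close>
    have "d k t \<le> (1/2) ^ k + 2 ^ k * (d k t)\<^sup>2" for k
    proof -
      define a where "a = (2::real) ^ k"
      have a: "a > 0" "(1/2) ^ k = 1 / a" by (auto simp: a_def power_one_over)
      have "0 \<le> (a * d k t - 1)\<^sup>2" by simp
      then have "2 * a * d k t \<le> 1 + a\<^sup>2 * (d k t)\<^sup>2"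
        by (simp add: power2_eq_square algebra_simps)
      moreover have "0 \<le> a * d k t"
        using a by (simp add: d_def)
      ultimately have "a * d k t \<le> 1 + a\<^sup>2 * (d k t)\<^sup>2"
        by linarith
      then have "d k t \<le> 1 / a + a * (d k t)\<^sup>2"
        using a by (simp add: field_simps power2_eq_square)
      then show ?thesis
        using a by (simp add: a_def)
    qed
    then have le: "norm (d k t) \<le> (1/2) ^ k + 2 ^ k * (d k t)\<^sup>2" for k
      by (simp add: d_def)
    have "summable (\<lambda>k. (1/2) ^ k + 2 ^ k * (d k t)\<^sup>2)"
      by (rule summable_add[OF _ s]) (simp add: summable_geometric)
    then have "summable (\<lambda>k. d k t)"
      by (rule summable_comparison_test'[where N = 0]) (rule le)
    then have "summable (\<lambda>k. f (r (Suc k)) t - f (r k) t)"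
      unfolding d_def by (rule summable_norm_cancel)
    then show "convergent (\<lambda>k. f (r k) t)"
      using convergent_add_const_right_iff[of "\<lambda>k. f (r k) t" "- f (r 0) t"]
      by (simp add: summable_iff_convergent sum_lessThan_telescope[of "\<lambda>k. f (r k) t"])
  qed
  define g where "g t = lim (\<lambda>k. f (r k) t)" for t
  have [measurable]: "g \<in> borel_measurable borel"
    unfolding g_def by (rule borel_measurable_lim_metric) (rule meas)
  have lim: "AE t in lborel. (\<lambda>k. f (r k) t) \<longlonglongrightarrow> g t"
    using conv by (rule AE_mp) (auto simp: g_def convergent_LIMSEQ_iff)
  \<comment> \<open>Fatou's lemma along the subsequence: for \<open>j \<ge> k\<close> both
    \<open>n\<close> and \<open>r j\<close> lie beyond \<open>r k\<close>, so every integral in the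
    lower limit obeys the bound.\<close>
  have tail: "(\<integral>\<^sup>+t. ennreal ((cmod (f n t - g t))\<^sup>2) \<partial>lborel) \<le> ennreal (((1/2) ^ k)\<^sup>2)"
    if n: "r k \<le> n" for n k
  proof -
    have "(\<integral>\<^sup>+t. ennreal ((cmod (f n t - g t))\<^sup>2) \<partial>lborel) =
        (\<integral>\<^sup>+t. liminf (\<lambda>j. ennreal ((cmod (f n t - f (r j) t))\<^sup>2)) \<partial>lborel)"
    proof (rule nn_integral_cong_AE, rule AE_mp[OF lim], intro AE_I2 impI)
      fix t assume "(\<lambda>k. f (r k) t) \<longlonglongrightarrow> g t"
      then have "(\<lambda>j. ennreal ((cmod (f n t - f (r j) t))\<^sup>2)) \<longlonglongrightarrow> ennreal ((cmod (f n t - g t))\<^sup>2)"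
        by (intro tendsto_intros tendsto_ennrealI)
      then show "ennreal ((cmod (f n t - g t))\<^sup>2) =
          liminf (\<lambda>j. ennreal ((cmod (f n t - f (r j) t))\<^sup>2))"
        by (intro lim_imp_Liminf[symmetric]) auto
    qed
    also have "\<dots> \<le> liminf (\<lambda>j. \<integral>\<^sup>+t. ennreal ((cmod (f n t - f (r j) t))\<^sup>2) \<partial>lborel)"
      by (rule nn_integral_liminf) measurable
    also have "\<dots> \<le> ennreal (((1/2) ^ k)\<^sup>2)"
    proof (rule Liminf_le)
      show "\<forall>\<^sub>F j in sequentially. (\<integral>\<^sup>+t. ennreal ((cmod (f n t - f (r j) t))\<^sup>2) \<partial>lborel) \<le>
          ennreal (((1/2) ^ k)\<^sup>2)"
      proof (rule eventually_sequentiallyI[of k])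
        fix j assume "k \<le> j"
        then have "r k \<le> r j"
          using mono by (simp add: strict_mono_less_eq)
        then have "dist (\<phi> n) (\<phi> (r j)) < (1/2) ^ k"
          by (rule small[OF n])
        then show "(\<integral>\<^sup>+t. ennreal ((cmod (f n t - f (r j) t))\<^sup>2) \<partial>lborel) \<le> ennreal (((1/2) ^ k)\<^sup>2)"
          unfolding f_def nn_integral_dist_L2 by (intro ennreal_leI power_mono) auto
      qed
    qed simp
    finally show ?thesis .
  qed
  \<comment> \<open>\<open>tail\<close> with \<open>k = 0\<close> has the finite right-hand side 1;
    subtracting the difference from \<open>f (r 0)\<close> then shows that the limit itself is
    square integrable.\<close>
  have "square_integrable (\<lambda>t. f (r 0) t - g t)"
  proof -
    have "(\<integral>\<^sup>+t. ennreal ((cmod (f (r 0) t - g t))\<^sup>2) \<partial>lborel) < \<infinity>"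
      by (rule le_less_trans[OF tail[of 0 "r 0"]]) auto
    then have "integrable lborel (\<lambda>t. (cmod (f (r 0) t - g t))\<^sup>2)"
      by (intro integrableI_bounded) auto
    moreover have "(\<lambda>t. f (r 0) t - g t) \<in> borel_measurable lborel"
      by measurable
    ultimately show ?thesis
      unfolding square_integrable_def by blast
  qed
  then have "square_integrable (\<lambda>t. f (r 0) t - (f (r 0) t - g t))"
    by (rule square_integrable_diff[OF f])
  then have g: "square_integrable g"
    by simp
  have "\<phi> \<longlonglongrightarrow> abs_L2 g"
  proof (rule metric_LIMSEQ_I)
    fix \<epsilon> :: real assume "\<epsilon> > 0"
    then obtain k where k: "(1/2) ^ k < \<epsilon>"
      using real_arch_pow_inv[of \<epsilon> "1/2"] by auto
    have "dist (\<phi> n) (abs_L2 g) < \<epsilon>" if n: "n \<ge> r k" for n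
    proof -
      have "ennreal ((dist (\<phi> n) (abs_L2 g))\<^sup>2) =
          (\<integral>\<^sup>+t. ennreal ((cmod (f n t - rep_L2 (abs_L2 g) t))\<^sup>2) \<partial>lborel)"
        unfolding f_def by (rule nn_integral_dist_L2[symmetric])
      also have "\<dots> = (\<integral>\<^sup>+t. ennreal ((cmod (f n t - g t))\<^sup>2) \<partial>lborel)"
        by (rule nn_integral_cong_AE, rule AE_mp[OF rep_abs_L2[OF g]]) (auto intro!: AE_I2)
      also have "\<dots> \<le> ennreal (((1/2) ^ k)\<^sup>2)"
        by (rule tail[OF n])
      finally have "(dist (\<phi> n) (abs_L2 g))\<^sup>2 \<le> ((1/2) ^ k)\<^sup>2"
        by simp
      then have "dist (\<phi> n) (abs_L2 g) \<le> (1/2) ^ k"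
        by (rule power2_le_imp_le) simp
      then show ?thesis
        using k by simp
    qed
    then show "\<exists>no. \<forall>n\<ge>no. dist (\<phi> n) (abs_L2 g) < \<epsilon>"
      by blast
  qed
  then show "\<exists>l\<in>UNIV. \<phi> \<longlonglongrightarrow> l"
    by blast
qed

section \<open>Plancherel's inequality\<close>

lemma (in pair_sigma_finite) integrable_times:
  fixes F G :: "_ \<Rightarrow> complex"
  assumes F: "integrable M1 F" and G: "integrable M2 G"
  shows "integrable (M1 \<Otimes>\<^sub>M M2) (\<lambda>z. F (fst z) * G (snd z))"
proof (rule integrableI_bounded)
  have [measurable]: "F \<in> borel_measurable M1" "G \<in> borel_measurable M2"
    using F G by auto
  show "(\<lambda>z. F (fst z) * G (snd z)) \<in> borel_measurable (M1 \<Otimes>\<^sub>M M2)"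
    by measurable
  have "(\<integral>\<^sup>+z. ennreal (cmod (F (fst z) * G (snd z))) \<partial>(M1 \<Otimes>\<^sub>M M2)) =
      (\<integral>\<^sup>+x. \<integral>\<^sup>+y. ennreal (cmod (F x)) * ennreal (cmod (G y)) \<partial>M2 \<partial>M1)"
    by (subst M2.nn_integral_fst[symmetric]) (auto simp: norm_mult ennreal_mult)
  also have "\<dots> = (\<integral>\<^sup>+x. ennreal (cmod (F x)) \<partial>M1) * (\<integral>\<^sup>+y. ennreal (cmod (G y)) \<partial>M2)"
    by (simp add: nn_integral_cmult nn_integral_multc)
  also have "\<dots> < \<infinity>"
    using F G by (simp add: integrable_iff_bounded ennreal_mult_less_top)
  finally show "(\<integral>\<^sup>+z. ennreal (cmod (F (fst z) * G (snd z))) \<partial>(M1 \<Otimes>\<^sub>M M2)) < \<infinity>" .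
qed

lemma (in pair_sigma_finite) integral_times:
  fixes F G :: "_ \<Rightarrow> complex"
  assumes "integrable M1 F" "integrable M2 G"
  shows "(\<integral>z. F (fst z) * G (snd z) \<partial>(M1 \<Otimes>\<^sub>M M2)) = (\<integral>x. F x \<partial>M1) * (\<integral>y. G y \<partial>M2)"
  using integral_fst'[OF integrable_times[OF assms]] by simp

lemma borel_measurable_sets_cong:
  "sets M = sets N \<Longrightarrow> f \<in> borel_measurable N \<Longrightarrow> f \<in> borel_measurable M"
  by (simp cong: measurable_cong_sets)

lemma integrable_bounded_compact_support:
  fixes g :: "real \<Rightarrow> real"
  assumes [measurable]: "g \<in> borel_measurable borel"
    and B: "\<And>q. \<bar>g q\<bar> \<le> B" and R: "\<And>q. R < \<bar>q\<bar> \<Longrightarrow> g q = 0"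
  shows "integrable lborel g"
proof (rule Bochner_Integration.integrable_bound)
  show "integrable lborel (\<lambda>q. B * indicator {-R..R} q :: real)"
    by (auto intro!: integrable_mult_right integrable_real_indicator simp: emeasure_lborel_Icc_eq)
  have "norm (g q) \<le> norm (B * indicator {-R..R} q)" for q
    using B[of q] R[of q] order_trans[OF abs_ge_zero B[of q]]
    by (cases "q \<in> {-R..R}") (auto simp: abs_le_iff not_le)
  then show "AE q in lborel. norm (g q) \<le> norm (B * indicator {-R..R} q)"
    by simp
qed simp

text \<open>As a function of \<open>r\<close> the Gaussian is, up to the factor
  \<open>sqrt (2 * pi) / b\<close>, the normal density with mean \<open>q\<close> and standard
  deviation \<open>1 / b\<close>.\<close>

lemma integral_gaussian_shift:
  fixes b q :: real
  assumes "b > 0"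
  shows "integrable lborel (\<lambda>r. exp (- ((b * (q - r))\<^sup>2) / 2))"
    "(\<integral>r. exp (- ((b * (q - r))\<^sup>2) / 2) \<partial>lborel) = sqrt (2 * pi) / b"
proof -
  have eq: "exp (- ((b * (q - r))\<^sup>2) / 2) = sqrt (2 * pi) / b * normal_density q (1 / b) r" for r
  proof -
    have "(b * (q - r))\<^sup>2 / 2 = (r - q)\<^sup>2 / (2 * (1 / b)\<^sup>2)"
      using assms by (simp add: power_mult_distrib power2_commute[of r] power_divide)
    moreover have "sqrt (2 * pi * (1 / b)\<^sup>2) = sqrt (2 * pi) / b"
      using assms by (simp add: real_sqrt_mult)
    ultimately show ?thesis
      using assms by (simp add: normal_density_def)
  qed
  show "integrable lborel (\<lambda>r. exp (- ((b * (q - r))\<^sup>2) / 2))"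
    unfolding eq using assms by (intro integrable_mult_right integrable_normal_density) auto
  show "(\<integral>r. exp (- ((b * (q - r))\<^sup>2) / 2) \<partial>lborel) = sqrt (2 * pi) / b"
    unfolding eq using assms by (simp add: integral_normal_density)
qed

text \<open>
  Plancherel's inequality, up to a constant. A Gaussian weight makes the double integral in
  \<open>\<bar>h\<bar>\<^sup>2 = h * cnj h\<close> absolutely convergent; its Fourier transform is again a Gaussian, and the
  arithmetic-geometric mean inequality finishes the proof.
\<close>

lemma Plancherel_inequality_gaussian:
  fixes g :: "real \<Rightarrow> real"
  assumes g: "integrable lborel g" and g2: "integrable lborel (\<lambda>q. (g q)\<^sup>2)" and "b > 0"
  defines "h \<equiv> \<lambda>u. \<integral>q. of_real (g q) * iexp (b * (q * u)) \<partial>lborel"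
  shows "(\<integral>\<^sup>+u. ennreal ((cmod (h u))\<^sup>2) \<partial>std_normal_distribution) \<le>
    ennreal (sqrt (2 * pi) / b * (\<integral>q. (g q)\<^sup>2 \<partial>lborel))"
proof -
  let ?N = "std_normal_distribution" and ?L = "lborel \<Otimes>\<^sub>M lborel :: (real \<times> real) measure"
  interpret N: prob_space ?N
    by (rule prob_space_normal_density) simp
  interpret L: sigma_finite_measure ?L
    by (metis lborel_prod sigma_finite_lborel)
  interpret NL: pair_sigma_finite ?N ?L ..
  have [measurable]: "g \<in> borel_measurable borel"
    using g by auto
  have sets: "sets ?L = sets (borel \<Otimes>\<^sub>M borel)"
      "sets (borel \<Otimes>\<^sub>M (lborel :: real measure)) = sets (borel \<Otimes>\<^sub>M borel)"
      "sets (?N \<Otimes>\<^sub>M ?L) = sets (borel \<Otimes>\<^sub>M (borel \<Otimes>\<^sub>M borel))"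
    by (auto intro!: sets_pair_measure_cong)
  have "(\<lambda>(u, q). complex_of_real (g q) * iexp (b * (q * u))) \<in>
      borel_measurable (borel \<Otimes>\<^sub>M (lborel :: real measure))"
    by (rule borel_measurable_sets_cong[OF sets(2)]) measurable
  then have [measurable]: "h \<in> borel_measurable borel"
    unfolding h_def by (rule lborel.borel_measurable_lebesgue_integral)
  have int: "integrable lborel (\<lambda>q. complex_of_real (g q) * iexp (b * (q * u)))" for u
    by (rule Bochner_Integration.integrable_bound[OF g])
      (auto simp: norm_mult)
  have int_gg: "integrable ?L (\<lambda>z. complex_of_real (g (fst z)) * complex_of_real (g (snd z)))"
    by (intro lborel_pair.integrable_times integrable_of_real g)
  define K where "K z u = complex_of_real (g (fst z)) * complex_of_real (g (snd z)) *
      iexp (b * (fst z - snd z) * u)" for z :: "real \<times> real" and u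
  have K_meas: "(\<lambda>(u, z). K z u) \<in> borel_measurable (?N \<Otimes>\<^sub>M ?L)"
    unfolding K_def by (rule borel_measurable_sets_cong[OF sets(3)]) measurable
  have h_sq: "complex_of_real ((cmod (h u))\<^sup>2) = (\<integral>z. K z u \<partial>?L)" for u
  proof -
    have "cnj (h u) = (\<integral>q. cnj (complex_of_real (g q) * iexp (b * (q * u))) \<partial>lborel)"
      unfolding h_def by (rule Bochner_Integration.integral_cnj[symmetric])
    then have "h u * cnj (h u) = (\<integral>z. (complex_of_real (g (fst z)) * iexp (b * (fst z * u))) *
        cnj (complex_of_real (g (snd z)) * iexp (b * (snd z * u))) \<partial>?L)"
      unfolding h_def using int[of u]
      by (simp only: lborel_pair.integral_times[OF int, of "\<lambda>q. cnj (complex_of_real (g q) * iexp (b * (q * u)))"]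
          integrable_cnj)
    also have "\<dots> = (\<integral>z. K z u \<partial>?L)"
      by (rule Bochner_Integration.integral_cong)
        (auto simp: K_def exp_cnj algebra_simps simp flip: exp_add)
    finally show ?thesis
      unfolding complex_norm_square .
  qed
  have "integrable (?N \<Otimes>\<^sub>M ?L) (\<lambda>z. 1 * (complex_of_real (g (fst (snd z))) * complex_of_real (g (snd (snd z)))))"
    by (rule NL.integrable_times[OF _ int_gg, of "\<lambda>_. 1"]) auto
  then have int_K: "integrable (?N \<Otimes>\<^sub>M ?L) (\<lambda>(u, z). K z u)"
    by (rule Bochner_Integration.integrable_bound[OF _ K_meas]) (auto simp: K_def norm_mult)
  have char: "(\<integral>u. K z u \<partial>?N) = complex_of_real (g (fst z)) * complex_of_real (g (snd z)) *
      of_real (exp (- ((b * (fst z - snd z))\<^sup>2) / 2))" for z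
    unfolding K_def using fun_cong[OF char_std_normal_distribution, of "b * (fst z - snd z)"]
    by (simp add: char_def)
  have int_h: "integrable ?N (\<lambda>u. (cmod (h u))\<^sup>2)"
  proof -
    have "integrable ?N (\<lambda>u. \<integral>z. K z u \<partial>?L)"
      using NL.integrable_fst'[OF int_K] by simp
    then show ?thesis
      by (simp only: h_sq[symmetric] complex_of_real_integrable_eq)
  qed
  \<comment> \<open>After the Gaussian average, the integrand is at most the mean of
    \<open>k q r\<close> and \<open>k r q\<close>, because the Gaussian depends only on the distance
    of \<open>q\<close> and \<open>r\<close>. Both have the same integral by exchanging the
    variables.\<close>
  define k where "k q r = (g q)\<^sup>2 * exp (- ((b * (q - r))\<^sup>2) / 2)" for q r
  have k_meas: "(\<lambda>z. k (fst z) (snd z)) \<in> borel_measurable ?L"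
    unfolding k_def by (rule borel_measurable_sets_cong[OF sets(1)]) measurable
  have k_int: "(\<integral>r. k q r \<partial>lborel) = sqrt (2 * pi) / b * (g q)\<^sup>2" for q
    using integral_gaussian_shift(2)[OF \<open>b > 0\<close>, of q] by (simp add: k_def)
  have k_able: "integrable lborel (k q)" for q
    unfolding k_def by (intro integrable_mult_right integral_gaussian_shift(1) \<open>b > 0\<close>)
  have k_norm: "norm (k q r) = k q r" for q r
    by (simp add: k_def)
  have k1: "integrable ?L (\<lambda>z. k (fst z) (snd z))"
  proof (rule lborel_pair.Fubini_integrable[OF k_meas])
    have "integrable lborel (\<lambda>q. sqrt (2 * pi) / b * (g q)\<^sup>2)"
      by (intro integrable_mult_right g2)
    then show "integrable lborel (\<lambda>q. \<integral>r. norm (k (fst (q, r)) (snd (q, r))) \<partial>lborel)"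
      by (simp only: fst_conv snd_conv k_norm k_int)
  qed (simp add: k_able)
  have k2: "integrable ?L (\<lambda>z. k (snd z) (fst z))"
    using lborel_pair.integrable_product_swap[OF k1] by (simp add: split_beta')
  have swap: "(\<integral>z. k (snd z) (fst z) \<partial>?L) = (\<integral>z. k (fst z) (snd z) \<partial>?L)"
    using lborel_pair.integral_product_swap[OF k_meas] by (simp add: split_beta')
  have k_val: "(\<integral>z. k (fst z) (snd z) \<partial>?L) = sqrt (2 * pi) / b * (\<integral>q. (g q)\<^sup>2 \<partial>lborel)"
    using lborel_pair.integral_fst'[OF k1] by (simp add: k_int)
  have "complex_of_real (\<integral>u. (cmod (h u))\<^sup>2 \<partial>?N) = (\<integral>u. (\<integral>z. K z u \<partial>?L) \<partial>?N)"
    by (simp only: h_sq[symmetric] integral_complex_of_real)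
  also have "\<dots> = (\<integral>z. (\<integral>u. K z u \<partial>?N) \<partial>?L)"
    by (rule NL.Fubini_integral[OF int_K, symmetric])
  finally have eq: "complex_of_real (\<integral>u. (cmod (h u))\<^sup>2 \<partial>?N) = (\<integral>z. (\<integral>u. K z u \<partial>?N) \<partial>?L)" .
  have "(\<integral>u. (cmod (h u))\<^sup>2 \<partial>?N) = cmod (complex_of_real (\<integral>u. (cmod (h u))\<^sup>2 \<partial>?N))"
    by simp
  also have "\<dots> = cmod (\<integral>z. (\<integral>u. K z u \<partial>?N) \<partial>?L)"
    by (simp only: eq)
  also have "\<dots> \<le> (\<integral>z. (k (fst z) (snd z) + k (snd z) (fst z)) / 2 \<partial>?L)"
  proof (rule Bochner_Integration.integral_norm_bound_integral)
    show "integrable ?L (\<lambda>z. \<integral>u. K z u \<partial>?N)"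
      using NL.integrable_snd[OF int_K] by simp
    show "integrable ?L (\<lambda>z. (k (fst z) (snd z) + k (snd z) (fst z)) / 2)"
      using k1 k2 by simp
    fix z :: "real \<times> real"
    have "2 * (\<bar>g (fst z)\<bar> * \<bar>g (snd z)\<bar>) \<le> (g (fst z))\<^sup>2 + (g (snd z))\<^sup>2"
      using sum_squares_bound[of "\<bar>g (fst z)\<bar>" "\<bar>g (snd z)\<bar>"] by simp
    then have "(\<bar>g (fst z)\<bar> * \<bar>g (snd z)\<bar>) * exp (- ((b * (fst z - snd z))\<^sup>2) / 2) \<le>
        ((g (fst z))\<^sup>2 + (g (snd z))\<^sup>2) / 2 * exp (- ((b * (fst z - snd z))\<^sup>2) / 2)"
      by (intro mult_right_mono) auto
    also have "\<dots> = (k (fst z) (snd z) + k (snd z) (fst z)) / 2"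
    proof -
      have "(b * (snd z - fst z))\<^sup>2 = (b * (fst z - snd z))\<^sup>2"
        by (simp add: power_mult_distrib power2_commute)
      then show ?thesis
        by (simp add: k_def distrib_right)
    qed
    finally show "cmod (\<integral>u. K z u \<partial>?N) \<le> (k (fst z) (snd z) + k (snd z) (fst z)) / 2"
      by (simp add: char norm_mult)
  qed
  also have "\<dots> = sqrt (2 * pi) / b * (\<integral>q. (g q)\<^sup>2 \<partial>lborel)"
    using k1 k2 by (simp add: swap k_val)
  finally have "(\<integral>u. (cmod (h u))\<^sup>2 \<partial>?N) \<le> sqrt (2 * pi) / b * (\<integral>q. (g q)\<^sup>2 \<partial>lborel)" .
  moreover have "(\<integral>\<^sup>+u. ennreal ((cmod (h u))\<^sup>2) \<partial>?N) = ennreal (\<integral>u. (cmod (h u))\<^sup>2 \<partial>?N)"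
    by (rule nn_integral_eq_integral[OF int_h]) simp
  ultimately show ?thesis
    by (simp add: ennreal_leI)
qed

text \<open>The window from \<open>- b\<close> to \<open>b\<close> is rescaled to the interval from
  -1 to 1, where the standard normal density is at least \<open>exp (- 1/2) / sqrt (2 * pi)\<close>.
  The factor \<open>b\<close> of the rescaling cancels the \<open>1 / b\<close> of the Gaussian
  inequality, so the bound is uniform in \<open>b\<close> and Fatou's lemma removes the window. The
  factor \<open>exp (1/2)\<close> is the loss in comparing the density on the window with its value
  at 0.\<close>

lemma Plancherel_inequality:
  fixes g :: "real \<Rightarrow> real"
  assumes g: "integrable lborel g" and g2: "integrable lborel (\<lambda>q. (g q)\<^sup>2)"
  shows "(\<integral>\<^sup>+u. ennreal ((cmod (\<integral>q. of_real (g q) * iexp (2 * pi * (q * u)) \<partial>lborel))\<^sup>2) \<partial>lborel) \<le>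
    ennreal (exp (1/2) * (\<integral>q. (g q)\<^sup>2 \<partial>lborel))"
proof -
  define h where "h u = (\<integral>q. of_real (g q) * iexp (2 * pi * (q * u)) \<partial>lborel)" for u
  define I where "I = (\<integral>q. (g q)\<^sup>2 \<partial>lborel)"
  have [simp]: "0 \<le> I"
    by (simp add: I_def)
  have [measurable]: "g \<in> borel_measurable borel"
    using g by auto
  have "(\<lambda>(u, q). complex_of_real (g q) * iexp (2 * pi * (q * u))) \<in>
      borel_measurable (borel \<Otimes>\<^sub>M (lborel :: real measure))"
    by (rule borel_measurable_sets_cong[of _ "borel \<Otimes>\<^sub>M borel"])
      (auto intro!: sets_pair_measure_cong, measurable)
  then have [measurable]: "h \<in> borel_measurable borel"
    unfolding h_def by (rule lborel.borel_measurable_lebesgue_integral)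
  \<comment> \<open>\<open>Suc n\<close> keeps the half-width of the window positive, so that the
    rescaling by it is invertible.\<close>
  let ?F = "\<lambda>n u. ennreal ((cmod (h u))\<^sup>2) * indicator {- real (Suc n)..real (Suc n)} u"
  have part: "(\<integral>\<^sup>+u. ?F n u \<partial>lborel) \<le> ennreal (exp (1/2) * I)" for n
  proof -
    define b where "b = real (Suc n)"
    have b: "b > 0"
      by (simp add: b_def)
    have "(\<integral>\<^sup>+u. ?F n u \<partial>lborel) =
        ennreal \<bar>b\<bar> * (\<integral>\<^sup>+u. ?F n (0 + b * u) \<partial>lborel)"
      using b by (intro nn_integral_real_affine) auto
    also have "\<dots> \<le> ennreal b * (\<integral>\<^sup>+u. ennreal (exp (1/2) * sqrt (2 * pi)) *
        (ennreal (std_normal_density u) * ennreal ((cmod (h (b * u)))\<^sup>2)) \<partial>lborel)"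
    proof (rule mult_mono[OF _ nn_integral_mono])
      fix u :: real
      show "?F n (0 + b * u) \<le> ennreal (exp (1/2) * sqrt (2 * pi)) *
          (ennreal (std_normal_density u) * ennreal ((cmod (h (b * u)))\<^sup>2))"
      proof (cases "\<bar>u\<bar> \<le> 1")
        case True
        then have "u\<^sup>2 \<le> 1"
          by (simp add: abs_square_le_1)
        then have "1 \<le> exp (1/2 - u\<^sup>2 / 2)"
          by simp
        also have "\<dots> = exp (1/2) * sqrt (2 * pi) * std_normal_density u"
          using exp_add[of "1/2" "- u\<^sup>2 / 2"] by (simp add: normal_density_def)
        finally have *: "1 \<le> exp (1/2) * sqrt (2 * pi) * std_normal_density u" .
        have "?F n (0 + b * u) \<le> ennreal (1 * (cmod (h (b * u)))\<^sup>2)"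
          by (simp add: indicator_def)
        also have "\<dots> \<le> ennreal (exp (1/2) * sqrt (2 * pi) * std_normal_density u * (cmod (h (b * u)))\<^sup>2)"
          by (intro ennreal_leI mult_right_mono *) auto
        finally show ?thesis
          by (simp add: ennreal_mult mult.assoc)
      next
        case False
        then have "b < \<bar>b * u\<bar>"
          using b by (simp add: abs_mult)
        then have "0 + b * u \<notin> {- b..b}"
          by auto
        then show ?thesis
          by (simp add: b_def)
      qed
    qed (use b in auto)
    also have "\<dots> = ennreal b * (ennreal (exp (1/2) * sqrt (2 * pi)) *
        (\<integral>\<^sup>+u. ennreal ((cmod (h (b * u)))\<^sup>2) \<partial>std_normal_distribution))"
      by (simp add: nn_integral_cmult nn_integral_density)
    also have "\<dots> \<le> ennreal b * (ennreal (exp (1/2) * sqrt (2 * pi)) *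
        ennreal (sqrt (2 * pi) / (2 * pi * b) * I))"
    proof (intro mult_left_mono)
      have "h (b * u) = (\<integral>q. of_real (g q) * iexp ((2 * pi * b) * (q * u)) \<partial>lborel)" for u
        unfolding h_def by (simp add: mult_ac)
      then show "(\<integral>\<^sup>+u. ennreal ((cmod (h (b * u)))\<^sup>2) \<partial>std_normal_distribution) \<le>
          ennreal (sqrt (2 * pi) / (2 * pi * b) * I)"
        using Plancherel_inequality_gaussian[OF g g2, of "2 * pi * b"] b by (simp only: I_def) simp
    qed auto
    also have "\<dots> = ennreal (b * ((exp (1/2) * sqrt (2 * pi)) * (sqrt (2 * pi) / (2 * pi * b) * I)))"
    proof -
      have "0 \<le> b" "0 \<le> exp (1/2) * sqrt (2 * pi)" "0 \<le> sqrt (2 * pi) / (2 * pi * b) * I"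
        using b by auto
      then show ?thesis
        by (simp only: ennreal_mult mult_nonneg_nonneg)
    qed
    also have "b * ((exp (1/2) * sqrt (2 * pi)) * (sqrt (2 * pi) / (2 * pi * b) * I)) =
        exp (1/2) * I * ((sqrt (2 * pi) * sqrt (2 * pi)) / (2 * pi))"
      using b by (simp only: times_divide_eq_left times_divide_eq_right) (simp add: field_simps)
    also have "\<dots> = exp (1/2) * I"
      by simp
    finally show ?thesis .
  qed
  have "(\<integral>\<^sup>+u. ennreal ((cmod (h u))\<^sup>2) \<partial>lborel) = (\<integral>\<^sup>+u. liminf (\<lambda>n. ?F n u) \<partial>lborel)"
  proof (rule nn_integral_cong)
    fix u :: real
    obtain m :: nat where m: "\<bar>u\<bar> \<le> real m"
      using real_arch_simple by blast
    have "\<forall>\<^sub>F n in sequentially. ?F n u = ennreal ((cmod (h u))\<^sup>2)"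
    proof (rule eventually_sequentiallyI[of m])
      fix n assume "m \<le> n"
      then have "\<bar>u\<bar> \<le> real (Suc n)"
        using m by linarith
      then show "?F n u = ennreal ((cmod (h u))\<^sup>2)"
        by (auto simp: indicator_def abs_le_iff)
    qed
    then show "ennreal ((cmod (h u))\<^sup>2) = liminf (\<lambda>n. ?F n u)"
      by (intro lim_imp_Liminf[symmetric] tendsto_eventually) auto
  qed
  also have "\<dots> \<le> liminf (\<lambda>n. \<integral>\<^sup>+u. ?F n u \<partial>lborel)"
    by (rule nn_integral_liminf) measurable
  also have "\<dots> \<le> ennreal (exp (1/2) * I)"
    by (rule Liminf_le[OF _ always_eventually[OF allI[OF part]]]) simp
  finally show ?thesis
    by (simp add: h_def I_def)
qed

section \<open>The ambiguity function\<close>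

definition cis_pi :: "real \<Rightarrow> complex" where
  "cis_pi a = exp (of_real pi * \<i> * of_real a)"

lemma cis_pi_eq_iexp: "cis_pi a = iexp (pi * a)"
  by (simp add: cis_pi_def mult_ac)

lemma norm_cis_pi [simp]: "cmod (cis_pi a) = 1"
  unfolding cis_pi_eq_iexp by (rule norm_exp_i_times)

lemma cis_pi_add: "cis_pi (a + b) = cis_pi a * cis_pi b"
  by (simp add: cis_pi_def distrib_left exp_add)

lemma cnj_cis_pi: "cnj (cis_pi a) = cis_pi (- a)"
  by (simp add: cis_pi_def exp_cnj)

lemma measurable_cis_pi [measurable]: "cis_pi \<in> borel_measurable borel"
  unfolding cis_pi_def by measurable

text \<open>
  The matrix coefficient \<open>\<langle>\<pi>(z) f, f\<rangle>\<close> of the Weyl operator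
  \<open>(\<pi>(x, y) f) t = cis_pi (x * y + 2 * y * t) * f (t + x)\<close>, also known as the Fourier--Wigner transform of \<open>f\<close>.
\<close>

definition ambiguity :: "(real \<Rightarrow> complex) \<Rightarrow> real \<times> real \<Rightarrow> complex" where
  "ambiguity f z =
    (\<integral>u. cis_pi (fst z * snd z + 2 * snd z * u) * f (u + fst z) * cnj (f u) \<partial>lborel)"

lemma measurable_cnj [measurable]: "cnj \<in> borel_measurable borel"
  by (intro borel_measurable_continuous_onI continuous_intros)

lemma two_mult_le_squares:
  fixes a b :: real
  shows "a * b \<le> (a\<^sup>2 + b\<^sup>2) / 2"
  using sum_squares_bound[of a b] by simp

lemma square_integrable_translate:
  assumes f: "square_integrable f"
  shows "square_integrable (\<lambda>u. f (u + p))"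
    "(\<integral>u. (cmod (f (u + p)))\<^sup>2 \<partial>lborel) = (\<integral>u. (cmod (f u))\<^sup>2 \<partial>lborel)"
proof -
  have [measurable]: "f \<in> borel_measurable borel"
    using f by (simp add: square_integrable_def)
  have "integrable lborel (\<lambda>u. (cmod (f (p + 1 * u)))\<^sup>2)"
    using f by (intro lborel_integrable_real_affine) (auto simp: square_integrable_def)
  then show "square_integrable (\<lambda>u. f (u + p))"
    by (simp add: square_integrable_def add.commute)
  show "(\<integral>u. (cmod (f (u + p)))\<^sup>2 \<partial>lborel) = (\<integral>u. (cmod (f u))\<^sup>2 \<partial>lborel)"
    using lborel_integral_real_affine[of 1 "\<lambda>u. (cmod (f u))\<^sup>2" p] by (simp add: add.commute)
qed

lemma nn_integral_translate:
  fixes g :: "real \<Rightarrow> ennreal"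
  assumes "g \<in> borel_measurable borel"
  shows "(\<integral>\<^sup>+u. g (u + p) \<partial>lborel) = (\<integral>\<^sup>+u. g u \<partial>lborel)"
  using nn_integral_real_affine[OF assms, of 1 p] by (simp add: add.commute)

lemma integrable_ambiguity:
  assumes f: "square_integrable f"
  shows "integrable lborel (\<lambda>u. cis_pi (a + b * u) * f (u + p) * cnj (f u))"
proof (rule Bochner_Integration.integrable_bound)
  have [measurable]: "f \<in> borel_measurable borel"
    using f by (simp add: square_integrable_def)
  show "integrable lborel (\<lambda>u. ((cmod (f (u + p)))\<^sup>2 + (cmod (f u))\<^sup>2) / 2)"
    using f square_integrable_translate(1)[OF f, of p] by (auto simp: square_integrable_def)
  have "norm (cis_pi (a + b * u) * f (u + p) * cnj (f u)) \<le>
      norm (((cmod (f (u + p)))\<^sup>2 + (cmod (f u))\<^sup>2) / 2)" for u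
    using two_mult_le_squares[of "cmod (f (u + p))" "cmod (f u)"] by (simp add: norm_mult)
  then show "AE u in lborel. norm (cis_pi (a + b * u) * f (u + p) * cnj (f u)) \<le>
      norm (((cmod (f (u + p)))\<^sup>2 + (cmod (f u))\<^sup>2) / 2)"
    by simp
  show "(\<lambda>u. cis_pi (a + b * u) * f (u + p) * cnj (f u)) \<in> borel_measurable lborel"
    by measurable
qed

text \<open>The arithmetic-geometric mean inequality loses nothing here compared with
  Cauchy-Schwarz: by translation invariance the two squares have the same integral.\<close>

lemma norm_ambiguity_le:
  assumes f: "square_integrable f"
  shows "cmod (ambiguity f z) \<le> (\<integral>u. (cmod (f u))\<^sup>2 \<partial>lborel)"
proof -
  have int: "integrable lborel (\<lambda>u. (cmod (f u))\<^sup>2)" "integrable lborel (\<lambda>u. (cmod (f (u + fst z)))\<^sup>2)"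
    using f square_integrable_translate(1)[OF f] by (auto simp: square_integrable_def)
  have "cmod (ambiguity f z) \<le> (\<integral>u. ((cmod (f (u + fst z)))\<^sup>2 + (cmod (f u))\<^sup>2) / 2 \<partial>lborel)"
    unfolding ambiguity_def
  proof (rule Bochner_Integration.integral_norm_bound_integral[OF integrable_ambiguity[OF f]])
    show "integrable lborel (\<lambda>u. ((cmod (f (u + fst z)))\<^sup>2 + (cmod (f u))\<^sup>2) / 2)"
      using int by simp
    fix u
    show "cmod (cis_pi (fst z * snd z + 2 * snd z * u) * f (u + fst z) * cnj (f u)) \<le>
        ((cmod (f (u + fst z)))\<^sup>2 + (cmod (f u))\<^sup>2) / 2"
      using two_mult_le_squares[of "cmod (f (u + fst z))" "cmod (f u)"] by (simp add: norm_mult)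
  qed
  also have "\<dots> = (\<integral>u. (cmod (f u))\<^sup>2 \<partial>lborel)"
    using int by (simp add: square_integrable_translate(2)[OF f])
  finally show ?thesis .
qed

lemma measurable_ambiguity [measurable (raw)]:
  assumes [measurable]: "f \<in> borel_measurable borel"
  shows "ambiguity f \<in> borel_measurable borel"
proof -
  have "(\<lambda>(z, u). cis_pi (fst z * snd z + 2 * snd z * u) * f (u + fst z) * cnj (f u)) \<in>
      borel_measurable ((borel \<Otimes>\<^sub>M borel) \<Otimes>\<^sub>M borel)"
    by measurable
  then have "(\<lambda>(z, u). cis_pi (fst z * snd z + 2 * snd z * u) * f (u + fst z) * cnj (f u)) \<in>
      borel_measurable (borel \<Otimes>\<^sub>M (lborel :: real measure))"
    by (rule borel_measurable_sets_cong[rotated]) (rule sets_pair_measure_cong, simp only: borel_prod, simp)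
  then show ?thesis
    unfolding ambiguity_def[abs_def] by (rule lborel.borel_measurable_lebesgue_integral)
qed

section \<open>Hilbert-Schmidt forms on orthonormal sets\<close>

lemma integrable_square_integrable_times:
  assumes h: "square_integrable h" and f: "square_integrable f"
  shows "integrable lborel (\<lambda>v. h v * f v)"
proof (rule Bochner_Integration.integrable_bound)
  have [measurable]: "f \<in> borel_measurable borel" "h \<in> borel_measurable borel"
    using f h by (simp_all add: square_integrable_def)
  show "integrable lborel (\<lambda>v. ((cmod (h v))\<^sup>2 + (cmod (f v))\<^sup>2) / 2)"
    using f h by (auto simp: square_integrable_def)
  have "norm (h v * f v) \<le> norm (((cmod (h v))\<^sup>2 + (cmod (f v))\<^sup>2) / 2)" for v
    using two_mult_le_squares[of "cmod (h v)" "cmod (f v)"] by (simp add: norm_mult)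
  then show "AE v in lborel. norm (h v * f v) \<le> norm (((cmod (h v))\<^sup>2 + (cmod (f v))\<^sup>2) / 2)"
    by simp
  show "(\<lambda>v. h v * f v) \<in> borel_measurable lborel"
    by measurable
qed

text \<open>The real inner product with the class of \<open>cnj h\<close> gives the real parts of
  the coefficients, and the same for \<open>- \<i> * h\<close> gives the imaginary parts; each
  family obeys the real Bessel inequality. The factor 2 is attained: with \<open>e\<close> and
  \<open>\<i> * e\<close> in \<open>E\<close> and \<open>h = cnj e\<close>, both coefficients have
  modulus 1.\<close>

lemma Bessel_inequality_L2:
  assumes h: "square_integrable h" and E: "finite E" "orthonormal_set E"
  shows "(\<Sum>e\<in>E. (cmod (\<integral>v. h v * rep_L2 e v \<partial>lborel))\<^sup>2) \<le> 2 * (\<integral>v. (cmod (h v))\<^sup>2 \<partial>lborel)"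
proof -
  have part: "(\<Sum>e\<in>E. (Re (\<integral>v. h v * rep_L2 e v \<partial>lborel))\<^sup>2) \<le> (\<integral>v. (cmod (h v))\<^sup>2 \<partial>lborel)"
    if h: "square_integrable h" for h
  proof -
    have ch: "square_integrable (\<lambda>v. cnj (h v))"
      using h by (auto simp: square_integrable_def)
    have "Re (\<integral>v. h v * rep_L2 e v \<partial>lborel) = abs_L2 (\<lambda>v. cnj (h v)) \<bullet> e" for e
    proof -
      have "Re (\<integral>v. h v * rep_L2 e v \<partial>lborel) = (\<integral>v. cnj (h v) \<bullet> rep_L2 e v \<partial>lborel)"
        by (subst Bochner_Integration.integral_Re[symmetric])
          (auto intro!: integrable_square_integrable_times h square_integrable_rep_L2 simp: inner_complex_def)
      also have "\<dots> = abs_L2 (\<lambda>v. cnj (h v)) \<bullet> abs_L2 (rep_L2 e)"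
        by (rule inner_abs_L2[OF ch square_integrable_rep_L2, symmetric])
      finally show ?thesis
        by (simp add: abs_rep_L2)
    qed
    then have "(\<Sum>e\<in>E. (Re (\<integral>v. h v * rep_L2 e v \<partial>lborel))\<^sup>2) \<le> (norm (abs_L2 (\<lambda>v. cnj (h v))))\<^sup>2"
      using Bessel_inequality[OF E] by simp
    then show ?thesis
      by (simp add: norm_abs_L2[OF ch])
  qed
  have "Im (\<integral>v. h v * rep_L2 e v \<partial>lborel) = Re (\<integral>v. (- \<i> * h v) * rep_L2 e v \<partial>lborel)" for e
    by (simp only: mult.assoc integral_mult_right_zero) simp
  then have "(\<Sum>e\<in>E. (Im (\<integral>v. h v * rep_L2 e v \<partial>lborel))\<^sup>2) \<le> (\<integral>v. (cmod (h v))\<^sup>2 \<partial>lborel)"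
    using part[OF square_integrable_cmult[OF h, of "- \<i>"]] by (simp add: norm_mult)
  then show ?thesis
    using part[OF h] by (simp add: cmod_power2 sum.distrib)
qed

text \<open>For fixed \<open>u\<close>, Bessel's inequality in \<open>v\<close> bounds the sum of
  the \<open>(cmod (A e u))\<^sup>2\<close> over \<open>E\<close>; integrating in \<open>u\<close>
  bounds the sum of the squared norms of the \<open>A e\<close> by \<open>2 * C\<close>. A value of
  the form of modulus at least \<open>\<epsilon>\<close> at a unit vector forces a squared norm of
  at least \<open>\<epsilon>\<^sup>2\<close>, which leaves room for boundedly many
  \<open>e\<close>.\<close>

lemma Hilbert_Schmidt_form_card:
  fixes K :: "real \<times> real \<Rightarrow> complex"
  assumes [measurable]: "K \<in> borel_measurable (borel \<Otimes>\<^sub>M borel)"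
    and sq: "\<And>u. square_integrable (\<lambda>v. K (u, v))"
    and C: "(\<integral>\<^sup>+u. (\<integral>\<^sup>+v. ennreal ((cmod (K (u, v)))\<^sup>2) \<partial>lborel) \<partial>lborel) \<le> ennreal C"
    and E: "finite E" "orthonormal_set E" and \<epsilon>: "\<epsilon> > 0" and "0 \<le> C"
    and big: "\<And>e. e \<in> E \<Longrightarrow>
      \<epsilon> \<le> cmod (\<integral>u. (\<integral>v. K (u, v) * rep_L2 e v \<partial>lborel) * cnj (rep_L2 e u) \<partial>lborel)"
  shows "real (card E) \<le> 2 * C / \<epsilon>\<^sup>2"
proof -
  define A where "A e u = (\<integral>v. K (u, v) * rep_L2 e v \<partial>lborel)" for e u
  have rep [measurable]: "rep_L2 e \<in> borel_measurable borel" for e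
    using square_integrable_rep_L2[of e] by (simp add: square_integrable_def)
  have A_meas [measurable]: "A e \<in> borel_measurable borel" for e
  proof -
    have "(\<lambda>(u, v). K (u, v) * rep_L2 e v) \<in> borel_measurable (borel \<Otimes>\<^sub>M borel)"
      by measurable
    then have "(\<lambda>(u, v). K (u, v) * rep_L2 e v) \<in> borel_measurable (borel \<Otimes>\<^sub>M (lborel :: real measure))"
      by (rule borel_measurable_sets_cong[rotated]) (auto intro!: sets_pair_measure_cong)
    then show ?thesis
      unfolding A_def[abs_def] by (rule lborel.borel_measurable_lebesgue_integral)
  qed
  have "(\<Sum>e\<in>E. \<integral>\<^sup>+u. ennreal ((cmod (A e u))\<^sup>2) \<partial>lborel) =
      (\<integral>\<^sup>+u. (\<Sum>e\<in>E. ennreal ((cmod (A e u))\<^sup>2)) \<partial>lborel)"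
    by (rule nn_integral_sum[symmetric]) measurable
  also have "\<dots> \<le> (\<integral>\<^sup>+u. 2 * (\<integral>\<^sup>+v. ennreal ((cmod (K (u, v)))\<^sup>2) \<partial>lborel) \<partial>lborel)"
  proof (rule nn_integral_mono)
    fix u
    have "(\<Sum>e\<in>E. ennreal ((cmod (A e u))\<^sup>2)) = ennreal (\<Sum>e\<in>E. (cmod (A e u))\<^sup>2)"
      by simp
    also have "\<dots> \<le> ennreal (2 * (\<integral>v. (cmod (K (u, v)))\<^sup>2 \<partial>lborel))"
      unfolding A_def by (intro ennreal_leI Bessel_inequality_L2 sq E)
    also have "\<dots> = 2 * (\<integral>\<^sup>+v. ennreal ((cmod (K (u, v)))\<^sup>2) \<partial>lborel)"
      using sq[of u] by (subst nn_integral_eq_integral) (auto simp: square_integrable_def ennreal_mult)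
    finally show "(\<Sum>e\<in>E. ennreal ((cmod (A e u))\<^sup>2)) \<le> 2 * (\<integral>\<^sup>+v. ennreal ((cmod (K (u, v)))\<^sup>2) \<partial>lborel)" .
  qed
  also have "\<dots> = 2 * (\<integral>\<^sup>+u. (\<integral>\<^sup>+v. ennreal ((cmod (K (u, v)))\<^sup>2) \<partial>lborel) \<partial>lborel)"
  proof (rule nn_integral_cmult)
    have "(\<lambda>(u, v). ennreal ((cmod (K (u, v)))\<^sup>2)) \<in> borel_measurable (borel \<Otimes>\<^sub>M borel)"
      by measurable
    then have "(\<lambda>(u, v). ennreal ((cmod (K (u, v)))\<^sup>2)) \<in> borel_measurable (borel \<Otimes>\<^sub>M (lborel :: real measure))"
      by (rule borel_measurable_sets_cong[rotated]) (auto intro!: sets_pair_measure_cong)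
    then have "(\<lambda>u. \<integral>\<^sup>+v. ennreal ((cmod (K (u, v)))\<^sup>2) \<partial>(lborel :: real measure)) \<in> borel_measurable borel"
      by (rule lborel.borel_measurable_nn_integral)
    then show "(\<lambda>u. \<integral>\<^sup>+v. ennreal ((cmod (K (u, v)))\<^sup>2) \<partial>(lborel :: real measure)) \<in> borel_measurable lborel"
      by simp
  qed
  also have "\<dots> \<le> 2 * ennreal C"
    by (intro mult_left_mono C) auto
  finally have total: "(\<Sum>e\<in>E. \<integral>\<^sup>+u. ennreal ((cmod (A e u))\<^sup>2) \<partial>lborel) \<le> ennreal (2 * C)"
    using \<open>0 \<le> C\<close> by (simp add: ennreal_mult)
  have each: "ennreal (\<epsilon>\<^sup>2) \<le> (\<integral>\<^sup>+u. ennreal ((cmod (A e u))\<^sup>2) \<partial>lborel)" if e: "e \<in> E" for e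
  proof -
    have fin: "(\<integral>\<^sup>+u. ennreal ((cmod (A e u))\<^sup>2) \<partial>lborel) < \<infinity>"
      by (rule le_less_trans[OF order_trans[OF member_le_sum[OF e] total]]) (auto simp: E)
    then have int: "integrable lborel (\<lambda>u. (cmod (A e u))\<^sup>2)"
      by (intro integrableI_bounded) auto
    have norm_e: "integrable lborel (\<lambda>u. (cmod (rep_L2 e u))\<^sup>2)" "(\<integral>u. (cmod (rep_L2 e u))\<^sup>2 \<partial>lborel) = 1"
      using norm_abs_L2[OF square_integrable_rep_L2, of e] square_integrable_rep_L2[of e] E(2) e
      by (auto simp: square_integrable_def abs_rep_L2 orthonormal_set_def)
    have AE: "square_integrable (A e)"
      using int by (simp add: square_integrable_def)
    have ce: "square_integrable (\<lambda>u. cnj (rep_L2 e u))"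
      using square_integrable_rep_L2[of e] by (auto simp: square_integrable_def)
    have "\<epsilon> \<le> cmod (\<integral>u. A e u * cnj (rep_L2 e u) \<partial>lborel)"
      using big[OF e] by (simp add: A_def)
    \<comment> \<open>The weight in the arithmetic-geometric mean inequality is chosen so that the
      second term integrates to \<open>\<epsilon> / 2\<close> and is absorbed by the
      \<open>\<epsilon>\<close> on the left.\<close>
    also have "\<dots> \<le> (\<integral>u. (cmod (A e u))\<^sup>2 / (2 * \<epsilon>) + \<epsilon> / 2 * (cmod (rep_L2 e u))\<^sup>2 \<partial>lborel)"
    proof (rule Bochner_Integration.integral_norm_bound_integral)
      show "integrable lborel (\<lambda>u. A e u * cnj (rep_L2 e u))"
        by (rule integrable_square_integrable_times[OF AE ce])
      show "integrable lborel (\<lambda>u. (cmod (A e u))\<^sup>2 / (2 * \<epsilon>) + \<epsilon> / 2 * (cmod (rep_L2 e u))\<^sup>2)"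
        using int norm_e(1) by simp
      fix u
      have "cmod (A e u) * (\<epsilon> * cmod (rep_L2 e u)) \<le> ((cmod (A e u))\<^sup>2 + (\<epsilon> * cmod (rep_L2 e u))\<^sup>2) / 2"
        by (rule two_mult_le_squares)
      then show "cmod (A e u * cnj (rep_L2 e u)) \<le> (cmod (A e u))\<^sup>2 / (2 * \<epsilon>) + \<epsilon> / 2 * (cmod (rep_L2 e u))\<^sup>2"
        using \<epsilon> by (simp add: norm_mult field_simps power2_eq_square)
    qed
    also have "\<dots> = (\<integral>u. (cmod (A e u))\<^sup>2 \<partial>lborel) / (2 * \<epsilon>) + \<epsilon> / 2"
      using int norm_e by simp
    finally have "\<epsilon>\<^sup>2 \<le> (\<integral>u. (cmod (A e u))\<^sup>2 \<partial>lborel)"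
      using \<epsilon> by (simp add: field_simps power2_eq_square)
    then have "ennreal (\<epsilon>\<^sup>2) \<le> ennreal (\<integral>u. (cmod (A e u))\<^sup>2 \<partial>lborel)"
      by (rule ennreal_leI)
    also have "\<dots> = (\<integral>\<^sup>+u. ennreal ((cmod (A e u))\<^sup>2) \<partial>lborel)"
      by (rule nn_integral_eq_integral[OF int, symmetric]) simp
    finally show ?thesis .
  qed
  have "ennreal (real (card E) * \<epsilon>\<^sup>2) = (\<Sum>e\<in>E. ennreal (\<epsilon>\<^sup>2))"
    using \<epsilon> by (simp add: ennreal_mult ennreal_of_nat_eq_real_of_nat)
  also have "\<dots> \<le> (\<Sum>e\<in>E. \<integral>\<^sup>+u. ennreal ((cmod (A e u))\<^sup>2) \<partial>lborel)"
    by (rule sum_mono[OF each])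
  also have "\<dots> \<le> ennreal (2 * C)"
    by (rule total)
  finally have "real (card E) * \<epsilon>\<^sup>2 \<le> 2 * C"
    using \<open>0 \<le> C\<close> by simp
  then show ?thesis
    using \<epsilon> by (simp add: field_simps)
qed

text \<open>Licenses exchanging \<open>z\<close> and \<open>u\<close> in the form: at fixed
  \<open>z\<close> the modulus integrates in \<open>u\<close> to at most the modulus of
  \<open>g z\<close> times the squared norm of \<open>f\<close>.\<close>

lemma ambiguity_kernel_integrable:
  fixes g :: "real \<times> real \<Rightarrow> real"
  assumes g: "integrable lborel g" and f: "square_integrable f"
  shows "integrable (lborel \<Otimes>\<^sub>M lborel)
    (\<lambda>(z, u). of_real (g z) * (cis_pi (fst z * snd z + 2 * snd z * u) * f (u + fst z) * cnj (f u)))"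
    (is "integrable _ (\<lambda>(z, u). ?H z u)")
proof -
  have [measurable]: "f \<in> borel_measurable borel"
    using f by (simp add: square_integrable_def)
  have [measurable]: "g \<in> borel_measurable (borel \<Otimes>\<^sub>M borel)"
    using borel_measurable_integrable[OF g] by (simp add: borel_prod)
  define N where "N = (\<integral>u. (cmod (f u))\<^sup>2 \<partial>lborel)"
  have "(\<lambda>(z, u). ?H z u) \<in> borel_measurable ((borel \<Otimes>\<^sub>M borel) \<Otimes>\<^sub>M borel)"
    by measurable
  then have meas: "(\<lambda>(z, u). ?H z u) \<in> borel_measurable (lborel \<Otimes>\<^sub>M (lborel :: real measure))"
    by (rule borel_measurable_sets_cong[rotated])
      (rule sets_pair_measure_cong, simp only: borel_prod sets_lborel, simp)
  have int_H: "integrable lborel (?H z)" for z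
    by (intro integrable_mult_right integrable_ambiguity f)
  have bound: "(\<integral>u. norm (?H z u) \<partial>lborel) \<le> \<bar>g z\<bar> * N" for z
  proof -
    have int: "integrable lborel (\<lambda>u. (cmod (f u))\<^sup>2)" "integrable lborel (\<lambda>u. (cmod (f (u + fst z)))\<^sup>2)"
      using f square_integrable_translate(1)[OF f] by (auto simp: square_integrable_def)
    have "(\<integral>u. norm (?H z u) \<partial>lborel) \<le>
        (\<integral>u. \<bar>g z\<bar> * (((cmod (f (u + fst z)))\<^sup>2 + (cmod (f u))\<^sup>2) / 2) \<partial>lborel)"
    proof (rule integral_mono)
      show "integrable lborel (\<lambda>u. norm (?H z u))"
        using int_H by (rule integrable_norm)
      show "integrable lborel (\<lambda>u. \<bar>g z\<bar> * (((cmod (f (u + fst z)))\<^sup>2 + (cmod (f u))\<^sup>2) / 2))"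
        using int by simp
      fix u
      show "norm (?H z u) \<le> \<bar>g z\<bar> * (((cmod (f (u + fst z)))\<^sup>2 + (cmod (f u))\<^sup>2) / 2)"
        using mult_left_mono[OF two_mult_le_squares[of "cmod (f (u + fst z))" "cmod (f u)"], of "\<bar>g z\<bar>"]
        by (simp add: norm_mult)
    qed
    also have "\<dots> = \<bar>g z\<bar> * N"
      using int by (simp add: N_def square_integrable_translate(2)[OF f])
    finally show ?thesis .
  qed
  show ?thesis
  proof (rule lborel_pair.Fubini_integrable[OF meas])
    have "(\<lambda>(z, u). norm (?H z u)) \<in> borel_measurable (lborel \<Otimes>\<^sub>M (lborel :: real measure))"
      using measurable_compose[OF meas borel_measurable_norm] by (simp only: split_beta')
    then have "(\<lambda>z. \<integral>u. norm (?H z u) \<partial>lborel) \<in> borel_measurable lborel"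
      by (rule lborel.borel_measurable_lebesgue_integral)
    then have "integrable lborel (\<lambda>z. \<integral>u. norm (?H z u) \<partial>lborel)"
    proof (rule Bochner_Integration.integrable_bound[rotated])
      show "integrable lborel (\<lambda>z. \<bar>g z\<bar> * N)"
        using g by simp
      show "AE z in lborel. norm (\<integral>u. norm (?H z u) \<partial>lborel) \<le> norm (\<bar>g z\<bar> * N)"
      proof (rule AE_I2)
        fix z
        have "0 \<le> (\<integral>u. norm (?H z u) \<partial>lborel)"
          by simp
        then show "norm (\<integral>u. norm (?H z u) \<partial>lborel) \<le> norm (\<bar>g z\<bar> * N)"
          using bound[of z] unfolding real_norm_def by linarith
      qed
    qed
    then show "integrable lborel (\<lambda>z. \<integral>u. norm (case (z, u) of (z, u) \<Rightarrow> ?H z u) \<partial>lborel)"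
      by (simp only: prod.case)
  qed (use int_H in simp)
qed

text \<open>The substitution \<open>v = u + p\<close> turns the form into that of the integral
  kernel \<open>K\<close>, whose entry at \<open>(u, v)\<close> is a Fourier transform of
  \<open>g\<close> in its second variable, taken at \<open>p = v - u\<close>. Plancherel's
  inequality in \<open>u\<close> for each \<open>p\<close>, and then the bounded range of
  \<open>p\<close>, make \<open>K\<close> Hilbert-Schmidt. One constant \<open>C\<close> serves
  every \<open>\<epsilon>\<close>.\<close>

lemma ambiguity_form_card_bounded:
  fixes g :: "real \<times> real \<Rightarrow> real"
  assumes g_meas: "g \<in> borel_measurable borel"
    and B: "\<And>z. \<bar>g z\<bar> \<le> B" and "0 \<le> R"
    and R: "\<And>p q. R < \<bar>p\<bar> \<or> R < \<bar>q\<bar> \<Longrightarrow> g (p, q) = 0"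
  obtains C where "0 \<le> C" "\<And>\<epsilon> E. \<lbrakk>\<epsilon> > 0; finite E; orthonormal_set E;
      \<And>e. e \<in> E \<Longrightarrow> \<epsilon> \<le> cmod (\<integral>z. of_real (g z) * ambiguity (rep_L2 e) z \<partial>lborel)\<rbrakk> \<Longrightarrow>
      real (card E) \<le> 2 * C / \<epsilon>\<^sup>2"
proof -
  have [measurable]: "g \<in> borel_measurable (borel \<Otimes>\<^sub>M borel)"
    using g_meas by (simp add: borel_prod)
  have "0 \<le> B"
    using B[of 0] by linarith
  define k where "k u p = (\<integral>q. of_real (g (p, q)) * cis_pi (p * q + 2 * q * u) \<partial>lborel)" for u p
  define K where "K w = k (fst w) (snd w - fst w)" for w
  \<comment> \<open>The constant of Plancherel's inequality, times a bound
    \<open>B\<^sup>2 * (2 * R)\<close> for the squared norm of each slice of \<open>g\<close>, times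
    the length \<open>2 * R\<close> of the range of \<open>p\<close>.\<close>
  define C where "C = exp (1/2) * (B\<^sup>2 * (2 * R)) * (2 * R)"
  have "0 \<le> C"
    using \<open>0 \<le> R\<close> by (simp add: C_def)
  have zero: "g (p, q) = 0" if "p \<notin> {-R..R} \<or> q \<notin> {-R..R}" for p q
    using R[of p q] that by (auto simp: abs_if split: if_splits)
  have slice_int: "integrable lborel (\<lambda>q. g (p, q))" for p
    by (rule integrable_bounded_compact_support[of _ B R]) (use B R in auto)
  have slice_sq: "integrable lborel (\<lambda>q. (g (p, q))\<^sup>2)"
    "(\<integral>q. (g (p, q))\<^sup>2 \<partial>lborel) \<le> B\<^sup>2 * (2 * R) * indicator {-R..R} p" for p
  proof -
    have sq_le: "(g z)\<^sup>2 \<le> B\<^sup>2" for z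
      using B[of z] by (metis abs_ge_zero power2_abs power_mono)
    show int: "integrable lborel (\<lambda>q. (g (p, q))\<^sup>2)"
      by (rule integrable_bounded_compact_support[of _ "B\<^sup>2" R]) (use sq_le R in auto)
    have "(\<integral>q. (g (p, q))\<^sup>2 \<partial>lborel) \<le> (\<integral>q. (B\<^sup>2 * indicator {-R..R} p) * indicator {-R..R} q \<partial>lborel)"
    proof (rule integral_mono[OF int])
      show "integrable lborel (\<lambda>q. (B\<^sup>2 * indicator {-R..R} p) * indicator {-R..R} q :: real)"
        by (intro integrable_mult_right integrable_real_indicator) (auto simp: emeasure_lborel_Icc_eq)
      show "(g (p, q))\<^sup>2 \<le> (B\<^sup>2 * indicator {-R..R} p) * indicator {-R..R} q" for q
        using sq_le[of "(p, q)"] zero[of p q] by (auto simp: indicator_def)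
    qed
    also have "\<dots> = B\<^sup>2 * (2 * R) * indicator {-R..R} p"
      using \<open>0 \<le> R\<close> by simp
    finally show "(\<integral>q. (g (p, q))\<^sup>2 \<partial>lborel) \<le> B\<^sup>2 * (2 * R) * indicator {-R..R} p" .
  qed
  have k_meas: "(\<lambda>w. k (fst w) (snd w)) \<in> borel_measurable (borel \<Otimes>\<^sub>M borel)"
  proof -
    have "(\<lambda>(w, q). of_real (g (snd w, q)) * cis_pi (snd w * q + 2 * q * fst w)) \<in>
        borel_measurable ((borel \<Otimes>\<^sub>M borel) \<Otimes>\<^sub>M borel)"
      by measurable
    then have "(\<lambda>(w, q). of_real (g (snd w, q)) * cis_pi (snd w * q + 2 * q * fst w)) \<in>
        borel_measurable ((borel \<Otimes>\<^sub>M borel) \<Otimes>\<^sub>M (lborel :: real measure))"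
      by (rule borel_measurable_sets_cong[rotated]) (auto intro!: sets_pair_measure_cong)
    then show ?thesis
      unfolding k_def by (rule lborel.borel_measurable_lebesgue_integral)
  qed
  then have [measurable]: "(\<lambda>p. k u p) \<in> borel_measurable borel" "(\<lambda>u. k u p) \<in> borel_measurable borel" for u p
    using measurable_compose[OF _ k_meas, of "\<lambda>p. (u, p)" borel]
      measurable_compose[OF _ k_meas, of "\<lambda>u. (u, p)" borel] by auto
  have K_meas: "K \<in> borel_measurable (borel \<Otimes>\<^sub>M borel)"
    unfolding K_def
    using measurable_compose[OF _ k_meas, of "\<lambda>w. (fst w, snd w - fst w)" "borel \<Otimes>\<^sub>M borel"] by simp
  have k_bound: "cmod (k u p) \<le> 2 * R * B" for u p
  proof -
    have "cmod (k u p) \<le> (\<integral>q. B * indicator {-R..R} q \<partial>lborel)"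
      unfolding k_def
    proof (rule Bochner_Integration.integral_norm_bound_integral)
      show "integrable lborel (\<lambda>q. complex_of_real (g (p, q)) * cis_pi (p * q + 2 * q * u))"
        by (rule Bochner_Integration.integrable_bound[OF slice_int[of p]]) (auto simp: norm_mult)
      show "integrable lborel (\<lambda>q. B * indicator {-R..R} q :: real)"
        by (intro integrable_mult_right integrable_real_indicator) (auto simp: emeasure_lborel_Icc_eq)
      show "cmod (complex_of_real (g (p, q)) * cis_pi (p * q + 2 * q * u)) \<le> B * indicator {-R..R} q" for q
        using B[of "(p, q)"] zero[of p q] by (auto simp: norm_mult indicator_def)
    qed
    then show ?thesis
      using \<open>0 \<le> R\<close> by (simp add: mult_ac)
  qed
  have k_zero: "k u p = 0" if "R < \<bar>p\<bar>" for u p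
    using R that by (simp add: k_def)
  have k_sq: "square_integrable (k u)" for u
  proof -
    have "integrable lborel (\<lambda>p. (cmod (k u p))\<^sup>2)"
      by (rule integrable_bounded_compact_support[of _ "(2 * R * B)\<^sup>2" R])
        (auto simp: k_zero intro!: power_mono k_bound)
    then show ?thesis
      by (simp add: square_integrable_def)
  qed
  have K_sq: "square_integrable (\<lambda>v. K (u, v))" for u
    using square_integrable_translate(1)[OF k_sq[of u], of "- u"] by (simp add: K_def)
  have k_column: "(\<integral>\<^sup>+u. ennreal ((cmod (k u p))\<^sup>2) \<partial>lborel) \<le>
      ennreal (exp (1/2) * (B\<^sup>2 * (2 * R))) * indicator {-R..R} p" for p
  proof -
    define h where "h u = (\<integral>q. of_real (g (p, q)) * iexp (2 * pi * (q * u)) \<partial>lborel)" for u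
    \<comment> \<open>The symmetric phase of the Weyl operators shifts the frequency by
      \<open>p / 2\<close>. At fixed \<open>p\<close> this is a translation in \<open>u\<close>,
      invisible to the integral over all \<open>u\<close>.\<close>
    have k_h: "k u p = h (u + p / 2)" for u
    proof -
      have "pi * (p * q + 2 * q * u) = 2 * pi * (q * (u + p / 2))" for q
        by (simp add: field_simps)
      then show ?thesis
        unfolding k_def h_def cis_pi_eq_iexp by (simp only:)
    qed
    then have h_k: "h = (\<lambda>u. k (u - p / 2) p)"
      by auto
    have [measurable]: "h \<in> borel_measurable borel"
      unfolding h_k by measurable
    have "(\<integral>\<^sup>+u. ennreal ((cmod (k u p))\<^sup>2) \<partial>lborel) = (\<integral>\<^sup>+u. ennreal ((cmod (h u))\<^sup>2) \<partial>lborel)"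
      unfolding k_h by (rule nn_integral_translate) measurable
    also have "\<dots> \<le> ennreal (exp (1/2) * (\<integral>q. (g (p, q))\<^sup>2 \<partial>lborel))"
      unfolding h_def by (rule Plancherel_inequality[OF slice_int slice_sq(1)])
    also have "\<dots> \<le> ennreal (exp (1/2) * (B\<^sup>2 * (2 * R) * indicator {-R..R} p))"
      by (intro ennreal_leI mult_left_mono slice_sq(2)) auto
    also have "\<dots> = ennreal (exp (1/2) * (B\<^sup>2 * (2 * R))) * indicator {-R..R} p"
      by (simp add: indicator_def)
    finally show ?thesis .
  qed
  have K_HS: "(\<integral>\<^sup>+u. (\<integral>\<^sup>+v. ennreal ((cmod (K (u, v)))\<^sup>2) \<partial>lborel) \<partial>lborel) \<le> ennreal C"
  proof -
    have "(\<integral>\<^sup>+v. ennreal ((cmod (K (u, v)))\<^sup>2) \<partial>lborel) = (\<integral>\<^sup>+p. ennreal ((cmod (k u p))\<^sup>2) \<partial>lborel)" for u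
      using nn_integral_translate[of "\<lambda>p. ennreal ((cmod (k u p))\<^sup>2)" "- u"] by (simp add: K_def)
    then have "(\<integral>\<^sup>+u. (\<integral>\<^sup>+v. ennreal ((cmod (K (u, v)))\<^sup>2) \<partial>lborel) \<partial>lborel) =
        (\<integral>\<^sup>+u. (\<integral>\<^sup>+p. ennreal ((cmod (k u p))\<^sup>2) \<partial>lborel) \<partial>lborel)"
      by simp
    \<comment> \<open>Plancherel's inequality concerns \<open>u\<close> at fixed \<open>p\<close>,
      so the integral over \<open>u\<close> has to become the inner one.\<close>
    also have "\<dots> = (\<integral>\<^sup>+p. (\<integral>\<^sup>+u. ennreal ((cmod (k u p))\<^sup>2) \<partial>lborel) \<partial>lborel)"
    proof (rule lborel_pair.Fubini'[symmetric])
      have "(\<lambda>w. ennreal ((cmod (k (fst w) (snd w)))\<^sup>2)) \<in> borel_measurable (borel \<Otimes>\<^sub>M borel)"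
        using k_meas by measurable
      then show "(\<lambda>(u, p). ennreal ((cmod (k u p))\<^sup>2)) \<in>
          borel_measurable (lborel \<Otimes>\<^sub>M (lborel :: real measure))"
        by (subst split_beta') (rule borel_measurable_sets_cong[rotated], auto intro!: sets_pair_measure_cong)
    qed
    also have "\<dots> \<le> (\<integral>\<^sup>+p. ennreal (exp (1/2) * (B\<^sup>2 * (2 * R))) * indicator {-R..R} p \<partial>lborel)"
      by (rule nn_integral_mono) (rule k_column)
    also have "\<dots> = ennreal (exp (1/2) * (B\<^sup>2 * (2 * R))) * ennreal (2 * R)"
      using \<open>0 \<le> R\<close> by (simp add: nn_integral_cmult_indicator)
    also have "\<dots> = ennreal C"
      unfolding C_def by (rule ennreal_mult'[symmetric]) (use \<open>0 \<le> R\<close> in simp)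
    finally show ?thesis .
  qed
  have g_int: "integrable lborel g"
  proof (rule Bochner_Integration.integrable_bound)
    show "integrable lborel (\<lambda>z. B * indicator (cbox (-R, -R) (R, R)) z :: real)"
      by (intro integrable_mult_right integrable_real_indicator) (auto simp: emeasure_lborel_cbox_eq)
    have "norm (g z) \<le> norm (B * indicator (cbox (-R, -R) (R, R)) z :: real)" for z
      using B[of z] zero[of "fst z" "snd z"] \<open>0 \<le> B\<close>
      by (cases z) (auto simp: indicator_def cbox_Pair_eq)
    then show "AE z in lborel. norm (g z) \<le> norm (B * indicator (cbox (-R, -R) (R, R)) z :: real)"
      by simp
  qed (use g_meas in simp)
  have form: "(\<integral>z. of_real (g z) * ambiguity f z \<partial>lborel) =
      (\<integral>u. (\<integral>v. K (u, v) * f v \<partial>lborel) * cnj (f u) \<partial>lborel)" if f: "square_integrable f" for f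
  proof -
    have [measurable]: "f \<in> borel_measurable borel"
      using f by (simp add: square_integrable_def)
    let ?H = "\<lambda>z u. of_real (g z) * (cis_pi (fst z * snd z + 2 * snd z * u) * f (u + fst z) * cnj (f u))"
    have int: "integrable (lborel \<Otimes>\<^sub>M lborel) (\<lambda>(z, u). ?H z u)"
      by (rule ambiguity_kernel_integrable[OF g_int f])
    have "(\<integral>z. of_real (g z) * ambiguity f z \<partial>lborel) = (\<integral>z. (\<integral>u. ?H z u \<partial>lborel) \<partial>lborel)"
      unfolding ambiguity_def by simp
    also have "\<dots> = (\<integral>u. (\<integral>z. ?H z u \<partial>lborel) \<partial>lborel)"
      by (rule lborel_pair.Fubini_integral[OF int, symmetric])
    also have "\<dots> = (\<integral>u. (\<integral>v. K (u, v) * f v \<partial>lborel) * cnj (f u) \<partial>lborel)"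
    proof (rule integral_cong_AE)
      show "(\<lambda>u. \<integral>z. ?H z u \<partial>lborel) \<in> borel_measurable lborel"
        using lborel_pair.integrable_snd[OF int] by auto
      have "(\<lambda>(u, v). K (u, v) * f v) \<in> borel_measurable (borel \<Otimes>\<^sub>M borel)"
        using K_meas by measurable
      then have "(\<lambda>(u, v). K (u, v) * f v) \<in> borel_measurable (borel \<Otimes>\<^sub>M (lborel :: real measure))"
        by (rule borel_measurable_sets_cong[rotated]) (auto intro!: sets_pair_measure_cong)
      then have [measurable]: "(\<lambda>u. \<integral>v. K (u, v) * f v \<partial>lborel) \<in> borel_measurable borel"
        by (rule lborel.borel_measurable_lebesgue_integral)
      show "(\<lambda>u. (\<integral>v. K (u, v) * f v \<partial>lborel) * cnj (f u)) \<in> borel_measurable lborel"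
        by measurable
      \<comment> \<open>Integrability in \<open>z\<close>, which is what permits splitting
        \<open>z\<close> into \<open>p\<close> and \<open>q\<close>, comes from Fubini's theorem for
        almost every \<open>u\<close> only.\<close>
      show "AE u in lborel. (\<integral>z. ?H z u \<partial>lborel) = (\<integral>v. K (u, v) * f v \<partial>lborel) * cnj (f u)"
      proof (rule AE_mp[OF lborel_pair.AE_integrable_snd[OF int]], intro AE_I2 impI)
        fix u assume "integrable lborel (\<lambda>z. ?H z u)"
        then have int_u: "integrable (lborel \<Otimes>\<^sub>M lborel) (\<lambda>z. ?H z u)"
          by (simp only: lborel_prod)
        have "(\<integral>z. ?H z u \<partial>lborel) = (\<integral>z. ?H z u \<partial>(lborel \<Otimes>\<^sub>M lborel))"
          by (simp only: lborel_prod)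
        also have "\<dots> = (\<integral>p. (\<integral>q. ?H (p, q) u \<partial>lborel) \<partial>lborel)"
          by (rule lborel_pair.integral_fst'[OF int_u, symmetric])
        also have "\<dots> = (\<integral>p. (k u p * f (u + p)) * cnj (f u) \<partial>lborel)"
        proof (rule Bochner_Integration.integral_cong[OF refl])
          fix p
          have "(\<integral>q. ?H (p, q) u \<partial>lborel) =
              (\<integral>q. (of_real (g (p, q)) * cis_pi (p * q + 2 * q * u)) * (f (u + p) * cnj (f u)) \<partial>lborel)"
            by (simp add: mult_ac)
          also have "\<dots> = k u p * (f (u + p) * cnj (f u))"
            unfolding k_def by (rule integral_mult_left_zero)
          also have "\<dots> = (k u p * f (u + p)) * cnj (f u)"
            by (simp add: mult.assoc)
          finally show "(\<integral>q. ?H (p, q) u \<partial>lborel) = (k u p * f (u + p)) * cnj (f u)" .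
        qed
        also have "\<dots> = (\<integral>p. k u p * f (u + p) \<partial>lborel) * cnj (f u)"
          by (rule integral_mult_left_zero)
        also have "(\<integral>p. k u p * f (u + p) \<partial>lborel) = (\<integral>v. K (u, v) * f v \<partial>lborel)"
          using lborel_integral_real_affine[of 1 "\<lambda>v. K (u, v) * f v" u] by (simp add: K_def)
        finally show "(\<integral>z. ?H z u \<partial>lborel) = (\<integral>v. K (u, v) * f v \<partial>lborel) * cnj (f u)" .
      qed
    qed
    finally show ?thesis .
  qed
  show thesis
  proof (rule that[OF \<open>0 \<le> C\<close>])
    fix \<epsilon> :: real and E
    assume "\<epsilon> > 0" "finite E" "orthonormal_set E"
      and big: "\<And>e. e \<in> E \<Longrightarrow> \<epsilon> \<le> cmod (\<integral>z. of_real (g z) * ambiguity (rep_L2 e) z \<partial>lborel)"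
    show "real (card E) \<le> 2 * C / \<epsilon>\<^sup>2"
    proof (rule Hilbert_Schmidt_form_card[OF K_meas K_sq K_HS])
      fix e assume "e \<in> E"
      then show "\<epsilon> \<le> cmod (\<integral>u. (\<integral>v. K (u, v) * rep_L2 e v \<partial>lborel) * cnj (rep_L2 e u) \<partial>lborel)"
        using big by (simp add: form[OF square_integrable_rep_L2, symmetric])
    qed fact+
  qed
qed

text \<open>Cutting \<open>G\<close> off in size and support makes an \<open>L\<^sup>1\<close> error
  below \<open>\<epsilon> / 2\<close> by dominated convergence. On unit vectors the ambiguity
  function is bounded by 1, so the truncated form still has modulus at least
  \<open>\<epsilon> / 2\<close> on \<open>E\<close>, and the bounded case counts
  \<open>E\<close>.\<close>

lemma ambiguity_form_card:
  fixes G :: "real \<times> real \<Rightarrow> real"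
  assumes G: "integrable lborel G" and \<epsilon>: "\<epsilon> > 0"
  obtains N where "\<And>E. \<lbrakk>finite E; orthonormal_set E;
      \<And>e. e \<in> E \<Longrightarrow> \<epsilon> \<le> cmod (\<integral>z. of_real (G z) * ambiguity (rep_L2 e) z \<partial>lborel)\<rbrakk> \<Longrightarrow>
      card E \<le> N"
proof -
  have G_meas: "G \<in> borel_measurable borel"
    using borel_measurable_integrable[OF G] by simp
  then have [measurable]: "G \<in> borel_measurable (borel \<Otimes>\<^sub>M borel)"
    by (simp add: borel_prod)
  define g where "g n z = (if \<bar>G z\<bar> \<le> real n \<and> \<bar>fst z\<bar> \<le> real n \<and> \<bar>snd z\<bar> \<le> real n then G z else 0)" for n z
  have "g n \<in> borel_measurable (borel \<Otimes>\<^sub>M borel)" for n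
    unfolding g_def by measurable
  then have g_meas: "g n \<in> borel_measurable borel" for n
    by (simp add: borel_prod)
  have "(\<lambda>n. \<integral>z. \<bar>G z - g n z\<bar> \<partial>lborel) \<longlonglongrightarrow> (\<integral>z. 0 \<partial>(lborel :: (real \<times> real) measure))"
  proof (rule integral_dominated_convergence[where w = "\<lambda>z. \<bar>G z\<bar>"])
    show "integrable lborel (\<lambda>z. \<bar>G z\<bar>)"
      using G by simp
    show "AE z in lborel. (\<lambda>n. \<bar>G z - g n z\<bar>) \<longlonglongrightarrow> 0"
    proof (rule AE_I2)
      fix z
      obtain m :: nat where m: "max \<bar>G z\<bar> (max \<bar>fst z\<bar> \<bar>snd z\<bar>) \<le> real m"
        using real_arch_simple by blast
      have "\<bar>G z - g n z\<bar> = 0" if "m \<le> n" for n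
        using m of_nat_mono[OF that, where 'a = real] by (auto simp: g_def)
      then show "(\<lambda>n. \<bar>G z - g n z\<bar>) \<longlonglongrightarrow> 0"
        by (intro tendsto_eventually eventually_sequentiallyI[of m])
    qed
    show "(\<lambda>z. \<bar>G z - g n z\<bar>) \<in> borel_measurable lborel" for n
      using G_meas g_meas[of n] by simp
  qed (auto simp: g_def)
  then have "(\<lambda>n. \<integral>z. \<bar>G z - g n z\<bar> \<partial>lborel) \<longlonglongrightarrow> 0"
    by simp
  then have "\<forall>\<^sub>F n in sequentially. (\<integral>z. \<bar>G z - g n z\<bar> \<partial>lborel) < \<epsilon> / 2"
    by (rule order_tendstoD) (use \<epsilon> in simp)
  then obtain n where n: "(\<integral>z. \<bar>G z - g n z\<bar> \<partial>lborel) < \<epsilon> / 2"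
    by (auto simp: eventually_sequentially)
  have g_int: "integrable lborel (g n)"
    by (rule Bochner_Integration.integrable_bound[OF G]) (auto simp: g_meas g_def[of n])
  obtain C where C: "\<And>\<epsilon> E. \<lbrakk>\<epsilon> > 0; finite E; orthonormal_set E;
      \<And>e. e \<in> E \<Longrightarrow> \<epsilon> \<le> cmod (\<integral>z. of_real (g n z) * ambiguity (rep_L2 e) z \<partial>lborel)\<rbrakk> \<Longrightarrow>
      real (card E) \<le> 2 * C / \<epsilon>\<^sup>2"
    by (rule ambiguity_form_card_bounded[of "g n" "real n" "real n"]) (auto simp: g_meas g_def[of n])
  show thesis
  proof (rule that[of "nat \<lfloor>2 * C / (\<epsilon> / 2)\<^sup>2\<rfloor>"])
    fix E
    assume E: "finite E" "orthonormal_set E"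
      and big: "\<And>e. e \<in> E \<Longrightarrow> \<epsilon> \<le> cmod (\<integral>z. of_real (G z) * ambiguity (rep_L2 e) z \<partial>lborel)"
    have "real (card E) \<le> 2 * C / (\<epsilon> / 2)\<^sup>2"
    proof (rule C)
      fix e assume e: "e \<in> E"
      have rep [measurable]: "rep_L2 e \<in> borel_measurable borel"
        using square_integrable_rep_L2[of e] by (simp add: square_integrable_def)
      have le1: "cmod (ambiguity (rep_L2 e) z) \<le> 1" for z
        using norm_ambiguity_le[OF square_integrable_rep_L2, of e z] e E(2)
          norm_abs_L2[OF square_integrable_rep_L2, of e]
        by (simp add: abs_rep_L2 orthonormal_set_def)
      have int: "integrable lborel (\<lambda>z. complex_of_real (h z) * ambiguity (rep_L2 e) z)"
        if h: "integrable lborel h" for h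
      proof (rule Bochner_Integration.integrable_bound[OF h])
        show "AE z in lborel. norm (complex_of_real (h z) * ambiguity (rep_L2 e) z) \<le> norm (h z)"
          using mult_left_le[OF le1] by (auto simp: norm_mult)
        show "(\<lambda>z. complex_of_real (h z) * ambiguity (rep_L2 e) z) \<in> borel_measurable lborel"
          using borel_measurable_integrable[OF h] measurable_ambiguity[OF rep]
          by (intro borel_measurable_times borel_measurable_of_real) auto
      qed
      have eq: "of_real (G z) * ambiguity (rep_L2 e) z =
          of_real (g n z) * ambiguity (rep_L2 e) z + of_real (G z - g n z) * ambiguity (rep_L2 e) z" for z
        by (simp add: algebra_simps)
      have split: "(\<integral>z. of_real (G z) * ambiguity (rep_L2 e) z \<partial>lborel) =
          (\<integral>z. of_real (g n z) * ambiguity (rep_L2 e) z \<partial>lborel) +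
          (\<integral>z. of_real (G z - g n z) * ambiguity (rep_L2 e) z \<partial>lborel)"
        using Bochner_Integration.integral_add[OF int[OF g_int]
            int[OF Bochner_Integration.integrable_diff[OF G g_int]]]
        by (simp only: eq[symmetric])
      have "cmod (\<integral>z. of_real (G z - g n z) * ambiguity (rep_L2 e) z \<partial>lborel) \<le>
          (\<integral>z. \<bar>G z - g n z\<bar> \<partial>lborel)"
      proof (rule Bochner_Integration.integral_norm_bound_integral[OF int])
        show "cmod (of_real (G z - g n z) * ambiguity (rep_L2 e) z) \<le> \<bar>G z - g n z\<bar>" for z
          using mult_left_le[OF le1[of z], of "\<bar>G z - g n z\<bar>"] by (simp add: norm_mult del: of_real_diff)
      qed (use G g_int in auto)
      then show "\<epsilon> / 2 \<le> cmod (\<integral>z. of_real (g n z) * ambiguity (rep_L2 e) z \<partial>lborel)"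
        using big[OF e, unfolded split] n norm_triangle_ineq[of
            "\<integral>z. of_real (g n z) * ambiguity (rep_L2 e) z \<partial>lborel"
            "\<integral>z. of_real (G z - g n z) * ambiguity (rep_L2 e) z \<partial>lborel"] by linarith
    qed (use \<epsilon> E in auto)
    then show "card E \<le> nat \<lfloor>2 * C / (\<epsilon> / 2)\<^sup>2\<rfloor>"
      by (metis floor_mono floor_of_nat nat_int nat_mono)
  qed
qed

section \<open>Weyl transforms and the autocorrelation of a measure\<close>

text \<open>A complex measure in polar form: \<open>\<nu>\<close> plays the total variation and
  \<open>\<theta>\<close> the phase. The phase is only bounded by 1, because \<open>sgn\<close> of a
  density is 0 where the density vanishes.\<close>

locale twisted_measure = finite_measure \<nu>
  for \<nu> :: "(real \<times> real) measure" +
  fixes \<theta> :: "real \<times> real \<Rightarrow> complex"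
  assumes sets_\<nu>: "sets \<nu> = sets borel"
    and measurable_\<theta>: "\<theta> \<in> borel_measurable borel"
    and norm_\<theta>: "cmod (\<theta> z) \<le> 1"
begin

sublocale P: pair_sigma_finite \<nu> \<nu> ..

definition phased :: "(real \<Rightarrow> complex) \<Rightarrow> real \<Rightarrow> real \<times> real \<Rightarrow> complex" where
  "phased f t z = cis_pi (fst z * snd z + 2 * snd z * t) * f (t + fst z) * \<theta> z"

definition weyl :: "(real \<Rightarrow> complex) \<Rightarrow> real \<Rightarrow> complex" where
  "weyl f t = (\<integral>z. phased f t z \<partial>\<nu>)"

text \<open>The cocycle of the Weyl operators: \<open>\<pi>(z')\<^sup>* \<pi>(z)\<close> is a unimodular multiple of \<open>\<pi>(z - z')\<close>.\<close>

definition twist :: "(real \<times> real) \<times> (real \<times> real) \<Rightarrow> complex" where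
  "twist w = \<theta> (fst w) * cnj (\<theta> (snd w)) *
    cis_pi (fst (fst w) * snd (snd w) - fst (snd w) * snd (fst w))"

lemma sets_\<nu>': "sets \<nu> = sets (borel \<Otimes>\<^sub>M borel)"
  by (simp only: sets_\<nu> borel_prod)

lemma sets_P: "sets (\<nu> \<Otimes>\<^sub>M \<nu>) = sets ((borel \<Otimes>\<^sub>M borel) \<Otimes>\<^sub>M (borel \<Otimes>\<^sub>M borel))"
  by (intro sets_pair_measure_cong sets_\<nu>')

lemma measurable_\<theta>' [measurable]: "\<theta> \<in> borel_measurable (borel \<Otimes>\<^sub>M borel)"
  using measurable_\<theta> by (simp add: borel_prod)

lemma measurable_difference [measurable]: "(\<lambda>w. fst w - snd w) \<in> (\<nu> \<Otimes>\<^sub>M \<nu>) \<rightarrow>\<^sub>M borel"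
proof -
  have "(\<lambda>w. fst w - snd w) \<in> (borel \<Otimes>\<^sub>M borel) \<rightarrow>\<^sub>M (borel :: (real \<times> real) measure)"
    by measurable
  then show ?thesis
    by (simp add: measurable_cong_sets[OF sets_pair_measure_cong[OF sets_\<nu> sets_\<nu>] refl])
qed

lemma finite_P: "finite_measure (\<nu> \<Otimes>\<^sub>M \<nu>)"
  by (rule finite_measure_pair_measure) unfold_locales

lemma measurable_twist [measurable]:
  "twist \<in> borel_measurable ((borel \<Otimes>\<^sub>M borel) \<Otimes>\<^sub>M (borel \<Otimes>\<^sub>M borel))"
  unfolding twist_def[abs_def] by measurable

lemma norm_twist: "cmod (twist w) \<le> 1"
  using mult_mono[OF norm_\<theta>[of "fst w"] norm_\<theta>[of "snd w"]]
  by (simp add: twist_def norm_mult)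

lemma norm_phased: "cmod (phased f t z) \<le> cmod (f (t + fst z))"
  using mult_left_le[OF norm_\<theta>[of z], of "cmod (f (t + fst z))"]
  by (simp add: phased_def norm_mult)

lemma measurable_phased [measurable]:
  assumes [measurable]: "f \<in> borel_measurable borel"
  shows "(\<lambda>w. phased f (fst w) (snd w)) \<in> borel_measurable (borel \<Otimes>\<^sub>M (borel \<Otimes>\<^sub>M borel))"
  unfolding phased_def by measurable

lemma measurable_weyl:
  assumes f: "f \<in> borel_measurable borel"
  shows "weyl f \<in> borel_measurable borel"
proof -
  have "(\<lambda>(t, z). phased f t z) \<in> borel_measurable (borel \<Otimes>\<^sub>M (borel \<Otimes>\<^sub>M borel))"
    using measurable_phased[OF f] by (simp only: split_beta')
  then have "(\<lambda>(t, z). phased f t z) \<in> borel_measurable (borel \<Otimes>\<^sub>M \<nu>)"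
    by (rule borel_measurable_sets_cong[rotated]) (intro sets_pair_measure_cong sets_\<nu>' refl)
  then show ?thesis
    unfolding weyl_def[abs_def] by (rule borel_measurable_lebesgue_integral)
qed

text \<open>By Tonelli's theorem the translates of \<open>f\<close> are square integrable against
  \<open>\<nu>\<close> for almost every \<open>t\<close>; finiteness of \<open>\<nu>\<close> and the
  bound \<open>a \<le> (1 + a\<^sup>2) / 2\<close> give integrability.\<close>

lemma AE_integrable_phased:
  assumes f: "square_integrable f"
  shows "AE t in lborel. integrable \<nu> (phased f t)"
proof -
  interpret L: pair_sigma_finite \<nu> "lborel :: real measure" ..
  have f_meas [measurable]: "f \<in> borel_measurable borel"
    using f by (simp add: square_integrable_def)
  have "(\<lambda>(z, t). (cmod (f (t + fst z)))\<^sup>2) \<in> borel_measurable ((borel \<Otimes>\<^sub>M borel) \<Otimes>\<^sub>M borel)"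
    by measurable
  then have meas: "(\<lambda>(z, t). (cmod (f (t + fst z)))\<^sup>2) \<in> borel_measurable (\<nu> \<Otimes>\<^sub>M (lborel :: real measure))"
    by (rule borel_measurable_sets_cong[rotated]) (intro sets_pair_measure_cong sets_\<nu>' sets_lborel refl)
  have "integrable (\<nu> \<Otimes>\<^sub>M lborel) (\<lambda>(z, t). (cmod (f (t + fst z)))\<^sup>2)"
    by (rule L.Fubini_integrable[OF meas])
      (use square_integrable_translate[OF f] in \<open>auto simp: square_integrable_def\<close>)
  then have "AE t in lborel. integrable \<nu> (\<lambda>z. (cmod (f (t + fst z)))\<^sup>2)"
    by (rule L.AE_integrable_snd)
  then show ?thesis
  proof (rule AE_mp, intro AE_I2 impI)
    fix t assume *: "integrable \<nu> (\<lambda>z. (cmod (f (t + fst z)))\<^sup>2)"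
    have "integrable \<nu> (\<lambda>z. (1 + (cmod (f (t + fst z)))\<^sup>2) / 2)"
      using * by simp
    then show "integrable \<nu> (phased f t)"
    proof (rule Bochner_Integration.integrable_bound)
      have "phased f t \<in> borel_measurable (borel \<Otimes>\<^sub>M borel)"
        unfolding phased_def[abs_def] by measurable
      then show "phased f t \<in> borel_measurable \<nu>"
        by (rule borel_measurable_sets_cong[OF sets_\<nu>'])
      have "cmod (phased f t z) \<le> (1 + (cmod (f (t + fst z)))\<^sup>2) / 2" for z
        using norm_phased[of f t z] two_mult_le_squares[of 1 "cmod (f (t + fst z))"] by simp
      then show "AE z in \<nu>. norm (phased f t z) \<le> norm ((1 + (cmod (f (t + fst z)))\<^sup>2) / 2)"
        by (intro AE_I2) (metis abs_ge_self order_trans real_norm_def)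
    qed
  qed
qed

text \<open>With \<open>t = u - x'\<close> the second factor becomes the conjugate of
  \<open>f u\<close>, up to phases. The two phases combine to the one of the ambiguity function at
  \<open>z - z'\<close>; what remains is the symplectic form \<open>x * y' - x' * y\<close>,
  recorded in \<open>twist\<close>.\<close>

lemma integral_phased_pair:
  "(\<integral>t. phased f t z * cnj (phased f t z') \<partial>lborel) = twist (z, z') * ambiguity f (z - z')"
proof -
  obtain x y x' y' where z: "z = (x, y)" "z' = (x', y')"
    by (cases z, cases z')
  have "(\<integral>t. phased f t z * cnj (phased f t z') \<partial>lborel) =
      (\<integral>u. phased f (- x' + 1 * u) z * cnj (phased f (- x' + 1 * u) z') \<partial>lborel)"
    using lborel_integral_real_affine[of 1 "\<lambda>t. phased f t z * cnj (phased f t z')" "- x'"] by simp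
  also have "\<dots> = (\<integral>u. twist (z, z') * (cis_pi ((x - x') * (y - y') + 2 * (y - y') * u) *
      f (u + (x - x')) * cnj (f u)) \<partial>lborel)"
  proof (rule Bochner_Integration.integral_cong[OF refl])
    fix u
    have "cis_pi (x * y + 2 * y * (u - x')) * cnj (cis_pi (x' * y' + 2 * y' * (u - x'))) =
        cis_pi (x * y' - x' * y) * cis_pi ((x - x') * (y - y') + 2 * (y - y') * u)"
      unfolding cnj_cis_pi cis_pi_add[symmetric] by (rule arg_cong[of _ _ cis_pi]) (simp add: algebra_simps)
    moreover have "- x' + 1 * u = u - x'" "u - x' + x = u + (x - x')" "u - x' + x' = u"
      by simp_all
    then have "phased f (- x' + 1 * u) z * cnj (phased f (- x' + 1 * u) z') =
        (cis_pi (x * y + 2 * y * (u - x')) * cnj (cis_pi (x' * y' + 2 * y' * (u - x')))) *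
        (f (u + (x - x')) * cnj (f u) * (\<theta> z * cnj (\<theta> z')))"
      by (simp only: phased_def z fst_conv snd_conv complex_cnj_mult mult_ac)
    ultimately have "phased f (- x' + 1 * u) z * cnj (phased f (- x' + 1 * u) z') =
        (cis_pi (x * y' - x' * y) * cis_pi ((x - x') * (y - y') + 2 * (y - y') * u)) *
        (f (u + (x - x')) * cnj (f u) * (\<theta> z * cnj (\<theta> z')))"
      by (simp only:)
    then show "phased f (- x' + 1 * u) z * cnj (phased f (- x' + 1 * u) z') =
        twist (z, z') * (cis_pi ((x - x') * (y - y') + 2 * (y - y') * u) * f (u + (x - x')) * cnj (f u))"
      by (simp only: twist_def z fst_conv snd_conv mult_ac)
  qed
  also have "\<dots> = twist (z, z') * ambiguity f (z - z')"
    by (simp add: ambiguity_def z)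
  finally show ?thesis .
qed

text \<open>The square of the modulus is an integral over pairs, and \<open>t\<close> is integrated
  out first. This is absolutely convergent: for each pair the modulus integrates in \<open>t\<close>
  to at most the squared norm of \<open>f\<close>, and the product measure is finite.\<close>

lemma energy_identity:
  assumes f: "square_integrable f"
  shows "complex_of_real (\<integral>t. (cmod (weyl f t))\<^sup>2 \<partial>lborel) =
    (\<integral>w. twist w * ambiguity f (fst w - snd w) \<partial>(\<nu> \<Otimes>\<^sub>M \<nu>))"
proof -
  interpret PP: finite_measure "\<nu> \<Otimes>\<^sub>M \<nu>" by (rule finite_P)
  interpret L: pair_sigma_finite "\<nu> \<Otimes>\<^sub>M \<nu>" "lborel :: real measure" ..
  have f_meas [measurable]: "f \<in> borel_measurable borel"
    using f by (simp add: square_integrable_def)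
  let ?H = "\<lambda>w t. phased f t (fst w) * cnj (phased f t (snd w))"
  have "(\<lambda>(w, t). ?H w t) \<in>
      borel_measurable (((borel \<Otimes>\<^sub>M borel) \<Otimes>\<^sub>M (borel \<Otimes>\<^sub>M borel)) \<Otimes>\<^sub>M borel)"
    unfolding phased_def by measurable
  then have meas: "(\<lambda>(w, t). ?H w t) \<in> borel_measurable ((\<nu> \<Otimes>\<^sub>M \<nu>) \<Otimes>\<^sub>M (lborel :: real measure))"
    by (rule borel_measurable_sets_cong[rotated]) (intro sets_pair_measure_cong sets_\<nu>' sets_lborel refl)
  define N where "N = (\<integral>u. (cmod (f u))\<^sup>2 \<partial>lborel)"
  have H_le: "norm (?H w t) \<le> ((cmod (f (t + fst (fst w))))\<^sup>2 + (cmod (f (t + fst (snd w))))\<^sup>2) / 2" for w t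
  proof -
    have "norm (?H w t) \<le> cmod (f (t + fst (fst w))) * cmod (f (t + fst (snd w)))"
      by (simp add: norm_mult mult_mono norm_phased)
    also note two_mult_le_squares
    finally show ?thesis .
  qed
  have sq: "integrable lborel (\<lambda>t. (cmod (f (t + a)))\<^sup>2)" for a
    using square_integrable_translate(1)[OF f] by (simp add: square_integrable_def)
  have H_int: "integrable lborel (?H w)" for w
  proof (rule Bochner_Integration.integrable_bound)
    show "integrable lborel (\<lambda>t. ((cmod (f (t + fst (fst w))))\<^sup>2 + (cmod (f (t + fst (snd w))))\<^sup>2) / 2)"
      using sq by simp
    show "?H w \<in> borel_measurable lborel"
      unfolding phased_def by measurable
    show "AE t in lborel. norm (?H w t) \<le>
        norm (((cmod (f (t + fst (fst w))))\<^sup>2 + (cmod (f (t + fst (snd w))))\<^sup>2) / 2)"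
      by (intro AE_I2 order_trans[OF H_le]) simp
  qed
  have H_bound: "(\<integral>t. norm (?H w t) \<partial>lborel) \<le> N" for w
  proof -
    have "(\<integral>t. norm (?H w t) \<partial>lborel) \<le>
        (\<integral>t. ((cmod (f (t + fst (fst w))))\<^sup>2 + (cmod (f (t + fst (snd w))))\<^sup>2) / 2 \<partial>lborel)"
      by (rule integral_mono[OF integrable_norm[OF H_int]]) (use sq H_le in auto)
    also have "\<dots> = N"
      using sq by (simp add: square_integrable_translate(2)[OF f] N_def)
    finally show ?thesis .
  qed
  have int: "integrable ((\<nu> \<Otimes>\<^sub>M \<nu>) \<Otimes>\<^sub>M lborel) (\<lambda>(w, t). ?H w t)"
  proof (rule L.Fubini_integrable[OF meas])
    have "(\<lambda>(w, t). norm (?H w t)) \<in> borel_measurable ((\<nu> \<Otimes>\<^sub>M \<nu>) \<Otimes>\<^sub>M (lborel :: real measure))"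
      using measurable_compose[OF meas borel_measurable_norm] by (simp only: split_beta')
    then have "(\<lambda>w. \<integral>t. norm (?H w t) \<partial>lborel) \<in> borel_measurable (\<nu> \<Otimes>\<^sub>M \<nu>)"
      by (rule lborel.borel_measurable_lebesgue_integral)
    then have "integrable (\<nu> \<Otimes>\<^sub>M \<nu>) (\<lambda>w. \<integral>t. norm (?H w t) \<partial>lborel)"
    proof (rule PP.integrable_const_bound[where B = N, rotated])
      show "AE w in \<nu> \<Otimes>\<^sub>M \<nu>. norm (\<integral>t. norm (?H w t) \<partial>lborel) \<le> N"
        using H_bound by (intro AE_I2) simp
    qed
    then show "integrable (\<nu> \<Otimes>\<^sub>M \<nu>) (\<lambda>w. \<integral>t. norm (case (w, t) of (w, t) \<Rightarrow> ?H w t) \<partial>lborel)"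
      by (simp only: prod.case)
  qed (use H_int in simp)
  have "complex_of_real (\<integral>t. (cmod (weyl f t))\<^sup>2 \<partial>lborel) =
      (\<integral>t. weyl f t * cnj (weyl f t) \<partial>lborel)"
    by (simp only: complex_norm_square[symmetric] integral_complex_of_real)
  also have "\<dots> = (\<integral>t. (\<integral>w. ?H w t \<partial>(\<nu> \<Otimes>\<^sub>M \<nu>)) \<partial>lborel)"
  proof (rule integral_cong_AE)
    have [measurable]: "weyl f \<in> borel_measurable borel"
      by (rule measurable_weyl[OF f_meas])
    show "(\<lambda>t. weyl f t * cnj (weyl f t)) \<in> borel_measurable lborel"
      by measurable
    show "(\<lambda>t. \<integral>w. ?H w t \<partial>(\<nu> \<Otimes>\<^sub>M \<nu>)) \<in> borel_measurable lborel"
      using L.integrable_snd[OF int] by auto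
    \<comment> \<open>The product of the two integrals is an integral over pairs once
      \<open>phased f t\<close> is integrable, which holds for almost every
      \<open>t\<close>.\<close>
    show "AE t in lborel. weyl f t * cnj (weyl f t) = (\<integral>w. ?H w t \<partial>(\<nu> \<Otimes>\<^sub>M \<nu>))"
    proof (rule AE_mp[OF AE_integrable_phased[OF f]], intro AE_I2 impI)
      fix t assume t: "integrable \<nu> (phased f t)"
      have "cnj (weyl f t) = (\<integral>z. cnj (phased f t z) \<partial>\<nu>)"
        unfolding weyl_def by (rule Bochner_Integration.integral_cnj[symmetric])
      then show "weyl f t * cnj (weyl f t) = (\<integral>w. ?H w t \<partial>(\<nu> \<Otimes>\<^sub>M \<nu>))"
        using P.integral_times[OF t, of "\<lambda>z. cnj (phased f t z)"] t by (simp add: weyl_def)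
    qed
  qed
  also have "\<dots> = (\<integral>w. (\<integral>t. ?H w t \<partial>lborel) \<partial>(\<nu> \<Otimes>\<^sub>M \<nu>))"
    by (rule L.Fubini_integral[OF int])
  also have "\<dots> = (\<integral>w. twist w * ambiguity f (fst w - snd w) \<partial>(\<nu> \<Otimes>\<^sub>M \<nu>))"
    by (simp add: integral_phased_pair)
  finally show ?thesis .
qed

text \<open>Boundedness of the operator is read off the energy identity, whose integrand is bounded
  by the squared norm of \<open>f\<close>; the constant is the mass of the product measure.\<close>

lemma energy_bound:
  assumes f: "square_integrable f"
  shows "(\<integral>t. (cmod (weyl f t))\<^sup>2 \<partial>lborel) \<le>
    measure (\<nu> \<Otimes>\<^sub>M \<nu>) (space (\<nu> \<Otimes>\<^sub>M \<nu>)) * (\<integral>t. (cmod (f t))\<^sup>2 \<partial>lborel)"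
proof -
  interpret PP: finite_measure "\<nu> \<Otimes>\<^sub>M \<nu>" by (rule finite_P)
  define N where "N = (\<integral>u. (cmod (f u))\<^sup>2 \<partial>lborel)"
  have "0 \<le> N"
    by (simp add: N_def)
  have le: "cmod (twist w * ambiguity f (fst w - snd w)) \<le> N" for w
    using mult_mono[OF norm_twist[of w] norm_ambiguity_le[OF f, of "fst w - snd w"]]
    by (simp add: norm_mult N_def)
  have "(\<integral>t. (cmod (weyl f t))\<^sup>2 \<partial>lborel) =
      cmod (complex_of_real (\<integral>t. (cmod (weyl f t))\<^sup>2 \<partial>lborel))"
    by simp
  also have "\<dots> = cmod (\<integral>w. twist w * ambiguity f (fst w - snd w) \<partial>(\<nu> \<Otimes>\<^sub>M \<nu>))"
    by (simp only: energy_identity[OF f])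
  also have "\<dots> \<le> (\<integral>w. N \<partial>(\<nu> \<Otimes>\<^sub>M \<nu>))"
  proof (cases "integrable (\<nu> \<Otimes>\<^sub>M \<nu>) (\<lambda>w. twist w * ambiguity f (fst w - snd w))")
    case True
    then show ?thesis
      by (rule Bochner_Integration.integral_norm_bound_integral) (auto simp: le)
  next
    \<comment> \<open>The Bochner integral of a non-integrable function is 0 by convention, so the
      estimate survives without a proof of integrability.\<close>
    case False
    then show ?thesis
      using \<open>0 \<le> N\<close> by (simp add: not_integrable_integral_eq)
  qed
  finally show ?thesis
    by (simp add: N_def)
qed

end

section \<open>Energy as an integral against Lebesgue densities\<close>

locale absolutely_continuous_differences = twisted_measure +
  assumes null_differences: "N \<in> null_sets lborel \<Longrightarrow>
    emeasure (\<nu> \<Otimes>\<^sub>M \<nu>) {w \<in> space (\<nu> \<Otimes>\<^sub>M \<nu>). fst w - snd w \<in> N} = 0"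
begin

text \<open>Radon-Nikodym theorem for the image under subtraction of the weighted product measure.
  The weight \<open>h\<close> is there because \<open>twist\<close> is not a function of the
  difference; it takes values between 0 and 1 so that the weighted measure is positive and finite. A
  single \<open>G\<close> serves every \<open>\<Phi>\<close>.\<close>

lemma difference_density:
  fixes h :: "(real \<times> real) \<times> (real \<times> real) \<Rightarrow> real"
  assumes h [measurable]: "h \<in> borel_measurable (\<nu> \<Otimes>\<^sub>M \<nu>)" and h0: "\<And>w. 0 \<le> h w" and h1: "\<And>w. h w \<le> 1"
  obtains G :: "real \<times> real \<Rightarrow> real" where "integrable lborel G"
    "\<And>\<Phi> :: real \<times> real \<Rightarrow> complex. \<Phi> \<in> borel_measurable borel \<Longrightarrow>
      (\<integral>w. of_real (h w) * \<Phi> (fst w - snd w) \<partial>(\<nu> \<Otimes>\<^sub>M \<nu>)) = (\<integral>z. of_real (G z) * \<Phi> z \<partial>lborel)"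
proof -
  interpret PP: finite_measure "\<nu> \<Otimes>\<^sub>M \<nu>" by (rule finite_P)
  define Q where "Q = density (\<nu> \<Otimes>\<^sub>M \<nu>) (\<lambda>w. ennreal (h w))"
  define \<kappa> where "\<kappa> = distr Q borel (\<lambda>w. fst w - snd w)"
  have [measurable]: "(\<lambda>w. fst w - snd w) \<in> Q \<rightarrow>\<^sub>M borel"
    unfolding Q_def using measurable_difference by simp
  have total: "emeasure \<kappa> UNIV < \<infinity>"
  proof -
    have "emeasure \<kappa> UNIV = emeasure Q (space Q)"
      unfolding \<kappa>_def by (subst emeasure_distr) (auto simp: Q_def)
    also have "\<dots> = (\<integral>\<^sup>+w. ennreal (h w) \<partial>(\<nu> \<Otimes>\<^sub>M \<nu>))"
      unfolding Q_def by (subst emeasure_density) (auto intro!: nn_integral_cong)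
    also have "\<dots> \<le> (\<integral>\<^sup>+w. 1 \<partial>(\<nu> \<Otimes>\<^sub>M \<nu>))"
      by (rule nn_integral_mono) (use h1 in \<open>simp add: ennreal_le_1\<close>)
    also have "\<dots> < \<infinity>"
      by (simp add: less_top[symmetric])
    finally show ?thesis .
  qed
  have "absolutely_continuous lborel \<kappa>"
    unfolding absolutely_continuous_def
  proof
    fix N :: "(real \<times> real) set" assume N: "N \<in> null_sets lborel"
    then have [measurable]: "N \<in> sets borel" by auto
    let ?S = "{w \<in> space (\<nu> \<Otimes>\<^sub>M \<nu>). fst w - snd w \<in> N}"
    have S: "?S \<in> null_sets (\<nu> \<Otimes>\<^sub>M \<nu>)"
      using null_differences[OF N] by (intro null_setsI) auto
    have "emeasure \<kappa> N = emeasure Q ?S"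
      unfolding \<kappa>_def by (subst emeasure_distr) (auto simp: Q_def intro!: arg_cong2[of _ _ _ _ emeasure])
    also have "\<dots> = 0"
      using null_sets_density_iff[of "\<lambda>w. ennreal (h w)" "\<nu> \<Otimes>\<^sub>M \<nu>" ?S] S AE_not_in[OF S]
      by (auto simp: Q_def null_sets_def)
    finally show "N \<in> null_sets \<kappa>"
      using N by (auto simp: \<kappa>_def null_sets_def)
  qed
  moreover have "sets \<kappa> = sets lborel"
    by (simp add: \<kappa>_def)
  ultimately obtain \<rho> where \<rho>: "\<rho> \<in> borel_measurable lborel" and dens: "density lborel \<rho> = \<kappa>"
    using sigma_finite_measure.Radon_Nikodym[OF sigma_finite_lborel] by blast
  then have [measurable]: "\<rho> \<in> borel_measurable borel"
    by simp
  have "(\<integral>\<^sup>+z. \<rho> z \<partial>lborel) = emeasure \<kappa> UNIV"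
    unfolding dens[symmetric] by (subst emeasure_density) auto
  with total have \<rho>_fin: "(\<integral>\<^sup>+z. \<rho> z \<partial>lborel) < \<infinity>"
    by simp
  then have AE_fin: "AE z in lborel. \<rho> z \<noteq> \<infinity>"
    by (intro nn_integral_PInf_AE) auto
  \<comment> \<open>The Radon-Nikodym density takes extended values; its integral is finite, so
    passing to real values changes it on a null set only.\<close>
  define G where "G z = enn2real (\<rho> z)" for z
  have [measurable]: "G \<in> borel_measurable borel"
    unfolding G_def by measurable
  have G_eq: "AE z in lborel. ennreal (G z) = \<rho> z"
    using AE_fin by (rule AE_mp) (auto simp: G_def less_top intro!: AE_I2)
  have G_dens: "density lborel (\<lambda>z. ennreal (G z)) = \<kappa>"
    unfolding dens[symmetric] by (rule density_cong) (use G_eq in auto)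
  show thesis
  proof (rule that)
    show "integrable lborel G"
    proof (rule integrableI_bounded)
      have "(\<integral>\<^sup>+z. ennreal (norm (G z)) \<partial>lborel) = (\<integral>\<^sup>+z. \<rho> z \<partial>lborel)"
        by (rule nn_integral_cong_AE, rule AE_mp[OF G_eq]) (auto simp: G_def intro!: AE_I2)
      then show "(\<integral>\<^sup>+z. ennreal (norm (G z)) \<partial>lborel) < \<infinity>"
        using \<rho>_fin by simp
    qed simp
    fix \<Phi> :: "real \<times> real \<Rightarrow> complex"
    assume [measurable]: "\<Phi> \<in> borel_measurable borel"
    have "(\<integral>z. of_real (G z) * \<Phi> z \<partial>lborel) = (\<integral>z. \<Phi> z \<partial>density lborel (\<lambda>z. ennreal (G z)))"
      by (subst integral_density) (auto simp: G_def scaleR_conv_of_real)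
    also have "\<dots> = (\<integral>w. \<Phi> (fst w - snd w) \<partial>Q)"
      unfolding G_dens \<kappa>_def by (rule integral_distr) auto
    also have "\<dots> = (\<integral>w. of_real (h w) * \<Phi> (fst w - snd w) \<partial>(\<nu> \<Otimes>\<^sub>M \<nu>))"
      unfolding Q_def by (subst integral_density) (auto simp: h0 scaleR_conv_of_real)
    finally show "(\<integral>w. of_real (h w) * \<Phi> (fst w - snd w) \<partial>(\<nu> \<Otimes>\<^sub>M \<nu>)) = (\<integral>z. of_real (G z) * \<Phi> z \<partial>lborel)"
      by simp
  qed
qed

text \<open>The positive and negative parts of the real and imaginary parts of \<open>twist\<close>
  are admissible weights, each with a density of its own. The four densities are fixed before
  \<open>f\<close>, which the counting of orthonormal vectors relies on.\<close>

lemma energy_decomposition: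
  obtains G1 G2 G3 G4 :: "real \<times> real \<Rightarrow> real"
  where "integrable lborel G1" "integrable lborel G2" "integrable lborel G3" "integrable lborel G4"
    "\<And>f. square_integrable f \<Longrightarrow> complex_of_real (\<integral>t. (cmod (weyl f t))\<^sup>2 \<partial>lborel) =
      (\<integral>z. of_real (G1 z) * ambiguity f z \<partial>lborel) - (\<integral>z. of_real (G2 z) * ambiguity f z \<partial>lborel) +
      \<i> * ((\<integral>z. of_real (G3 z) * ambiguity f z \<partial>lborel) - (\<integral>z. of_real (G4 z) * ambiguity f z \<partial>lborel))"
proof -
  interpret PP: finite_measure "\<nu> \<Otimes>\<^sub>M \<nu>" by (rule finite_P)
  define h where "h r w = max 0 (r (twist w))" for r :: "complex \<Rightarrow> real" and w
  have twist [measurable]: "twist \<in> borel_measurable (\<nu> \<Otimes>\<^sub>M \<nu>)"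
    by (rule borel_measurable_sets_cong[OF sets_P measurable_twist])
  have G: "\<exists>G. integrable lborel G \<and> (\<forall>f. square_integrable f \<longrightarrow>
      (\<integral>w. of_real (h r w) * ambiguity f (fst w - snd w) \<partial>(\<nu> \<Otimes>\<^sub>M \<nu>)) =
      (\<integral>z. of_real (G z) * ambiguity f z \<partial>lborel))"
    if r [measurable]: "r \<in> borel_measurable borel" and le: "\<And>c. \<bar>r c\<bar> \<le> cmod c" for r
  proof -
    have h: "h r \<in> borel_measurable (\<nu> \<Otimes>\<^sub>M \<nu>)" "0 \<le> h r w" "h r w \<le> 1" for w
      using le[of "twist w"] norm_twist[of w] unfolding h_def by (measurable, auto)
    obtain G where "integrable lborel G" "\<And>\<Phi> :: real \<times> real \<Rightarrow> complex. \<Phi> \<in> borel_measurable borel \<Longrightarrow>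
        (\<integral>w. of_real (h r w) * \<Phi> (fst w - snd w) \<partial>(\<nu> \<Otimes>\<^sub>M \<nu>)) = (\<integral>z. of_real (G z) * \<Phi> z \<partial>lborel)"
      by (rule difference_density[OF h]) blast
    then show ?thesis
      by (intro exI[of _ G]) (auto simp: square_integrable_def intro!: measurable_ambiguity)
  qed
  let ?r1 = "Re" and ?r2 = "\<lambda>c. - Re c" and ?r3 = "Im" and ?r4 = "\<lambda>c. - Im c"
  obtain G1 where G1: "integrable lborel G1" "\<And>f. square_integrable f \<Longrightarrow>
      (\<integral>w. of_real (h ?r1 w) * ambiguity f (fst w - snd w) \<partial>(\<nu> \<Otimes>\<^sub>M \<nu>)) = (\<integral>z. of_real (G1 z) * ambiguity f z \<partial>lborel)"
    using G[of ?r1] abs_Re_le_cmod by auto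
  obtain G2 where G2: "integrable lborel G2" "\<And>f. square_integrable f \<Longrightarrow>
      (\<integral>w. of_real (h ?r2 w) * ambiguity f (fst w - snd w) \<partial>(\<nu> \<Otimes>\<^sub>M \<nu>)) = (\<integral>z. of_real (G2 z) * ambiguity f z \<partial>lborel)"
    using G[of ?r2] abs_Re_le_cmod by auto
  obtain G3 where G3: "integrable lborel G3" "\<And>f. square_integrable f \<Longrightarrow>
      (\<integral>w. of_real (h ?r3 w) * ambiguity f (fst w - snd w) \<partial>(\<nu> \<Otimes>\<^sub>M \<nu>)) = (\<integral>z. of_real (G3 z) * ambiguity f z \<partial>lborel)"
    using G[of ?r3] abs_Im_le_cmod by auto
  obtain G4 where G4: "integrable lborel G4" "\<And>f. square_integrable f \<Longrightarrow>
      (\<integral>w. of_real (h ?r4 w) * ambiguity f (fst w - snd w) \<partial>(\<nu> \<Otimes>\<^sub>M \<nu>)) = (\<integral>z. of_real (G4 z) * ambiguity f z \<partial>lborel)"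
    using G[of ?r4] abs_Im_le_cmod by auto
  show thesis
  proof (rule that[OF G1(1) G2(1) G3(1) G4(1)])
    fix f assume f: "square_integrable f"
    have f_meas: "f \<in> borel_measurable borel"
      using f by (simp add: square_integrable_def)
    let ?a = "\<lambda>w. ambiguity f (fst w - snd w)"
    have a_meas: "?a \<in> borel_measurable (\<nu> \<Otimes>\<^sub>M \<nu>)"
      by (rule measurable_compose[OF measurable_difference measurable_ambiguity[OF f_meas]])
    have int: "integrable (\<nu> \<Otimes>\<^sub>M \<nu>) (\<lambda>w. of_real (h r w) * ?a w)"
      if r [measurable]: "r \<in> borel_measurable borel" and le: "\<And>c. \<bar>r c\<bar> \<le> cmod c" for r
    proof (rule PP.integrable_const_bound)
      have h_le: "0 \<le> h r w" "h r w \<le> 1" for w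
        using le[of "twist w"] norm_twist[of w] by (auto simp: h_def)
      show "AE w in \<nu> \<Otimes>\<^sub>M \<nu>. norm (of_real (h r w) * ?a w) \<le> (\<integral>u. (cmod (f u))\<^sup>2 \<partial>lborel)"
      proof (rule AE_I2)
        fix w
        show "norm (of_real (h r w) * ?a w) \<le> (\<integral>u. (cmod (f u))\<^sup>2 \<partial>lborel)"
          using mult_mono[OF h_le(2)[of w] norm_ambiguity_le[OF f, of "fst w - snd w"]] h_le(1)[of w]
          by (simp add: norm_mult)
      qed
      have "h r \<in> borel_measurable (\<nu> \<Otimes>\<^sub>M \<nu>)"
        unfolding h_def by measurable
      then show "(\<lambda>w. of_real (h r w) * ?a w) \<in> borel_measurable (\<nu> \<Otimes>\<^sub>M \<nu>)"
        using a_meas by measurable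
    qed
    have int1: "integrable (\<nu> \<Otimes>\<^sub>M \<nu>) (\<lambda>w. of_real (h ?r1 w) * ?a w)"
      by (rule int) (auto intro: abs_Re_le_cmod)
    have int2: "integrable (\<nu> \<Otimes>\<^sub>M \<nu>) (\<lambda>w. of_real (h ?r2 w) * ?a w)"
      by (rule int) (auto intro: abs_Re_le_cmod)
    have int3: "integrable (\<nu> \<Otimes>\<^sub>M \<nu>) (\<lambda>w. of_real (h ?r3 w) * ?a w)"
      by (rule int) (auto intro: abs_Im_le_cmod)
    have int4: "integrable (\<nu> \<Otimes>\<^sub>M \<nu>) (\<lambda>w. of_real (h ?r4 w) * ?a w)"
      by (rule int) (auto intro: abs_Im_le_cmod)
    have "twist w * ?a w = (of_real (h ?r1 w) * ?a w - of_real (h ?r2 w) * ?a w) +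
        \<i> * (of_real (h ?r3 w) * ?a w - of_real (h ?r4 w) * ?a w)" for w
    proof -
      have "twist w = (of_real (h ?r1 w) - of_real (h ?r2 w)) + \<i> * (of_real (h ?r3 w) - of_real (h ?r4 w))"
        by (auto simp: complex_eq_iff h_def)
      then show ?thesis
        by (metis (no_types, lifting) distrib_right left_diff_distrib mult.assoc)
    qed
    then have "complex_of_real (\<integral>t. (cmod (weyl f t))\<^sup>2 \<partial>lborel) =
        (\<integral>w. (of_real (h ?r1 w) * ?a w - of_real (h ?r2 w) * ?a w) +
          \<i> * (of_real (h ?r3 w) * ?a w - of_real (h ?r4 w) * ?a w) \<partial>(\<nu> \<Otimes>\<^sub>M \<nu>))"
      by (simp only: energy_identity[OF f])
    also have "\<dots> =
      ((\<integral>w. of_real (h ?r1 w) * ?a w \<partial>(\<nu> \<Otimes>\<^sub>M \<nu>)) - (\<integral>w. of_real (h ?r2 w) * ?a w \<partial>(\<nu> \<Otimes>\<^sub>M \<nu>))) +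
      \<i> * ((\<integral>w. of_real (h ?r3 w) * ?a w \<partial>(\<nu> \<Otimes>\<^sub>M \<nu>)) - (\<integral>w. of_real (h ?r4 w) * ?a w \<partial>(\<nu> \<Otimes>\<^sub>M \<nu>)))"
      using int1 int2 int3 int4 by simp
    finally show "complex_of_real (\<integral>t. (cmod (weyl f t))\<^sup>2 \<partial>lborel) =
      (\<integral>z. of_real (G1 z) * ambiguity f z \<partial>lborel) - (\<integral>z. of_real (G2 z) * ambiguity f z \<partial>lborel) +
      \<i> * ((\<integral>z. of_real (G3 z) * ambiguity f z \<partial>lborel) - (\<integral>z. of_real (G4 z) * ambiguity f z \<partial>lborel))"
      by (simp only: G1(2)[OF f] G2(2)[OF f] G3(2)[OF f] G4(2)[OF f])
  qed
qed

text \<open>Where the energy is at least \<open>\<epsilon>\<close>, one of the four forms has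
  modulus at least \<open>\<epsilon> / 4\<close>. Hence \<open>E\<close> is the union of four
  orthonormal sets, each of cardinality bounded in terms of its own density.\<close>

lemma weyl_card:
  assumes "\<epsilon> > 0"
  obtains N where "\<And>E. \<lbrakk>finite E; orthonormal_set E;
      \<And>e. e \<in> E \<Longrightarrow> \<epsilon> \<le> (\<integral>t. (cmod (weyl (rep_L2 e) t))\<^sup>2 \<partial>lborel)\<rbrakk> \<Longrightarrow> card E \<le> N"
proof -
  let ?A = "\<lambda>G e. \<integral>z. complex_of_real (G z) * ambiguity (rep_L2 e) z \<partial>lborel"
  obtain G1 G2 G3 G4 :: "real \<times> real \<Rightarrow> real" where
    G: "integrable lborel G1" "integrable lborel G2" "integrable lborel G3" "integrable lborel G4"
    and dec: "\<And>f. square_integrable f \<Longrightarrow> complex_of_real (\<integral>t. (cmod (weyl f t))\<^sup>2 \<partial>lborel) =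
      (\<integral>z. of_real (G1 z) * ambiguity f z \<partial>lborel) - (\<integral>z. of_real (G2 z) * ambiguity f z \<partial>lborel) +
      \<i> * ((\<integral>z. of_real (G3 z) * ambiguity f z \<partial>lborel) - (\<integral>z. of_real (G4 z) * ambiguity f z \<partial>lborel))"
    by (rule energy_decomposition) blast
  have "\<exists>N. \<forall>E. finite E \<longrightarrow> orthonormal_set E \<longrightarrow> (\<forall>e\<in>E. \<epsilon> / 4 \<le> cmod (?A G e)) \<longrightarrow> card E \<le> N"
    if "integrable lborel G" for G
  proof -
    have "\<epsilon> / 4 > 0"
      using \<open>\<epsilon> > 0\<close> by simp
    show ?thesis
      by (rule ambiguity_form_card[OF that \<open>\<epsilon> / 4 > 0\<close>]) blast
  qed
  then obtain N where N: "\<And>G E. integrable lborel G \<Longrightarrow> finite E \<Longrightarrow> orthonormal_set E \<Longrightarrow>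
      (\<And>e. e \<in> E \<Longrightarrow> \<epsilon> / 4 \<le> cmod (?A G e)) \<Longrightarrow> card E \<le> N G"
    by metis
  show thesis
  proof (rule that)
    fix E assume E: "finite E" "orthonormal_set E"
      and big: "\<And>e. e \<in> E \<Longrightarrow> \<epsilon> \<le> (\<integral>t. (cmod (weyl (rep_L2 e) t))\<^sup>2 \<partial>lborel)"
    define S where "S G = {e \<in> E. \<epsilon> / 4 \<le> cmod (?A G e)}" for G
    have card_S: "card (S G) \<le> N G" if "integrable lborel G" for G
    proof (rule N[OF that])
      show "orthonormal_set (S G)"
        using E(2) by (auto simp: orthonormal_set_def S_def pairwise_def)
    qed (auto simp: S_def E)
    have "E \<subseteq> S G1 \<union> S G2 \<union> (S G3 \<union> S G4)"
    proof
      fix e assume e: "e \<in> E"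
      have "\<epsilon> \<le> cmod (complex_of_real (\<integral>t. (cmod (weyl (rep_L2 e) t))\<^sup>2 \<partial>lborel))"
        using big[OF e] by simp
      also have "\<dots> = cmod ((?A G1 e - ?A G2 e) + \<i> * (?A G3 e - ?A G4 e))"
        by (simp only: dec[OF square_integrable_rep_L2])
      also have "\<dots> \<le> cmod (?A G1 e - ?A G2 e) + cmod (?A G3 e - ?A G4 e)"
        using norm_triangle_ineq[of "?A G1 e - ?A G2 e" "\<i> * (?A G3 e - ?A G4 e)"] by (simp add: norm_mult)
      also have "\<dots> \<le> (cmod (?A G1 e) + cmod (?A G2 e)) + (cmod (?A G3 e) + cmod (?A G4 e))"
        by (intro add_mono norm_triangle_ineq4)
      finally show "e \<in> S G1 \<union> S G2 \<union> (S G3 \<union> S G4)"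
        using e by (auto simp: S_def)
    qed
    then have "card E \<le> card (S G1 \<union> S G2 \<union> (S G3 \<union> S G4))"
      using E(1) by (intro card_mono) (auto simp: S_def)
    also have "\<dots> \<le> (card (S G1) + card (S G2)) + (card (S G3) + card (S G4))"
      by (intro order_trans[OF card_Un_le] add_mono card_Un_le)
    also have "\<dots> \<le> (N G1 + N G2) + (N G3 + N G4)"
      by (intro add_mono card_S G)
    finally show "card E \<le> (N G1 + N G2) + (N G3 + N G4)" .
  qed
qed

end

section \<open>Differences of points on curves of finite type\<close>

lemma Ck_on_cong:
  assumes "open S" "\<And>x. x \<in> S \<Longrightarrow> f x = g x" "Ck_on k S f"
  shows "Ck_on k S g"
proof (cases k)
  case 0
  then show ?thesis
    using assms by (auto cong: continuous_on_cong)
next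
  case (Suc n)
  then obtain f' where f': "\<And>x. x \<in> S \<Longrightarrow> (f has_derivative f' x) (at x)" "\<And>v. Ck_on n S (\<lambda>x. f' x v)"
    using assms(3) by auto
  have "(g has_derivative f' x) (at x)" if "x \<in> S" for x
    using has_derivative_transform_within_open[OF f'(1)[OF that] assms(1) that] assms(2) by blast
  then show ?thesis
    using f'(2) Suc by auto
qed

lemma smooth_on_imp_continuous_on: "smooth_on S f \<Longrightarrow> continuous_on S f"
  unfolding smooth_on_def by (metis Ck_on.simps(1))

text \<open>\<open>Ck_on\<close> supplies a derivative for each order separately. Uniqueness of
  derivatives identifies them all with \<open>vector_derivative\<close>, and on the line the
  direction 1 recovers it from the directional derivatives.\<close>

lemma smooth_on_vector_derivative:
  assumes "open I" "smooth_on I \<gamma>"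
  shows "s \<in> I \<Longrightarrow> (\<gamma> has_vector_derivative vector_derivative \<gamma> (at s)) (at s)"
    and "smooth_on I (\<lambda>s. vector_derivative \<gamma> (at s))"
proof -
  have *: "\<exists>f'. (\<forall>x\<in>I. (\<gamma> has_derivative f' x) (at x)) \<and> (\<forall>v. Ck_on k I (\<lambda>x. f' x v))" for k
    using assms(2) unfolding smooth_on_def by (metis Ck_on.simps(2))
  have vd: "(\<gamma> has_vector_derivative f' 1) (at x)" if "(\<gamma> has_derivative f') (at x)" for f' and x :: real
  proof -
    have "linear f'"
      using that by (rule has_derivative_linear)
    then have "f' = (\<lambda>h. h *\<^sub>R f' 1)"
      by (metis linear_scale mult.right_neutral real_scaleR_def)
    then show ?thesis
      using that unfolding has_vector_derivative_def by simp
  qed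
  show "(\<gamma> has_vector_derivative vector_derivative \<gamma> (at s)) (at s)" if "s \<in> I"
    using *[of 0] vd that vector_derivative_works vector_derivative_at by metis
  show "smooth_on I (\<lambda>s. vector_derivative \<gamma> (at s))"
    unfolding smooth_on_def
  proof
    fix k
    obtain f' where f': "\<And>x. x \<in> I \<Longrightarrow> (\<gamma> has_derivative f' x) (at x)" "\<And>v. Ck_on k I (\<lambda>x. f' x v)"
      using *[of k] by blast
    show "Ck_on k I (\<lambda>s. vector_derivative \<gamma> (at s))"
      by (rule Ck_on_cong[OF assms(1) _ f'(2)[of 1]]) (use vector_derivative_at[OF vd[OF f'(1)]] in auto)
  qed
qed

lemma curve_deriv_Suc: "curve_deriv (Suc k) \<gamma> s = vector_derivative (curve_deriv k \<gamma>) (at s)"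
  by (simp add: curve_deriv_def)

lemma smooth_on_curve_deriv:
  assumes "open I" "smooth_on I \<gamma>"
  shows "smooth_on I (curve_deriv k \<gamma>)"
proof (induction k)
  case 0
  then show ?case
    using assms(2) by (simp add: curve_deriv_def)
next
  case (Suc k)
  have "curve_deriv (Suc k) \<gamma> = (\<lambda>s. vector_derivative (curve_deriv k \<gamma>) (at s))"
    by (simp add: fun_eq_iff curve_deriv_Suc)
  then show ?case
    using smooth_on_vector_derivative(2)[OF assms(1) Suc] by simp
qed

lemma has_vector_derivative_curve_deriv:
  assumes "open I" "smooth_on I \<gamma>" "s \<in> I"
  shows "(curve_deriv k \<gamma> has_vector_derivative curve_deriv (Suc k) \<gamma> s) (at s)"
  unfolding curve_deriv_Suc
  by (rule smooth_on_vector_derivative(1)[OF assms(1) smooth_on_curve_deriv[OF assms(1,2)] assms(3)])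

section \<open>Directions orthogonal to the tangent\<close>

text \<open>Continuity makes \<open>s\<close> itself a zero. Rolle's theorem between
  \<open>s\<close> and a nearby zero then yields a zero of the derivative strictly between them, in
  particular different from \<open>s\<close>, so that the argument can be iterated.\<close>

lemma islimpt_zeros_deriv:
  fixes f :: "real \<Rightarrow> real"
  assumes I: "open I" "s \<in> I" and der: "\<And>x. x \<in> I \<Longrightarrow> (f has_real_derivative f' x) (at x)"
    and lim: "s islimpt {x \<in> I. f x = 0}"
  shows "f s = 0" "s islimpt {x \<in> I. f' x = 0}"
proof -
  have cont: "isCont f x" if "x \<in> I" for x
    using der[OF that] by (rule DERIV_isCont)
  show "f s = 0"
  proof (rule ccontr)
    assume "f s \<noteq> 0"
    then have "\<forall>\<^sub>F x in at s. f x \<noteq> 0"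
      using tendsto_imp_eventually_ne[OF cont[OF I(2), unfolded isCont_def]] by blast
    then have "\<forall>\<^sub>F x in at s. x \<notin> {x \<in> I. f x = 0}"
      by (rule eventually_mono) auto
    then show False
      using lim unfolding islimpt_iff_eventually by blast
  qed
  show "s islimpt {x \<in> I. f' x = 0}"
    unfolding islimpt_approachable
  proof (intro allI impI)
    fix \<epsilon> :: real assume "\<epsilon> > 0"
    obtain \<delta> where \<delta>: "\<delta> > 0" "ball s \<delta> \<subseteq> I"
      using I open_contains_ball by blast
    obtain x where x: "f x = 0" "x \<noteq> s" "dist x s < min \<epsilon> \<delta>"
      using lim \<open>\<epsilon> > 0\<close> \<delta>(1) unfolding islimpt_approachable by (metis (mono_tags, lifting) mem_Collect_eq min_less_iff_conj)
    define a b where "a = min x s" and "b = max x s"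
    have ab: "a < b" "f a = f b"
      using x \<open>f s = 0\<close> by (auto simp: a_def b_def min_def max_def)
    have sub: "{a..b} \<subseteq> ball s \<delta>"
      using x(3) by (auto simp: a_def b_def dist_real_def)
    have "\<exists>z. a < z \<and> z < b \<and> DERIV f z :> 0"
    proof (rule Rolle[OF ab])
      show "continuous_on {a..b} f"
        using sub \<delta>(2) cont by (intro continuous_at_imp_continuous_on) auto
      show "f differentiable (at z)" if "a < z" "z < b" for z
      proof -
        have "z \<in> I"
          using that sub \<delta>(2) by (meson atLeastAtMost_iff less_imp_le subsetD)
        then show ?thesis
          using der real_differentiable_def by blast
      qed
    qed
    then obtain z where z: "a < z" "z < b" "DERIV f z :> 0"
      by blast
    have "z \<in> I"
      using z sub \<delta>(2) by (meson atLeastAtMost_iff less_imp_le subsetD)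
    then have "f' z = 0"
      using der z(3) DERIV_unique by blast
    moreover have "z \<noteq> s" "dist z s < \<epsilon>"
      using z x(3) by (auto simp: a_def b_def dist_real_def min_def max_def split: if_splits)
    ultimately show "\<exists>y\<in>{x \<in> I. f' x = 0}. y \<noteq> s \<and> dist y s < \<epsilon>"
      using \<open>z \<in> I\<close> by blast
  qed
qed

text \<open>
  At an accumulation point of zeros of \<open>\<langle>\<gamma>', v\<rangle>\<close> all derivatives of \<open>\<langle>\<gamma>, v\<rangle>\<close> would vanish by
  Rolle's theorem.
\<close>

lemma negligible_tangent_orthogonal:
  assumes ft: "finite_type M" and M: "regular_param M I \<gamma>" "\<gamma> ` I \<subseteq> M" and "v \<noteq> 0"
  shows "negligible {s \<in> I. curve_deriv 1 \<gamma> s \<bullet> v = 0}"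
proof -
  have I: "open I" "smooth_on I \<gamma>"
    using M(1) by (auto simp: regular_param_def)
  let ?Z = "\<lambda>k. {s \<in> I. curve_deriv k \<gamma> s \<bullet> v = 0}"
  have der: "((\<lambda>s. curve_deriv k \<gamma> s \<bullet> v) has_real_derivative curve_deriv (Suc k) \<gamma> x \<bullet> v) (at x)"
    if "x \<in> I" for k x
  proof -
    have "((\<lambda>s. curve_deriv k \<gamma> s \<bullet> v) has_derivative (\<lambda>h. (h *\<^sub>R curve_deriv (Suc k) \<gamma> x) \<bullet> v)) (at x)"
      using has_vector_derivative_curve_deriv[OF I that, of k] unfolding has_vector_derivative_def
      by (rule has_derivative_inner_left)
    then show ?thesis
      by (simp add: has_field_derivative_def mult_commute_abs)
  qed
  have isolated: "\<not> s islimpt ?Z 1" if s: "s \<in> I" for s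
  proof
    assume lim: "s islimpt ?Z 1"
    \<comment> \<open>The induction starts with the first derivative, since finite type speaks of
      the orders from 1 on.\<close>
    have lim_k: "s islimpt ?Z (Suc k)" for k
    proof (induction k)
      case 0
      then show ?case
        using lim by simp
    next
      case (Suc k)
      then show ?case
        using islimpt_zeros_deriv(2)[OF I(1) s der] by blast
    qed
    have zero: "curve_deriv (Suc k) \<gamma> s \<bullet> v = 0" for k
      using islimpt_zeros_deriv(1)[OF I(1) s der lim_k] .
    have "norm (v /\<^sub>R norm v) = 1" "\<gamma> s \<in> M"
      using \<open>v \<noteq> 0\<close> M(2) s by auto
    then obtain k where "k \<ge> 1" "curve_deriv k \<gamma> s \<bullet> (v /\<^sub>R norm v) \<noteq> 0"
      using ft M(1) s unfolding finite_type_def by blast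
    then show False
      using zero[of "k - 1"] by simp
  qed
  show ?thesis
  \<comment> \<open>Negligibility is local, so isolated zeros suffice: each has a neighbourhood that
    meets the zero set in that point alone.\<close>
  proof (rule locally_negligible_alt[THEN iffD2], rule ballI)
    fix s assume s: "s \<in> ?Z 1"
    then have "s \<in> I"
      by simp
    from isolated[OF this] obtain T where T: "open T" "s \<in> T" "\<not> (\<exists>y\<in>?Z 1. y \<in> T \<and> y \<noteq> s)"
      unfolding islimpt_def not_all not_imp by (elim exE conjE) (rule that)
    have "?Z 1 \<inter> T = {s}"
    proof (intro equalityI subsetI)
      fix y assume "y \<in> ?Z 1 \<inter> T"
      then show "y \<in> {s}"
        using T(3) by (metis IntD1 IntD2 singletonI)
    qed (use T(2) s in simp)
    then have "negligible (?Z 1 \<inter> T)"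
      by (simp only: negligible_sing)
    then show "\<exists>U. openin (top_of_set (?Z 1)) U \<and> s \<in> U \<and> negligible U"
      using T(1,2) s by (intro exI[of _ "?Z 1 \<inter> T"] conjI openin_open_Int) simp_all
  qed
qed

section \<open>Null sets under the difference map\<close>

text \<open>Near each point the preimage lies in the image of \<open>N\<close> under a local inverse
  of \<open>G\<close>. The inverse function theorem makes that inverse differentiable, and
  differentiable maps between spaces of equal dimension preserve null sets.\<close>

lemma negligible_preimage_local_diffeo:
  fixes G :: "'a::euclidean_space \<Rightarrow> 'a"
  assumes "open W" and der: "\<And>x. x \<in> W \<Longrightarrow> (G has_derivative blinfun_apply (G' x)) (at x)"
    and cont: "continuous_on W G'" and inv: "\<And>x. x \<in> W \<Longrightarrow> \<exists>L. L o\<^sub>L G' x = id_blinfun"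
    and N: "negligible N"
  shows "negligible {x \<in> W. G x \<in> N}"
proof (rule locally_negligible_alt[THEN iffD2], rule ballI)
  let ?S = "{x \<in> W. G x \<in> N}"
  fix x assume x: "x \<in> ?S"
  then have xW: "x \<in> W"
    by simp
  obtain L where L: "L o\<^sub>L G' x = id_blinfun"
    using inv[OF xW] by (rule exE)
  obtain U V g g' where U: "open U" "U \<subseteq> W" "x \<in> U" "open V" "G x \<in> V"
    and hom: "homeomorphism U V G g" and g': "\<And>y. y \<in> V \<Longrightarrow> (g has_derivative (g' y)) (at y)"
    and "\<And>y. y \<in> V \<Longrightarrow> g' y = inv (blinfun_apply (G' (g y)))"
    and "\<And>y. y \<in> V \<Longrightarrow> bij (blinfun_apply (G' (g y)))"
    by (rule inverse_function_theorem[OF assms(1) der cont xW L]) (assumption | rule that)+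
  have "negligible (g ` (N \<inter> V))"
  proof (rule negligible_differentiable_image_negligible[OF order_refl])
    show "negligible (N \<inter> V)"
      using N by (rule negligible_subset) auto
    show "g differentiable_on N \<inter> V"
      using g' by (auto simp: differentiable_on_def differentiable_def intro: has_derivative_at_withinI)
  qed
  moreover have "?S \<inter> U \<subseteq> g ` (N \<inter> V)"
  proof
    fix y assume "y \<in> ?S \<inter> U"
    then have "g (G y) = y" "G y \<in> N \<inter> V"
      using hom by (auto simp: homeomorphism_def)
    then show "y \<in> g ` (N \<inter> V)"
      by (metis imageI)
  qed
  ultimately have "negligible (?S \<inter> U)"
    by (rule negligible_subset)
  then show "\<exists>U. openin (top_of_set ?S) U \<and> x \<in> U \<and> negligible U"
    using U(1,3) x by (intro exI[of _ "?S \<inter> U"] conjI openin_open_Int) auto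
qed

text \<open>Tonelli's theorem with the second coordinate held fixed. Measurability is part of the
  assumption because null slices alone do not force a set to be null.\<close>

lemma negligible_vertical_slices:
  fixes Z :: "(real \<times> real) set"
  assumes "Z \<in> sets borel" "\<And>t. negligible {s. (s, t) \<in> Z}"
  shows "negligible Z"
proof -
  have Z: "Z \<in> sets (lborel \<Otimes>\<^sub>M lborel)"
    using assms(1) by (simp only: lborel_prod sets_lborel)
  have "emeasure lborel Z = emeasure (lborel \<Otimes>\<^sub>M lborel) Z"
    by (simp only: lborel_prod)
  also have "\<dots> = (\<integral>\<^sup>+t. emeasure lborel ((\<lambda>s. (s, t)) -` Z) \<partial>lborel)"
    by (rule lborel_pair.emeasure_pair_measure_alt2[OF Z])
  also have "\<dots> = (\<integral>\<^sup>+t. 0 \<partial>(lborel :: real measure))"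
  proof (rule nn_integral_cong)
    fix t :: real
    have meas: "(\<lambda>s. (s, t)) -` Z \<in> sets borel"
    proof -
      have "(\<lambda>s. (s, t)) \<in> borel_measurable borel"
        by (intro borel_measurable_continuous_onI continuous_intros)
      from measurable_sets[OF this assms(1)] show ?thesis
        by simp
    qed
    have "negligible ((\<lambda>s. (s, t)) -` Z)"
      using assms(2)[of t] by (simp add: vimage_def)
    then have "emeasure lebesgue ((\<lambda>s. (s, t)) -` Z) = 0"
      by (simp add: negligible_iff_null_sets null_setsD1)
    then show "emeasure lborel ((\<lambda>s. (s, t)) -` Z) = 0"
      using meas by simp
  qed
  finally have "emeasure lborel Z = 0"
    by simp
  then show ?thesis
    using assms(1) by (auto simp: negligible_iff_null_sets null_sets_def)
qed

text \<open>A quarter turn. The inner product of \<open>a\<close> with \<open>normal_vec b\<close>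
  is minus the determinant of \<open>a\<close> and \<open>b\<close>, so it vanishes exactly when
  they are parallel.\<close>

definition normal_vec :: "real \<times> real \<Rightarrow> real \<times> real" where
  "normal_vec v = (- snd v, fst v)"

text \<open>\<open>det\<close> is the Jacobian determinant of the difference map. At fixed
  \<open>t\<close> its vanishing says that the tangent of \<open>\<gamma>\<close> is orthogonal to
  the fixed vector \<open>normal_vec (\<eta>' t)\<close>, nonzero by regularity of
  \<open>\<eta>\<close>; finite type makes those \<open>s\<close> negligible. Off the zeros of
  \<open>det\<close> the map is a local diffeomorphism.\<close>

lemma negligible_difference_preimage:
  assumes ft: "finite_type M"
    and \<gamma>: "regular_param M I \<gamma>" "\<gamma> ` I \<subseteq> M" and \<eta>: "regular_param M J \<eta>" "\<eta> ` J \<subseteq> M"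
    and N: "negligible N"
  shows "negligible {(s, t) \<in> I \<times> J. \<gamma> s - \<eta> t \<in> N}"
proof -
  have I: "open I" "smooth_on I \<gamma>" and J: "open J" "smooth_on J \<eta>" "\<And>t. t \<in> J \<Longrightarrow> curve_deriv 1 \<eta> t \<noteq> 0"
    using \<gamma> \<eta> by (auto simp: regular_param_def)
  define \<gamma>' where "\<gamma>' = curve_deriv 1 \<gamma>"
  define \<eta>' where "\<eta>' = curve_deriv 1 \<eta>"
  have d\<gamma>: "(\<gamma> has_vector_derivative \<gamma>' s) (at s)" if "s \<in> I" for s
    using has_vector_derivative_curve_deriv[OF I that, of 0] by (simp add: \<gamma>'_def curve_deriv_def)
  have d\<eta>: "(\<eta> has_vector_derivative \<eta>' s) (at s)" if "s \<in> J" for s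
    using has_vector_derivative_curve_deriv[OF J(1,2) that, of 0] by (simp add: \<eta>'_def curve_deriv_def)
  have c\<gamma>: "continuous_on I \<gamma>'" and c\<eta>: "continuous_on J \<eta>'"
    unfolding \<gamma>'_def \<eta>'_def
    by (intro smooth_on_imp_continuous_on smooth_on_curve_deriv I J)+
  have c\<gamma>2: "continuous_on (I \<times> J) (\<lambda>w. \<gamma>' (fst w))"
    by (rule continuous_on_compose2[OF c\<gamma>]) (auto intro: continuous_intros)
  have c\<eta>2: "continuous_on (I \<times> J) (\<lambda>w. \<eta>' (snd w))"
    by (rule continuous_on_compose2[OF c\<eta>]) (auto intro: continuous_intros)
  define det where "det w = \<gamma>' (fst w) \<bullet> normal_vec (\<eta>' (snd w))" for w
  have c_det: "continuous_on (I \<times> J) det"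
    unfolding det_def normal_vec_def by (intro continuous_intros c\<gamma>2 c\<eta>2)
  define Z where "Z = {w \<in> I \<times> J. det w = 0}"
  define W where "W = {w \<in> I \<times> J. det w \<noteq> 0}"
  have open_W: "open W"
  proof -
    have "open ((I \<times> J) \<inter> det -` (- {0}))"
      by (rule continuous_open_preimage[OF c_det]) (auto intro: open_Times I J)
    moreover have "(I \<times> J) \<inter> det -` (- {0}) = W"
      by (auto simp: W_def)
    ultimately show ?thesis
      by simp
  qed
  have "negligible Z"
  proof (rule negligible_vertical_slices)
    have "Z = I \<times> J - W"
      by (auto simp: Z_def W_def)
    then show "Z \<in> sets borel"
      using open_W open_Times[OF I(1) J(1)] by auto
    fix t
    show "negligible {s. (s, t) \<in> Z}"
    proof (cases "t \<in> J")
      case True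
      then have "normal_vec (\<eta>' t) \<noteq> 0"
        using J(3)[OF True] by (auto simp: normal_vec_def \<eta>'_def prod_eq_iff zero_prod_def)
      then have "negligible {s \<in> I. \<gamma>' s \<bullet> normal_vec (\<eta>' t) = 0}"
        unfolding \<gamma>'_def by (rule negligible_tangent_orthogonal[OF ft \<gamma>])
      then show ?thesis
        by (rule negligible_subset) (auto simp: Z_def det_def)
    qed (auto simp: Z_def)
  qed
  moreover have "negligible {w \<in> W. \<gamma> (fst w) - \<eta> (snd w) \<in> N}"
  proof (rule negligible_preimage_local_diffeo[OF open_W _ _ _ N])
    let ?G = "\<lambda>w. \<gamma> (fst w) - \<eta> (snd w)"
    let ?G' = "\<lambda>w. (blinfun_scaleR_left (\<gamma>' (fst w)) o\<^sub>L fst_blinfun) -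
      (blinfun_scaleR_left (\<eta>' (snd w)) o\<^sub>L snd_blinfun)"
    show "(?G has_derivative blinfun_apply (?G' w)) (at w)" if w: "w \<in> W" for w
    proof -
      have "fst w \<in> I" "snd w \<in> J"
        using w by (auto simp: W_def)
      then have "((\<lambda>w. \<gamma> (fst w)) has_derivative (\<lambda>h. fst h *\<^sub>R \<gamma>' (fst w))) (at w)"
        "((\<lambda>w. \<eta> (snd w)) has_derivative (\<lambda>h. snd h *\<^sub>R \<eta>' (snd w))) (at w)"
        using has_derivative_compose[OF has_derivative_fst[OF has_derivative_ident] d\<gamma>[unfolded has_vector_derivative_def], of w]
          has_derivative_compose[OF has_derivative_snd[OF has_derivative_ident] d\<eta>[unfolded has_vector_derivative_def], of w]
        by simp_all
      then have "(?G has_derivative (\<lambda>h. fst h *\<^sub>R \<gamma>' (fst w) - snd h *\<^sub>R \<eta>' (snd w))) (at w)"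
        by (rule has_derivative_diff)
      moreover have "blinfun_apply (?G' w) = (\<lambda>h. fst h *\<^sub>R \<gamma>' (fst w) - snd h *\<^sub>R \<eta>' (snd w))"
        by (rule ext) (simp add: blinfun.diff_left)
      ultimately show ?thesis
        by (simp only:)
    qed
    show "continuous_on W ?G'"
      by (intro continuous_intros continuous_on_subset[OF c\<gamma>2] continuous_on_subset[OF c\<eta>2])
        (auto simp: W_def)
    show "\<exists>L. L o\<^sub>L ?G' w = id_blinfun" if w: "w \<in> W" for w
    proof -
      define d where "d = det w"
      have "d \<noteq> 0"
        using w by (simp add: W_def d_def)
      define a b where "a = \<gamma>' (fst w)" and "b = \<eta>' (snd w)"
      have d: "d = - fst a * snd b + snd a * fst b"
        by (simp add: d_def det_def a_def b_def normal_vec_def inner_prod_def)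
      \<comment> \<open>Cramer's rule: \<open>l\<close> inverts the map taking \<open>(s, t)\<close>
        to \<open>s *\<^sub>R a - t *\<^sub>R b\<close>. Pairing with \<open>normal_vec b\<close>
        removes \<open>b\<close>, and pairing with \<open>normal_vec a\<close> removes
        \<open>a\<close>.\<close>
      define l where "l h = (h \<bullet> normal_vec b / d, h \<bullet> normal_vec a / d)" for h :: "real \<times> real"
      have "bounded_linear l"
        unfolding l_def by (intro bounded_linear_Pair bounded_linear_divide[THEN bounded_linear_compose] bounded_linear_inner_left)
      then have "Blinfun l o\<^sub>L ?G' w = id_blinfun"
        using \<open>d \<noteq> 0\<close>
        by (intro blinfun_eqI)
          (auto simp: bounded_linear_Blinfun_apply blinfun.diff_left l_def normal_vec_def inner_prod_def
            prod_eq_iff a_def[symmetric] b_def[symmetric], (simp add: field_simps d)+)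
      then show ?thesis
        by blast
    qed
  qed
  ultimately have "negligible (Z \<union> {w \<in> W. \<gamma> (fst w) - \<eta> (snd w) \<in> N})"
    by (rule negligible_Un)
  moreover have "{(s, t) \<in> I \<times> J. \<gamma> s - \<eta> t \<in> N} \<subseteq> Z \<union> {w \<in> W. \<gamma> (fst w) - \<eta> (snd w) \<in> N}"
    unfolding Z_def W_def by force
  ultimately show ?thesis
    by (rule negligible_subset)
qed

section \<open>Smooth measures\<close>

lemma regular_param_image_subset: "regular_param M I \<gamma> \<Longrightarrow> \<gamma> ` I \<subseteq> M"
  by (auto simp: regular_param_def dest: openin_imp_subset)

lemma regular_param_continuous_on: "regular_param M I \<gamma> \<Longrightarrow> continuous_on I \<gamma>"
  by (auto simp: regular_param_def homeomorphism_def)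

lemma regular_param_inj_on: "regular_param M I \<gamma> \<Longrightarrow> inj_on \<gamma> I"
  by (metis homeomorphism_def inj_on_inverseI regular_param_def)

text \<open>An open set of parameters is a countable union of compact sets, so the image is a
  countable union of compact sets.\<close>

lemma borel_regular_param_image:
  assumes "regular_param M I \<gamma>"
  shows "\<gamma> ` I \<in> sets borel"
proof -
  have "open I"
    using assms by (simp add: regular_param_def)
  then obtain C :: "nat \<Rightarrow> real set" where C: "\<And>n. compact (C n)" "\<And>n. C n \<subseteq> I" "\<Union>(range C) = I"
    using open_Union_compact_subsets[of I] by metis
  have "\<gamma> ` C n \<in> sets borel" for n
    using compact_continuous_image[OF continuous_on_subset[OF regular_param_continuous_on[OF assms] C(2)] C(1)]
    by (intro borel_closed compact_imp_closed)
  then have "(\<Union>n. \<gamma> ` C n) \<in> sets borel"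
    by (intro sets.countable_UN) auto
  then show ?thesis
    by (metis C(3) image_UN)
qed

text \<open>Carries Lebesgue null sets of parameters over to null sets of \<open>\<sigma>\<close>:
  the integrand in the characterization of arc length vanishes almost everywhere.\<close>

lemma arc_length_null_param:
  assumes \<sigma>: "arc_length_measure M \<sigma>" and \<gamma>: "regular_param M I \<gamma>"
    and B: "B \<in> sets borel" and ae: "AE s in lborel. s \<in> I \<longrightarrow> \<gamma> s \<notin> B"
  shows "emeasure \<sigma> (B \<inter> \<gamma> ` I) = 0"
proof -
  have "emeasure \<sigma> (B \<inter> \<gamma> ` I) =
      (\<integral>\<^sup>+s. ennreal (norm (curve_deriv 1 \<gamma> s)) * indicator (I \<inter> \<gamma> -` B) s \<partial>lborel)"
    using \<sigma> \<gamma> B by (auto simp: arc_length_measure_def)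
  also have "\<dots> = (\<integral>\<^sup>+s. 0 \<partial>(lborel :: real measure))"
    by (rule nn_integral_cong_AE, rule AE_mp[OF ae]) (auto simp: indicator_def intro!: AE_I2)
  finally show ?thesis
    by simp
qed

text \<open>The speed is bounded on a compact interval, and injectivity of \<open>\<gamma>\<close>
  makes that interval the whole preimage of the arc, so no other parameters contribute.\<close>

lemma arc_length_compact_finite:
  assumes \<sigma>: "arc_length_measure M \<sigma>" and \<gamma>: "regular_param M I \<gamma>" and ab: "{a..b} \<subseteq> I"
  shows "emeasure \<sigma> (\<gamma> ` {a..b}) < \<infinity>"
proof -
  have I: "open I" "smooth_on I \<gamma>"
    using \<gamma> by (auto simp: regular_param_def)
  have comp: "compact (\<gamma> ` {a..b})"
    by (intro compact_continuous_image continuous_on_subset[OF regular_param_continuous_on[OF \<gamma>] ab]) auto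
  have "continuous_on {a..b} (curve_deriv 1 \<gamma>)"
    by (rule continuous_on_subset[OF smooth_on_imp_continuous_on[OF smooth_on_curve_deriv[OF I]] ab])
  then have "bounded (curve_deriv 1 \<gamma> ` {a..b})"
    by (intro compact_imp_bounded compact_continuous_image) auto
  then obtain B where B: "\<And>s. s \<in> {a..b} \<Longrightarrow> norm (curve_deriv 1 \<gamma> s) \<le> B"
    unfolding bounded_iff by blast
  have eq: "I \<inter> \<gamma> -` (\<gamma> ` {a..b}) = {a..b}"
    using inj_onD[OF regular_param_inj_on[OF \<gamma>]] ab by blast
  have "emeasure \<sigma> (\<gamma> ` {a..b} \<inter> \<gamma> ` I) =
      (\<integral>\<^sup>+s. ennreal (norm (curve_deriv 1 \<gamma> s)) * indicator (I \<inter> \<gamma> -` (\<gamma> ` {a..b})) s \<partial>lborel)"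
    using \<sigma> \<gamma> borel_compact[OF comp] by (auto simp: arc_length_measure_def)
  also have "\<dots> \<le> (\<integral>\<^sup>+s. ennreal B * indicator {a..b} s \<partial>lborel)"
    unfolding eq
  proof (rule nn_integral_mono)
    fix s :: real
    show "ennreal (norm (curve_deriv 1 \<gamma> s)) * indicator {a..b} s \<le> ennreal B * indicator {a..b} s"
      using ennreal_leI[OF B, of s] by (cases "s \<in> {a..b}") simp_all
  qed
  also have "\<dots> < \<infinity>"
    by (simp add: nn_integral_cmult_indicator emeasure_lborel_Icc_eq ennreal_mult_less_top)
  finally show ?thesis
    using ab by (simp add: inf_absorb1 image_mono)
qed

text \<open>While \<open>M\<close> may have infinite length, each point has a neighbourhood in
  \<open>M\<close> contained in a compact arc of finite length, and finitely many such
  neighbourhoods cover \<open>K\<close>.\<close>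

lemma arc_length_finite_compact:
  assumes sub: "smooth_curve_submanifold M" and \<sigma>: "arc_length_measure M \<sigma>"
    and K: "compact K" "K \<subseteq> M"
  shows "emeasure \<sigma> K < \<infinity>"
proof -
  have sets: "sets \<sigma> = sets borel"
    using \<sigma> by (simp add: arc_length_measure_def)
  have "\<exists>T C. open T \<and> p \<in> T \<and> M \<inter> T \<subseteq> C \<and> compact C \<and> emeasure \<sigma> C < \<infinity>" if p: "p \<in> K" for p
  proof -
    have "p \<in> M"
      using K(2) p by (rule subsetD)
    then obtain I \<gamma> where \<gamma>: "regular_param M I \<gamma>" and "p \<in> \<gamma> ` I"
      using sub unfolding smooth_curve_submanifold_def by metis
    then obtain s where s: "s \<in> I" "\<gamma> s = p"
      by auto
    have "open I"
      using \<gamma> by (simp add: regular_param_def)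
    then obtain \<delta> where \<delta>: "\<delta> > 0" "cball s \<delta> \<subseteq> I"
      using s open_contains_cball by blast
    have sub: "{s - \<delta>..s + \<delta>} \<subseteq> I"
      using \<delta>(2) by (simp add: cball_eq_atLeastAtMost)
    obtain g where hom: "homeomorphism I (\<gamma> ` I) \<gamma> g"
      using \<gamma> by (auto simp: regular_param_def)
    have "openin (top_of_set I) {s - \<delta><..<s + \<delta>}"
      using sub \<open>open I\<close> by (subst openin_open_eq) auto
    \<comment> \<open>This is where embeddedness enters: a small open arc is relatively open in
      \<open>M\<close>, so some plane neighbourhood of \<open>p\<close> meets no other branch of
      \<open>M\<close>.\<close>
    then have "openin (top_of_set (\<gamma> ` I)) (\<gamma> ` {s - \<delta><..<s + \<delta>})"
      by (rule homeomorphism_imp_open_map[OF hom])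
    moreover have "openin (top_of_set M) (\<gamma> ` I)"
      using \<gamma> by (simp add: regular_param_def)
    ultimately have "openin (top_of_set M) (\<gamma> ` {s - \<delta><..<s + \<delta>})"
      by (rule openin_trans)
    then obtain T where T: "open T" "\<gamma> ` {s - \<delta><..<s + \<delta>} = M \<inter> T"
      by (auto simp: openin_open)
    have "p \<in> M \<inter> T"
      unfolding T(2)[symmetric] using s \<delta>(1) by (intro image_eqI[of _ _ s]) simp_all
    then have "p \<in> T"
      by simp
    have "M \<inter> T \<subseteq> \<gamma> ` {s - \<delta>..s + \<delta>}"
      unfolding T(2)[symmetric] by (intro image_mono) auto
    moreover have "compact (\<gamma> ` {s - \<delta>..s + \<delta>})"
      by (intro compact_continuous_image continuous_on_subset[OF regular_param_continuous_on[OF \<gamma>] sub]) auto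
    ultimately show ?thesis
      using T(1) \<open>p \<in> T\<close> arc_length_compact_finite[OF \<sigma> \<gamma> sub] by (intro exI conjI)
  qed
  then obtain T C where T: "\<And>p. p \<in> K \<Longrightarrow> open (T p)" "\<And>p. p \<in> K \<Longrightarrow> p \<in> T p"
    and C: "\<And>p. p \<in> K \<Longrightarrow> M \<inter> T p \<subseteq> C p" "\<And>p. p \<in> K \<Longrightarrow> compact (C p)"
      "\<And>p. p \<in> K \<Longrightarrow> emeasure \<sigma> (C p) < \<infinity>"
    by metis
  have "K \<subseteq> (\<Union>p\<in>K. T p)"
    using T(2) by blast
  with K(1) T(1) obtain F where F: "F \<subseteq> K" "finite F" "K \<subseteq> (\<Union>p\<in>F. T p)"
    by (rule compactE_image)
  have "K \<subseteq> (\<Union>p\<in>F. C p)"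
  proof
    fix q assume q: "q \<in> K"
    then obtain p where p: "p \<in> F" "q \<in> T p"
      using F(3) by (meson UN_E subsetD)
    then have "q \<in> C p"
      using C(1)[of p] F(1) K(2) q by (meson IntI subsetD)
    then show "q \<in> (\<Union>p\<in>F. C p)"
      using p(1) by (rule UN_I[rotated])
  qed
  moreover have C_sets: "C p \<in> sets \<sigma>" if p: "p \<in> F" for p
    unfolding sets by (rule borel_compact[OF C(2)]) (use F(1) p in \<open>rule subsetD\<close>)
  ultimately have "emeasure \<sigma> K \<le> emeasure \<sigma> (\<Union>p\<in>F. C p)"
    using F(2) by (intro emeasure_mono sets.finite_UN) auto
  also have "\<dots> \<le> (\<Sum>p\<in>F. emeasure \<sigma> (C p))"
    using F(2) C_sets by (intro emeasure_subadditive_finite) auto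
  also have "\<dots> < \<infinity>"
  proof -
    have "emeasure \<sigma> (C p) \<noteq> \<infinity>" if p: "p \<in> F" for p
      using C(3)[OF subsetD[OF F(1) p]] by simp
    then show ?thesis
      by (simp add: less_top[symmetric] F(2))
  qed
  finally show ?thesis .
qed

text \<open>As \<open>\<sigma>\<close> lives on \<open>M\<close>, the density vanishes almost
  everywhere off the compact part of its support in \<open>M\<close>. There it is bounded and the
  length is finite; the support in the plane may well be unbounded.\<close>

lemma smooth_measure_integrable:
  assumes sub: "smooth_curve_submanifold M" and sm: "smooth_measure M \<sigma> \<psi>"
  shows "integrable \<sigma> \<psi>"
proof -
  have \<sigma>: "arc_length_measure M \<sigma>" and cont: "continuous_on UNIV \<psi>"
    and K: "compact (closure {z. \<psi> z \<noteq> 0} \<inter> M)" (is "compact ?K")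
    using sm by (auto simp: smooth_measure_def intro: smooth_on_imp_continuous_on)
  have sets: "sets \<sigma> = sets borel" and M: "AE z in \<sigma>. z \<in> M"
    using \<sigma> by (auto simp: arc_length_measure_def)
  have "bounded (\<psi> ` ?K)"
    by (intro compact_imp_bounded compact_continuous_image K continuous_on_subset[OF cont]) auto
  then obtain B where B: "\<And>z. z \<in> ?K \<Longrightarrow> cmod (\<psi> z) \<le> B"
    unfolding bounded_iff by blast
  show ?thesis
  proof (rule Bochner_Integration.integrable_bound)
    show "integrable \<sigma> (\<lambda>z. B * indicator ?K z :: real)"
      using arc_length_finite_compact[OF sub \<sigma> K] borel_compact[OF K]
      by (intro integrable_mult_right integrable_real_indicator) (auto simp: sets)
    show "\<psi> \<in> borel_measurable \<sigma>"
      using borel_measurable_continuous_onI[OF cont] by (rule borel_measurable_sets_cong[OF sets])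
    show "AE z in \<sigma>. norm (\<psi> z) \<le> norm (B * indicator ?K z :: real)"
    proof (rule AE_mp[OF M], intro AE_I2 impI)
      fix z assume "z \<in> M"
      show "norm (\<psi> z) \<le> norm (B * indicator ?K z :: real)"
      proof (cases "\<psi> z = 0")
        case False
        then have "z \<in> ?K"
          using \<open>z \<in> M\<close> subsetD[OF closure_subset, of z "{z. \<psi> z \<noteq> 0}"] by simp
        then show ?thesis
          using B[of z] by simp
      qed simp
    qed
  qed
qed

text \<open>Parametrized pieces are relatively open, so the Lindelof property of subsets of the
  plane thins them out to countably many. This keeps exceptional null sets countable in
  number.\<close>

lemma countable_param_cover:
  assumes "smooth_curve_submanifold M"
  obtains \<F> :: "(real set \<times> (real \<Rightarrow> real \<times> real)) set" where "countable \<F>"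
    "\<And>I \<gamma>. (I, \<gamma>) \<in> \<F> \<Longrightarrow> regular_param M I \<gamma>" "M \<subseteq> (\<Union>(I, \<gamma>)\<in>\<F>. \<gamma> ` I)"
proof -
  define \<G> where "\<G> = {\<gamma> ` I |I \<gamma>. regular_param M I \<gamma>}"
  have param: "\<exists>I \<gamma>. regular_param M I \<gamma> \<and> S = \<gamma> ` I" if "S \<in> \<G>" for S
    using that unfolding \<G>_def by (simp add: conj_commute)
  then have op: "\<And>S. S \<in> \<G> \<Longrightarrow> openin (top_of_set M) S"
    unfolding regular_param_def by metis
  obtain \<G>' where \<G>': "\<G>' \<subseteq> \<G>" "countable \<G>'" "\<Union>\<G>' = \<Union>\<G>"
    by (rule Lindelof_openin[OF op])
  have "\<exists>I \<gamma>. regular_param M I \<gamma> \<and> S = \<gamma> ` I" if "S \<in> \<G>'" for S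
    using param subsetD[OF \<G>'(1) that] .
  then obtain I \<gamma> where I\<gamma>: "\<And>S. S \<in> \<G>' \<Longrightarrow> regular_param M (I S) (\<gamma> S)"
    "\<And>S. S \<in> \<G>' \<Longrightarrow> S = \<gamma> S ` I S"
    by metis
  show thesis
  proof (rule that[of "(\<lambda>S. (I S, \<gamma> S)) ` \<G>'"])
    show "countable ((\<lambda>S. (I S, \<gamma> S)) ` \<G>')"
      using \<G>'(2) by simp
    show "regular_param M J \<eta>" if "(J, \<eta>) \<in> (\<lambda>S. (I S, \<gamma> S)) ` \<G>'" for J \<eta>
      using that by (elim imageE Pair_inject) (simp add: I\<gamma>(1))
    show "M \<subseteq> (\<Union>(J, \<eta>)\<in>(\<lambda>S. (I S, \<gamma> S)) ` \<G>'. \<eta> ` J)"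
    proof
      fix p assume "p \<in> M"
      then obtain J \<eta> where "regular_param M J \<eta>" "p \<in> \<eta> ` J"
        using assms unfolding smooth_curve_submanifold_def by metis
      then have "p \<in> \<Union>\<G>"
        unfolding \<G>_def by (intro UnionI[of "\<eta> ` J"]) auto
      then obtain S where S: "S \<in> \<G>'" "p \<in> S"
        using \<G>'(3) by (metis UnionE)
      then have "p \<in> \<gamma> S ` I S"
        using I\<gamma>(2) by metis
      then show "p \<in> (\<Union>(J, \<eta>)\<in>(\<lambda>S. (I S, \<gamma> S)) ` \<G>'. \<eta> ` J)"
        using S(1) by (intro UN_I[of "(I S, \<gamma> S)"]) simp_all
    qed
  qed
qed

text \<open>The null set in the parameter rectangle is transferred one variable at a time: for
  almost every \<open>s\<close> the slice in \<open>t\<close> is null, hence null for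
  \<open>\<sigma>\<close> along \<open>\<eta>\<close>, hence for \<open>\<nu>\<close>. Finiteness of
  \<open>\<nu>\<close> makes the slice mass \<open>k\<close> measurable, so the exceptional set
  \<open>B\<close> is Borel and can be tested against \<open>\<sigma>\<close> in each
  parametrization.\<close>

lemma AE_difference_notin:
  assumes sub: "smooth_curve_submanifold M" and ft: "finite_type M" and \<sigma>: "arc_length_measure M \<sigma>"
    and fin: "finite_measure \<nu>" and sets_\<nu>: "sets \<nu> = sets borel"
    and ac: "\<And>A. A \<in> sets borel \<Longrightarrow> emeasure \<sigma> A = 0 \<Longrightarrow> emeasure \<nu> A = 0"
    and N: "N \<in> null_sets lborel"
  shows "AE z in \<nu>. AE z' in \<nu>. z - z' \<notin> N"
proof -
  interpret finite_measure \<nu> by (rule fin)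
  have sets_\<sigma>: "sets \<sigma> = sets borel" and M_\<sigma>: "AE z in \<sigma>. z \<in> M"
    using \<sigma> by (auto simp: arc_length_measure_def)
  have space: "space \<nu> = UNIV" "space \<sigma> = UNIV"
    using sets_eq_imp_space_eq[OF sets_\<nu>] sets_eq_imp_space_eq[OF sets_\<sigma>] by auto
  have AE_\<nu>: "AE z in \<nu>. P z" if ae: "AE z in \<sigma>. P z" for P
  proof -
    obtain A where "{z \<in> space \<sigma>. \<not> P z} \<subseteq> A" "emeasure \<sigma> A = 0" "A \<in> sets \<sigma>"
      by (rule AE_E[OF ae])
    then show ?thesis
      by (intro AE_I[of _ _ A]) (auto simp: sets_\<sigma> sets_\<nu> space intro: ac)
  qed
  have N_borel: "N \<in> sets borel"
    using N by auto
  have "negligible N"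
    using N by (metis negligible_iff_null_sets null_sets_completionI)
  have "sets (\<nu> \<Otimes>\<^sub>M \<nu>) = sets borel"
    unfolding sets_pair_measure_cong[OF sets_\<nu> sets_\<nu>] by (simp only: borel_prod)
  moreover have "(\<lambda>w. fst w - snd w) -` N \<in> sets (borel :: ((real \<times> real) \<times> (real \<times> real)) measure)"
  proof -
    have "(\<lambda>w :: (real \<times> real) \<times> (real \<times> real). fst w - snd w) \<in> borel_measurable borel"
      by (intro borel_measurable_continuous_onI continuous_intros)
    from measurable_sets[OF this N_borel] show ?thesis
      by simp
  qed
  ultimately have D: "(\<lambda>w. fst w - snd w) -` N \<in> sets (\<nu> \<Otimes>\<^sub>M \<nu>)"
    by (simp only:)
  obtain \<F> :: "(real set \<times> (real \<Rightarrow> real \<times> real)) set" where \<F>: "countable \<F>"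
    "\<And>I \<gamma>. (I, \<gamma>) \<in> \<F> \<Longrightarrow> regular_param M I \<gamma>" "M \<subseteq> (\<Union>(I, \<gamma>)\<in>\<F>. \<gamma> ` I)"
    using countable_param_cover[OF sub] by blast
  have cover: "\<exists>w\<in>\<F>. z \<in> snd w ` fst w" if "z \<in> M" for z
    using subsetD[OF \<F>(3) that] by (simp add: split_beta')
  have main: "AE z in \<sigma>. AE z' in \<nu>. z' \<in> \<eta> ` J \<longrightarrow> z - z' \<notin> N" if \<eta>: "regular_param M J \<eta>" for J \<eta>
  proof -
    define A where "A = (UNIV \<times> \<eta> ` J) \<inter> ((\<lambda>w. fst w - snd w) -` N)"
    have J: "\<eta> ` J \<in> sets borel"
      by (rule borel_regular_param_image[OF \<eta>])
    have A: "A \<in> sets (\<nu> \<Otimes>\<^sub>M \<nu>)"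
    proof -
      have "UNIV \<times> \<eta> ` J \<in> sets (\<nu> \<Otimes>\<^sub>M \<nu>)"
        using J sets.top[of \<nu>] by (intro pair_measureI) (auto simp: sets_\<nu> space)
      then show ?thesis
        unfolding A_def using D by auto
    qed
    define k where "k z = emeasure \<nu> (Pair z -` A)" for z
    have "k \<in> borel_measurable \<nu>"
      unfolding k_def by (rule measurable_emeasure_Pair[OF A])
    then have k: "k \<in> borel_measurable borel"
      by (simp add: measurable_cong_sets[OF sets_\<nu> refl])
    define B where "B = {z. k z \<noteq> 0}"
    have B: "B \<in> sets borel"
    proof -
      have "k -` (- {0}) \<inter> space borel \<in> sets borel"
        by (rule measurable_sets[OF k]) auto
      then show ?thesis
        by (simp add: B_def vimage_def)
    qed
    have slice: "Pair z -` A \<in> sets borel" for z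
      using sets_Pair1[OF A, of z] by (simp add: sets_\<nu>)
    have null: "emeasure \<sigma> (B \<inter> \<gamma> ` I) = 0" if \<gamma>: "regular_param M I \<gamma>" for I \<gamma>
    proof (rule arc_length_null_param[OF \<sigma> \<gamma> B])
      have "negligible {(s, t) \<in> I \<times> J. \<gamma> s - \<eta> t \<in> N}"
        using negligible_difference_preimage[OF ft \<gamma> regular_param_image_subset[OF \<gamma>] \<eta>
            regular_param_image_subset[OF \<eta>] \<open>negligible N\<close>] .
      then have "{(s, t) \<in> I \<times> J. \<gamma> s - \<eta> t \<in> N} \<in> null_sets (completion lborel)"
        by (simp add: negligible_iff_null_sets)
      \<comment> \<open>The preimage is known to be null only in the completed measure; a Borel null
        superset makes the almost-everywhere form of Tonelli's theorem applicable.\<close>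
      then obtain Z where Z: "Z \<in> null_sets lborel" "{(s, t) \<in> I \<times> J. \<gamma> s - \<eta> t \<in> N} \<subseteq> Z"
        by (auto simp: null_sets_completion_iff2)
      have "AE w in (lborel \<Otimes>\<^sub>M lborel :: (real \<times> real) measure). w \<notin> Z"
        unfolding lborel_prod by (rule AE_not_in[OF Z(1)])
      then have "AE s in lborel. AE t in lborel. (s, t) \<notin> Z"
        by (rule lborel_pair.AE_pair)
      then show "AE s in lborel. s \<in> I \<longrightarrow> \<gamma> s \<notin> B"
      proof (rule AE_mp, intro AE_I2 impI)
        fix s :: real assume ae: "AE t in lborel. (s, t) \<notin> Z" and s: "s \<in> I"
        have "AE t in lborel. t \<in> J \<longrightarrow> \<eta> t \<notin> Pair (\<gamma> s) -` A"
          using ae by (rule AE_mp) (use Z(2) s in \<open>auto simp: A_def intro!: AE_I2\<close>)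
        then have "emeasure \<sigma> (Pair (\<gamma> s) -` A \<inter> \<eta> ` J) = 0"
          by (rule arc_length_null_param[OF \<sigma> \<eta> slice])
        moreover have "Pair (\<gamma> s) -` A \<inter> \<eta> ` J = Pair (\<gamma> s) -` A"
          by (auto simp: A_def)
        ultimately have "k (\<gamma> s) = 0"
          unfolding k_def by (intro ac slice) simp
        then show "\<gamma> s \<notin> B"
          by (simp add: B_def)
      qed
    qed
    have ae: "AE z in \<sigma>. \<forall>w\<in>\<F>. z \<notin> B \<inter> snd w ` fst w"
    proof (rule AE_ball_countable[OF \<F>(1), THEN iffD2], rule ballI)
      fix w assume "w \<in> \<F>"
      then have w: "regular_param M (fst w) (snd w)"
        using \<F>(2)[of "fst w" "snd w"] by simp
      have "B \<inter> snd w ` fst w \<in> null_sets \<sigma>"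
        using null[OF w] B borel_regular_param_image[OF w] by (intro null_setsI) (auto simp: sets_\<sigma>)
      then show "AE z in \<sigma>. z \<notin> B \<inter> snd w ` fst w"
        by (rule AE_not_in)
    qed
    have ae_k: "AE z in \<sigma>. k z = 0"
    proof (rule AE_mp[OF ae], rule AE_mp[OF M_\<sigma>], intro AE_I2 impI)
      fix z assume "z \<in> M" "\<forall>w\<in>\<F>. z \<notin> B \<inter> snd w ` fst w"
      then show "k z = 0"
        using cover[of z] by (auto simp: B_def)
    qed
    show ?thesis
    proof (rule AE_mp[OF ae_k], rule AE_I2, rule impI)
      fix z assume "k z = 0"
      then have "Pair z -` A \<in> null_sets \<nu>"
        using slice[of z] by (simp add: k_def null_sets_def sets_\<nu>)
      then have "AE z' in \<nu>. z' \<notin> Pair z -` A"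
        by (rule AE_not_in)
      then show "AE z' in \<nu>. z' \<in> \<eta> ` J \<longrightarrow> z - z' \<notin> N"
        by (rule AE_mp) (auto simp: A_def intro!: AE_I2)
    qed
  qed
  have ae: "AE z in \<sigma>. \<forall>w\<in>\<F>. AE z' in \<nu>. z' \<in> snd w ` fst w \<longrightarrow> z - z' \<notin> N"
  proof (rule AE_ball_countable[OF \<F>(1), THEN iffD2], rule ballI)
    fix w assume "w \<in> \<F>"
    then show "AE z in \<sigma>. AE z' in \<nu>. z' \<in> snd w ` fst w \<longrightarrow> z - z' \<notin> N"
      using \<F>(2)[of "fst w" "snd w"] main by simp
  qed
  have "AE z in \<sigma>. AE z' in \<nu>. z - z' \<notin> N"
  proof (rule AE_mp[OF ae], rule AE_I2, rule impI)
    fix z assume "\<forall>w\<in>\<F>. AE z' in \<nu>. z' \<in> snd w ` fst w \<longrightarrow> z - z' \<notin> N"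
    \<comment> \<open>Countability of the cover lets the quantifier over pieces move inside the
      almost-everywhere statement.\<close>
    then have ae: "AE z' in \<nu>. \<forall>w\<in>\<F>. z' \<in> snd w ` fst w \<longrightarrow> z - z' \<notin> N"
      by (rule AE_ball_countable[OF \<F>(1), THEN iffD2])
    show "AE z' in \<nu>. z - z' \<notin> N"
    proof (rule AE_mp[OF ae], rule AE_mp[OF AE_\<nu>[OF M_\<sigma>]], intro AE_I2 impI)
      fix z' assume "z' \<in> M" "\<forall>w\<in>\<F>. z' \<in> snd w ` fst w \<longrightarrow> z - z' \<notin> N"
      then show "z - z' \<notin> N"
        using cover[of z'] by blast
    qed
  qed
  then show ?thesis
    by (rule AE_\<nu>)
qed

text \<open>Splits the complex measure into its total variation and the phase
  \<open>sgn (\<psi> z)\<close>. The iterated almost-everywhere statement says that almost all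
  slices of the preimage are null, which makes the preimage null for the product measure.\<close>

lemma differences_absolutely_continuous:
  assumes sub: "smooth_curve_submanifold M" and ft: "finite_type M" and sm: "smooth_measure M \<sigma> \<psi>"
  shows "absolutely_continuous_differences (density \<sigma> (\<lambda>z. ennreal (cmod (\<psi> z)))) (\<lambda>z. sgn (\<psi> z))"
proof -
  let ?\<nu> = "density \<sigma> (\<lambda>z. ennreal (cmod (\<psi> z)))"
  have \<sigma>: "arc_length_measure M \<sigma>" and cont: "continuous_on UNIV \<psi>"
    using sm by (auto simp: smooth_measure_def intro: smooth_on_imp_continuous_on)
  have sets_\<sigma>: "sets \<sigma> = sets borel"
    using \<sigma> by (auto simp: arc_length_measure_def)
  have \<psi>_meas [measurable]: "\<psi> \<in> borel_measurable borel"
    by (rule borel_measurable_continuous_onI[OF cont])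
  then have [measurable]: "\<psi> \<in> borel_measurable \<sigma>"
    by (rule borel_measurable_sets_cong[OF sets_\<sigma>])
  have fin: "finite_measure ?\<nu>"
    by (rule finite_total_var[OF sets_\<sigma> smooth_measure_integrable[OF sub sm]])
  have sets_\<nu>: "sets ?\<nu> = sets borel"
    by (simp add: sets_\<sigma>)
  have ac: "emeasure ?\<nu> A = 0" if A: "A \<in> sets borel" "emeasure \<sigma> A = 0" for A
  proof -
    have "A \<in> null_sets \<sigma>"
      using A by (auto simp: null_sets_def sets_\<sigma>)
    then have "A \<in> null_sets ?\<nu>"
      using AE_not_in[of A \<sigma>] by (subst null_sets_density_iff) (auto elim!: AE_mp simp: null_sets_def)
    then show ?thesis
      by auto
  qed
  interpret twisted_measure ?\<nu> "\<lambda>z. sgn (\<psi> z)"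
    using fin by (intro twisted_measure.intro twisted_measure_axioms.intro)
      (auto simp: sets_\<sigma> norm_sgn)
  show ?thesis
  proof
    fix N :: "(real \<times> real) set" assume N: "N \<in> null_sets lborel"
    have meas: "{w \<in> space (?\<nu> \<Otimes>\<^sub>M ?\<nu>). fst w - snd w \<in> N} \<in> sets (?\<nu> \<Otimes>\<^sub>M ?\<nu>)"
      using measurable_sets[OF measurable_difference, of N] N by (auto simp: vimage_def Int_def conj_commute)
    have "emeasure (?\<nu> \<Otimes>\<^sub>M ?\<nu>) {w \<in> space (?\<nu> \<Otimes>\<^sub>M ?\<nu>). fst w - snd w \<in> N} =
        (\<integral>\<^sup>+z. emeasure ?\<nu> (Pair z -` {w \<in> space (?\<nu> \<Otimes>\<^sub>M ?\<nu>). fst w - snd w \<in> N}) \<partial>?\<nu>)"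
      by (rule emeasure_pair_measure_alt[OF meas])
    also have "\<dots> = (\<integral>\<^sup>+z. 0 \<partial>?\<nu>)"
    proof (rule nn_integral_cong_AE,
        rule AE_mp[OF AE_difference_notin[OF sub ft \<sigma> fin sets_\<nu> _ N]], rule ac, assumption+,
        intro AE_I2 impI)
      fix z assume "AE z' in ?\<nu>. z - z' \<notin> N"
      then have "AE z' in ?\<nu>. z' \<notin> Pair z -` {w \<in> space (?\<nu> \<Otimes>\<^sub>M ?\<nu>). fst w - snd w \<in> N}"
        by (rule AE_mp) (auto intro!: AE_I2)
      then show "emeasure ?\<nu> (Pair z -` {w \<in> space (?\<nu> \<Otimes>\<^sub>M ?\<nu>). fst w - snd w \<in> N}) = 0"
        by (rule AE_iff_measurable[OF sets_Pair1[OF meas], THEN iffD1, rotated]) (auto simp: space_pair_measure)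
    qed
    finally show "emeasure (?\<nu> \<Otimes>\<^sub>M ?\<nu>) {w \<in> space (?\<nu> \<Otimes>\<^sub>M ?\<nu>). fst w - snd w \<in> N} = 0"
      by simp
  qed
qed

section \<open>Linearity of the Weyl transform on classes and compactness\<close>

lemma cscale_abs_L2: "square_integrable f \<Longrightarrow> cscale_L2 c (abs_L2 f) = abs_L2 (\<lambda>t. c * f t)"
  by (simp add: cscale_L2.abs_eq L2_rel_refl)

lemma plus_abs_L2:
  "square_integrable f \<Longrightarrow> square_integrable g \<Longrightarrow> abs_L2 f + abs_L2 g = abs_L2 (\<lambda>t. f t + g t)"
  by (simp add: plus_L2.abs_eq L2_rel_refl)

lemma abs_L2_eqI:
  assumes "square_integrable f" "square_integrable g" "AE t in lborel. f t = g t"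
  shows "abs_L2 f = abs_L2 g"
  by (rule Quotient3_rel_abs[OF Quotient3_L2]) (use assms in \<open>simp add: L2_rel_def\<close>)

lemma weyl_transform_cscale:
  assumes "sets \<sigma> = sets borel" "integrable \<sigma> \<psi>"
  shows "weyl_transform \<sigma> \<psi> (cscale_L2 c \<phi>) = cscale_L2 c (weyl_transform \<sigma> \<psi> \<phi>)"
proof -
  define f where "f = rep_L2 \<phi>"
  have f: "square_integrable f" "\<phi> = abs_L2 f"
    by (simp_all add: f_def square_integrable_rep_L2 abs_rep_L2)
  \<comment> \<open>Unlike additivity, this holds at every \<open>t\<close>: where the integral
    diverges, both sides are 0 by the convention for Bochner integrals.\<close>
  have "weyl_fun \<sigma> \<psi> (\<lambda>t. c * f t) = (\<lambda>t. c * weyl_fun \<sigma> \<psi> f t)"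
  proof
    fix t
    have "weyl_fun \<sigma> \<psi> (\<lambda>t. c * f t) t = (\<integral>w. c * (case w of (x, y) \<Rightarrow>
        exp (of_real pi * \<i> * of_real (x * y + 2 * y * t)) * f (t + x) * \<psi> (x, y)) \<partial>\<sigma>)"
      unfolding weyl_fun_def by (rule Bochner_Integration.integral_cong) (auto simp: mult_ac)
    also have "\<dots> = c * weyl_fun \<sigma> \<psi> f t"
      unfolding weyl_fun_def by (rule integral_mult_right_zero)
    finally show "weyl_fun \<sigma> \<psi> (\<lambda>t. c * f t) t = c * weyl_fun \<sigma> \<psi> f t" .
  qed
  then show ?thesis
    using f square_integrable_weyl_fun[OF assms f(1)]
    by (simp add: cscale_abs_L2 weyl_transform_abs[OF assms] square_integrable_cmult)
qed

text \<open>The integral is split where both summands are integrable, hence at almost every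
  \<open>t\<close>, which is all that equality of classes requires.\<close>

lemma weyl_transform_add:
  assumes "sets \<sigma> = sets borel" "integrable \<sigma> \<psi>"
  shows "weyl_transform \<sigma> \<psi> (\<phi> + \<xi>) = weyl_transform \<sigma> \<psi> \<phi> + weyl_transform \<sigma> \<psi> \<xi>"
proof -
  define f g where "f = rep_L2 \<phi>" and "g = rep_L2 \<xi>"
  have f: "square_integrable f" "\<phi> = abs_L2 f" and g: "square_integrable g" "\<xi> = abs_L2 g"
    by (simp_all add: f_def g_def square_integrable_rep_L2 abs_rep_L2)
  have "AE t in lborel. weyl_fun \<sigma> \<psi> (\<lambda>t. f t + g t) t = weyl_fun \<sigma> \<psi> f t + weyl_fun \<sigma> \<psi> g t"
  proof (rule AE_mp[OF weyl_fun_integrable[OF assms f(1)]],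
      rule AE_mp[OF weyl_fun_integrable[OF assms g(1)]], intro AE_I2 impI)
    fix t
    let ?k = "\<lambda>f. \<lambda>(x, y). exp (of_real pi * \<i> * of_real (x * y + 2 * y * t)) * f (t + x) * \<psi> (x, y)"
    assume int: "integrable \<sigma> (?k g)" "integrable \<sigma> (?k f)"
    have "weyl_fun \<sigma> \<psi> (\<lambda>t. f t + g t) t = (\<integral>w. ?k f w + ?k g w \<partial>\<sigma>)"
      unfolding weyl_fun_def
      by (rule Bochner_Integration.integral_cong) (auto simp: distrib_left distrib_right)
    also have "\<dots> = weyl_fun \<sigma> \<psi> f t + weyl_fun \<sigma> \<psi> g t"
      unfolding weyl_fun_def by (rule Bochner_Integration.integral_add[OF int(2,1)])
    finally show "weyl_fun \<sigma> \<psi> (\<lambda>t. f t + g t) t = weyl_fun \<sigma> \<psi> f t + weyl_fun \<sigma> \<psi> g t" .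
  qed
  then have "abs_L2 (weyl_fun \<sigma> \<psi> (\<lambda>t. f t + g t)) = abs_L2 (\<lambda>t. weyl_fun \<sigma> \<psi> f t + weyl_fun \<sigma> \<psi> g t)"
    by (intro abs_L2_eqI square_integrable_weyl_fun[OF assms] square_integrable_add f(1) g(1))
  then show ?thesis
    using f g square_integrable_weyl_fun[OF assms f(1)] square_integrable_weyl_fun[OF assms g(1)]
    by (simp add: plus_abs_L2 weyl_transform_abs[OF assms] square_integrable_add)
qed

lemma norm_weyl_transform:
  assumes "sets \<sigma> = sets borel" "integrable \<sigma> \<psi>"
  shows "(norm (weyl_transform \<sigma> \<psi> \<phi>))\<^sup>2 = (\<integral>t. (cmod (weyl_fun \<sigma> \<psi> (rep_L2 \<phi>) t))\<^sup>2 \<partial>lborel)"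
  unfolding weyl_transform_def
  by (rule norm_abs_L2[OF square_integrable_weyl_fun[OF assms square_integrable_rep_L2]])

theorem theorem4p1:
  fixes M :: "(real \<times> real) set"
    and \<sigma> :: "(real \<times> real) measure"
    and \<psi> :: "real \<times> real \<Rightarrow> complex"
  assumes "smooth_curve_submanifold M"
    and "connected M"
    and "finite_type M"
    and "smooth_measure M \<sigma> \<psi>"
  shows "compact_operator (weyl_transform \<sigma> \<psi>)"
proof -
  let ?\<nu> = "density \<sigma> (\<lambda>z. ennreal (cmod (\<psi> z)))" and ?W = "weyl_transform \<sigma> \<psi>"
  have sets: "sets \<sigma> = sets borel"
    using assms(4) by (simp add: smooth_measure_def arc_length_measure_def)
  have int: "integrable \<sigma> \<psi>"
    by (rule smooth_measure_integrable[OF assms(1,4)])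
  interpret absolutely_continuous_differences ?\<nu> "\<lambda>z. sgn (\<psi> z)"
    by (rule differences_absolutely_continuous[OF assms(1,3,4)])
  have weyl_eq: "weyl_fun \<sigma> \<psi> f = weyl f" if "square_integrable f" for f
  proof -
    have "f \<in> borel_measurable borel"
      using that by (simp add: square_integrable_def)
    then show ?thesis
      by (simp add: fun_eq_iff weyl_fun_eq[OF sets int] weyl_def phased_def cis_pi_def)
  qed
  have norm_W: "(norm (?W \<phi>))\<^sup>2 = (\<integral>t. (cmod (weyl (rep_L2 \<phi>) t))\<^sup>2 \<partial>lborel)" for \<phi>
    using norm_weyl_transform[OF sets int] by (simp add: weyl_eq square_integrable_rep_L2)
  define m where "m = measure (?\<nu> \<Otimes>\<^sub>M ?\<nu>) (space (?\<nu> \<Otimes>\<^sub>M ?\<nu>))"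
  have bl: "bounded_linear ?W"
  proof (rule bounded_linear_intro)
    fix \<phi> \<xi> :: L2 and r :: real
    show "?W (\<phi> + \<xi>) = ?W \<phi> + ?W \<xi>"
      by (rule weyl_transform_add[OF sets int])
    show "?W (r *\<^sub>R \<phi>) = r *\<^sub>R ?W \<phi>"
      unfolding scaleR_L2_def by (rule weyl_transform_cscale[OF sets int])
    have "(norm (?W \<phi>))\<^sup>2 \<le> m * (norm \<phi>)\<^sup>2"
      using energy_bound[OF square_integrable_rep_L2, of \<phi>] norm_abs_L2[OF square_integrable_rep_L2, of \<phi>]
      by (simp add: norm_W m_def abs_rep_L2)
    then have "norm (?W \<phi>) \<le> sqrt (m * (norm \<phi>)\<^sup>2)"
      by (rule real_le_rsqrt)
    then show "norm (?W \<phi>) \<le> norm \<phi> * sqrt m"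
      by (simp add: real_sqrt_mult mult.commute)
  qed
  \<comment> \<open>The counting bound is applied at level \<open>\<epsilon>\<^sup>2\<close>,
    because the energy is the square of the norm.\<close>
  have few: "\<exists>N. \<forall>E. finite E \<longrightarrow> orthonormal_set E \<longrightarrow> (\<forall>e\<in>E. \<epsilon> \<le> norm (?W e)) \<longrightarrow> card E \<le> N"
    if "\<epsilon> > 0" for \<epsilon>
  proof -
    have "\<epsilon>\<^sup>2 > 0"
      using that by simp
    then obtain N where N: "\<And>E. \<lbrakk>finite E; orthonormal_set E;
        \<And>e. e \<in> E \<Longrightarrow> \<epsilon>\<^sup>2 \<le> (\<integral>t. (cmod (weyl (rep_L2 e) t))\<^sup>2 \<partial>lborel)\<rbrakk> \<Longrightarrow> card E \<le> N"
      by (rule weyl_card) blast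
    have "card E \<le> N" if E: "finite E" "orthonormal_set E" "\<forall>e\<in>E. \<epsilon> \<le> norm (?W e)" for E
    proof (rule N[OF E(1,2)])
      fix e assume "e \<in> E"
      then show "\<epsilon>\<^sup>2 \<le> (\<integral>t. (cmod (weyl (rep_L2 e) t))\<^sup>2 \<partial>lborel)"
        using E(3) \<open>\<epsilon> > 0\<close> unfolding norm_W[symmetric] by (intro power_mono) auto
    qed
    then show ?thesis
      by blast
  qed
  have "compact (closure (?W ` cball 0 1))"
    unfolding compact_eq_totally_bounded
  proof (intro conjI allI impI)
    show "complete (closure (?W ` cball 0 1))"
      using complete_closed_subset[OF closed_closure subset_UNIV complete_UNIV_L2] .
    fix \<epsilon> :: real assume "\<epsilon> > 0"
    \<comment> \<open>Points of the closure may lie on the boundary of the balls of a net; radius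
      \<open>\<epsilon> / 2\<close> leaves room to pass through closed balls, whose finite union is
      closed, to open balls of radius \<open>\<epsilon>\<close>.\<close>
    then obtain k where k: "finite k" "?W ` cball 0 1 \<subseteq> (\<Union>x\<in>k. ball x (\<epsilon> / 2))"
      using totally_bounded_image_cball[OF bl few, of "\<epsilon> / 2"] by auto
    have "closure (?W ` cball 0 1) \<subseteq> (\<Union>x\<in>k. cball x (\<epsilon> / 2))"
    proof (rule closure_minimal)
      show "?W ` cball 0 1 \<subseteq> (\<Union>x\<in>k. cball x (\<epsilon> / 2))"
        using k(2) by (fastforce intro: less_imp_le)
      show "closed (\<Union>x\<in>k. cball x (\<epsilon> / 2))"
        using k(1) by (intro closed_UN) auto
    qed
    also have "\<dots> \<subseteq> (\<Union>x\<in>k. ball x \<epsilon>)"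
      using \<open>\<epsilon> > 0\<close> by fastforce
    finally show "\<exists>k. finite k \<and> closure (?W ` cball 0 1) \<subseteq> (\<Union>x\<in>k. ball x \<epsilon>)"
      using k(1) by blast
  qed
  then show ?thesis
    unfolding compact_operator_def using bl weyl_transform_cscale[OF sets int] by blast
qed

end
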